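(* Let $(X,d,\mathfrak m)$ be a metric measure space, $p\in(1,\infty)$, let $\varnothing\neq\Omega\subset X$ be open and let $u\in W^{1,p}_{loc}(\Omega)$ be such that $\mathfrak m(\{u>t\})<\infty$ for all $t>\operatorname{ess\,inf}u$. Let $I\subset\mathbb R$ be an open interval, $g:I\to(0,\infty)$ continuous and $\omega=g\,\mathcal L^1|_I$, and assume $\mathfrak m(\Omega)\le\omega(\mathbb R)$, $\omega((-\infty,x])<\infty$ for all $x\in I$, and $\lim_{x\to-\infty}\omega((-\infty,x])=0$. Let $u^*:\Omega^*\to\mathbb R$ be the decreasing rearrangement of $u$ with respect to $\omega$. Suppose that for some constants $\mathsf C,\varepsilon>0$ $$\mathrm{Per}(E,\Omega)\ge \mathsf C\cdot \mathcal I^\flat_g(\mathfrak m(E))\qquad\text{for all Borel } E\subset(\operatorname{supp}(u))^\varepsilon\cap\Omega\ \text{ with }\mathfrak m(E)<\infty .$$ Then $$\int_\Omega|Du|_p^p\,d\mathfrak m\ \ge\ \mathsf C^p\int_{\Omega^*}|(u^* )'|^p\,d\omega ,$$ and moreover, if the left-hand side is finite, then $u^*$ is locally absolutely continuous in $\Omega^*$.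
   Context: Metric measure space: $(X,d)$ complete and separable, $\mathfrak m\ne0$ a non-negative Borel measure finite on bounded sets, with $\operatorname{supp}\mathfrak m=X$. $A^\varepsilon$ is the open $\varepsilon$-neighbourhood of $A$. Sobolev functions: $\mathrm{lip}\,u$ is the local Lipschitz constant. For $u\in L^p(X)$, $\mathrm{Ch}_p(u)=\inf\{\liminf_n\int(\mathrm{lip}\,u_n)^p\,d\mathfrak m:\ u_n\in\mathrm{Lip}(X),\ u_n\to u\text{ in }L^p(X)\}$; $u\in W^{1,p}(X)$ iff $u\in L^p(X)$ and $\mathrm{Ch}_p(u)<\infty$, and then $\mathrm{Ch}_p(u)=\int|Du|_p^p\,d\mathfrak m$ where $|Du|_p\in L^p(X)$ is the minimal $p$-weak upper gradient. $u\in W^{1,p}_{loc}(\Omega)$ means: $u\in L^p_{loc}(\Omega)$ and $\eta u\in W^{1,p}(X)$ (extended by zero) for every Lipschitz $\eta$ with bounded support contained in $\Omega$; $|Du|_p:=|D(\eta u)|_p$ a.e. on $\{\eta=1\}$. Perimeter: for $v\in L^1_{loc}(\Omega)$ and $U\subset\Omega$ open, $|\mathbf Dv|(U)=\inf\{\liminf_n\int_U\mathrm{lip}\,v_n\,d\mathfrak m:\ v_n\in\mathrm{Lip}_{loc}(U),\ v_n\to v\text{ in }L^1_{loc}(U)\}$; $\mathrm{Per}(E,U)=|\mathbf D\chi_E|(U)$ (possibly $+\infty$). Rearrangement: $\mu(t)=\mathfrak m(\{u>t\})$ for $t>\operatorname{ess\,inf}u$; $u^\#(0)=\operatorname{ess\,sup}u$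 and $u^\#(s)=\inf\{t>\operatorname{ess\,inf}u:\mu(t)<s\}$ for $s>0$. $F_\omega(x)=\omega((-\infty,x))$, $l^*=\inf\{l:F_\omega(l)>0\}$, $r^*=\sup\{r:F_\omega(r)<\mathfrak m(\Omega)\}$, $\Omega^*=(l^*,r^* )$, and $u^*(x)=u^\#(F_\omega(x))$ for $x\in\Omega^*$; $u^*$ is non-increasing, and $(u^* )'$ is its a.e. derivative. Profile: $F_\omega$ restricted to $I$ is strictly increasing with inverse $F_g^{-1}:(0,\omega(\mathbb R))\to I$; $\mathcal I^\flat_g(v)=g(F_g^{-1}(v))$ for $0<v<\omega(\mathbb R)$, $\mathcal I^\flat_g(0)=0$, and (if $\omega(\mathbb R)<\infty$) $\mathcal I^\flat_g(\omega(\mathbb R))=0$. The convention $\infty\le\infty$ is used in $\mathfrak m(\Omega)\le\omega(\mathbb R)$.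
   Formalization: supp(u) is taken as the support of u − ess inf u (closure of {u > ess inf u} up to null sets), since with the usual support {u ≠ 0} the claim fails when ess inf u < 0; for u ≥ 0 the stated claim is covered. *)

theory Defs
  imports "HOL-Analysis.Analysis" "HOL-Probability.Essential_Supremum"
begin

section \<open>Metric measure spaces\<close>

text \<open>The metric space is the whole of a type of class \<^class>\<open>polish_space\<close> (complete metric and
  second countable, i.e. complete and separable).\<close>

definition measure_support :: "'a::metric_space measure \<Rightarrow> 'a set" where
  "measure_support m = {x. \<forall>r>0. emeasure m (ball x r) > 0}"

definition metric_measure_space :: "'a::polish_space measure \<Rightarrow> bool" where
  "metric_measure_space m \<longleftrightarrow>
     sets m = sets borel \<and>
     emeasure m UNIV \<noteq> 0 \<and>
     (\<forall>B\<in>sets borel. bounded B \<longrightarrow> emeasure m B < \<infinity>) \<and>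
     measure_support m = UNIV"

definition open_nbhd :: "real \<Rightarrow> 'a::metric_space set \<Rightarrow> 'a set" where
  "open_nbhd \<epsilon> A = (\<Union>a\<in>A. ball a \<epsilon>)"

section \<open>Lipschitz functions\<close>

definition lipschitz_fun :: "('a::metric_space \<Rightarrow> real) \<Rightarrow> bool" where
  "lipschitz_fun u \<longleftrightarrow> (\<exists>L. L-lipschitz_on UNIV u)"

definition loc_lipschitz :: "'a::metric_space set \<Rightarrow> ('a \<Rightarrow> real) \<Rightarrow> bool" where
  "loc_lipschitz U u \<longleftrightarrow> (\<forall>x\<in>U. \<exists>r>0. \<exists>L. L-lipschitz_on (ball x r \<inter> U) u)"

text \<open>The \<open>Limsup\<close> is finite wherever \<open>u\<close> is locally Lipschitz, which is where \<open>lip\<close> is used. At an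
  isolated point \<open>at x\<close> is the bottom filter, so that \<open>lip u x = 0\<close>.\<close>

definition lip :: "('a::metric_space \<Rightarrow> real) \<Rightarrow> 'a \<Rightarrow> real" where
  "lip u x = enn2real (Limsup (at x) (\<lambda>y. ennreal (\<bar>u y - u x\<bar> / dist y x)))"

section \<open>Lebesgue spaces\<close>

definition in_Lp :: "real \<Rightarrow> 'a measure \<Rightarrow> ('a \<Rightarrow> real) \<Rightarrow> bool" where
  "in_Lp p m u \<longleftrightarrow>
     u \<in> borel_measurable m \<and> (\<integral>\<^sup>+x. ennreal (\<bar>u x\<bar> powr p) \<partial>m) < \<infinity>"

definition tendsto_Lp :: "real \<Rightarrow> 'a measure \<Rightarrow> (nat \<Rightarrow> 'a \<Rightarrow> real) \<Rightarrow> ('a \<Rightarrow> real) \<Rightarrow> bool" where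
  "tendsto_Lp p m w u \<longleftrightarrow>
     (\<lambda>n. \<integral>\<^sup>+x. ennreal (\<bar>w n x - u x\<bar> powr p) \<partial>m) \<longlonglongrightarrow> 0"

text \<open>As for \<open>loc_lipschitz\<close>, a property holds locally in an open set \<open>U\<close> if it holds in a
  neighbourhood of each point of \<open>U\<close>.\<close>

definition in_Lp_loc :: "real \<Rightarrow> 'a::metric_space measure \<Rightarrow> 'a set \<Rightarrow> ('a \<Rightarrow> real) \<Rightarrow> bool" where
  "in_Lp_loc p m U u \<longleftrightarrow>
     u \<in> borel_measurable (restrict_space m U) \<and>
     (\<forall>x\<in>U. \<exists>r>0. ball x r \<subseteq> U \<and> (\<integral>\<^sup>+y\<in>ball x r. ennreal (\<bar>u y\<bar> powr p) \<partial>m) < \<infinity>)"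

definition tendsto_L1_loc ::
    "'a::metric_space measure \<Rightarrow> 'a set \<Rightarrow> (nat \<Rightarrow> 'a \<Rightarrow> real) \<Rightarrow> ('a \<Rightarrow> real) \<Rightarrow> bool" where
  "tendsto_L1_loc m U w v \<longleftrightarrow>
     (\<forall>x\<in>U. \<exists>r>0. ball x r \<subseteq> U \<and>
        (\<lambda>n. \<integral>\<^sup>+y\<in>ball x r. ennreal \<bar>w n y - v y\<bar> \<partial>m) \<longlonglongrightarrow> 0)"

section \<open>Sobolev functions\<close>

definition Cheeger :: "real \<Rightarrow> 'a::metric_space measure \<Rightarrow> ('a \<Rightarrow> real) \<Rightarrow> ennreal" where
  "Cheeger p m u =
     Inf {liminf (\<lambda>n. \<integral>\<^sup>+x. ennreal (lip (w n) x powr p) \<partial>m) | w.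
            (\<forall>n. lipschitz_fun (w n)) \<and> tendsto_Lp p m w u}"

definition W1p :: "real \<Rightarrow> 'a::metric_space measure \<Rightarrow> ('a \<Rightarrow> real) \<Rightarrow> bool" where
  "W1p p m u \<longleftrightarrow> in_Lp p m u \<and> Cheeger p m u < \<infinity>"

text \<open>Weak upper gradients in the sense of the relaxation that defines \<open>Cheeger\<close> (J. Cheeger;
  L. Ambrosio, N. Gigli and G. Savare): \<open>G\<close> is an \<open>L\<^sup>p\<close>-limit of upper bounds \<open>g n\<close> for the local
  Lipschitz constants of Lipschitz functions \<open>w n\<close> converging to \<open>u\<close> in \<open>L\<^sup>p\<close>. For \<open>1 < p < \<infinity>\<close>, by
  Mazur's lemma, this amounts to \<open>G\<close> being a.e. at least some weak \<open>L\<^sup>p\<close>-limit of \<open>lip (w n)\<close>.\<close>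

definition weak_upper_gradient ::
    "real \<Rightarrow> 'a::metric_space measure \<Rightarrow> ('a \<Rightarrow> real) \<Rightarrow> ('a \<Rightarrow> real) \<Rightarrow> bool" where
  "weak_upper_gradient p m u G \<longleftrightarrow>
     in_Lp p m G \<and> (AE x in m. 0 \<le> G x) \<and>
     (\<exists>w g. (\<forall>n. lipschitz_fun (w n)) \<and> tendsto_Lp p m w u \<and>
            (\<forall>n. in_Lp p m (g n)) \<and> tendsto_Lp p m g G \<and>
            (\<forall>n. AE x in m. lip (w n) x \<le> g n x))"

text \<open>The minimal weak upper gradient \<open>|Du|\<^sub>p\<close> is unique up to a.e. equality only, so it is a relation
  between \<open>u\<close> and the representatives \<open>G\<close>.\<close>

definition minimal_weak_upper_gradient ::
    "real \<Rightarrow> 'a::metric_space measure \<Rightarrow> ('a \<Rightarrow> real) \<Rightarrow> ('a \<Rightarrow> real) \<Rightarrow> bool" where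
  "minimal_weak_upper_gradient p m u G \<longleftrightarrow>
     weak_upper_gradient p m u G \<and>
     (\<forall>H. weak_upper_gradient p m u H \<longrightarrow> (AE x in m. G x \<le> H x))"

definition cutoffs :: "'a::metric_space set \<Rightarrow> ('a \<Rightarrow> real) set" where
  "cutoffs \<Omega> = {\<eta>. lipschitz_fun \<eta> \<and> bounded {x. \<eta> x \<noteq> 0} \<and> closure {x. \<eta> x \<noteq> 0} \<subseteq> \<Omega>}"

definition zero_extend :: "'a set \<Rightarrow> ('a \<Rightarrow> real) \<Rightarrow> 'a \<Rightarrow> real" where
  "zero_extend \<Omega> f x = (if x \<in> \<Omega> then f x else 0)"

definition W1p_loc :: "real \<Rightarrow> 'a::metric_space measure \<Rightarrow> 'a set \<Rightarrow> ('a \<Rightarrow> real) \<Rightarrow> bool" where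
  "W1p_loc p m \<Omega> u \<longleftrightarrow>
     in_Lp_loc p m \<Omega> u \<and>
     (\<forall>\<eta>\<in>cutoffs \<Omega>. W1p p m (zero_extend \<Omega> (\<lambda>x. \<eta> x * u x)))"

text \<open>\<open>G\<close> is a representative on \<open>\<Omega>\<close> of \<open>|Du|\<^sub>p\<close>. The sets \<open>{\<eta> = 1}\<close> of countably many cutoffs cover
  \<open>\<Omega>\<close>, so \<open>G\<close> is determined a.e. on \<open>\<Omega>\<close>.\<close>

definition local_minimal_weak_upper_gradient ::
    "real \<Rightarrow> 'a::metric_space measure \<Rightarrow> 'a set \<Rightarrow> ('a \<Rightarrow> real) \<Rightarrow> ('a \<Rightarrow> real) \<Rightarrow> bool" where
  "local_minimal_weak_upper_gradient p m \<Omega> u G \<longleftrightarrow>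
     G \<in> borel_measurable (restrict_space m \<Omega>) \<and>
     (\<forall>\<eta>\<in>cutoffs \<Omega>. \<exists>D.
        minimal_weak_upper_gradient p m (zero_extend \<Omega> (\<lambda>x. \<eta> x * u x)) D \<and>
        (AE x in m. \<eta> x = 1 \<longrightarrow> G x = D x))"

section \<open>Perimeter\<close>

definition total_variation :: "'a::metric_space measure \<Rightarrow> ('a \<Rightarrow> real) \<Rightarrow> 'a set \<Rightarrow> ennreal" where
  "total_variation m v U =
     Inf {liminf (\<lambda>n. \<integral>\<^sup>+x\<in>U. ennreal (lip (w n) x) \<partial>m) | w.
            (\<forall>n. loc_lipschitz U (w n)) \<and> tendsto_L1_loc m U w v}"

definition Per :: "'a::metric_space measure \<Rightarrow> 'a set \<Rightarrow> 'a set \<Rightarrow> ennreal" where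
  "Per m E U = total_variation m (indicator E) U"

section \<open>Decreasing rearrangement\<close>

definition weighted_measure :: "real set \<Rightarrow> (real \<Rightarrow> real) \<Rightarrow> real measure" where
  "weighted_measure I g = density lborel (\<lambda>x. ennreal (g x) * indicator I x)"

definition cdf_left :: "real measure \<Rightarrow> real \<Rightarrow> ennreal" where
  "cdf_left \<omega> x = emeasure \<omega> {..<x}"

definition ess_inf :: "'a measure \<Rightarrow> 'a set \<Rightarrow> ('a \<Rightarrow> real) \<Rightarrow> ereal" where
  "ess_inf m \<Omega> u = Liminf (ae_filter (restrict_space m \<Omega>)) (\<lambda>x. ereal (u x))"

text \<open>The support of \<open>u\<close> is taken relative to the base level \<open>ess inf u\<close>, i.e. it is the support of the
  a.e.-class of \<open>u - ess inf u\<close>; if \<open>ess inf u = 0\<close> this is the usual support of \<open>u\<close>, and if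
  \<open>ess inf u > 0\<close> it is contained in it. All the superlevel sets \<open>{u > t}\<close>, \<open>t > ess inf u\<close>, that define
  the rearrangement are contained in it up to null sets. With \<open>{u \<noteq> 0}\<close> in place of
  \<open>{u > ess inf u}\<close> this would fail if \<open>ess inf u < 0\<close>, and an isoperimetric inequality near
  \<open>{u \<noteq> 0}\<close> would not control the rearrangement: on \<open>\<Omega> = (0,10) \<subseteq> \<real>\<close> let \<open>u = -1\<close> on
  \<open>(0,1/2)\<close>, \<open>u x = 2 * (x - 1)\<close> on \<open>(1/2,1)\<close> and \<open>u = 0\<close> on \<open>[1,10)\<close>, and take a profile equal to 1
  on \<open>(0,2)\<close> and to \<open>K > 1\<close> on \<open>(8,10)\<close>. Then the perimeter in \<open>\<Omega>\<close> dominates the profile for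
  \<open>E \<subseteq> (0,3/2)\<close>, but the rearrangement has \<open>K powr p\<close> times the energy of \<open>u\<close>.\<close>

definition ess_supp :: "'a::metric_space measure \<Rightarrow> 'a set \<Rightarrow> ('a \<Rightarrow> real) \<Rightarrow> 'a set" where
  "ess_supp m \<Omega> u =
     {x. \<forall>r>0. emeasure m {y \<in> ball x r \<inter> \<Omega>. ereal (u y) > ess_inf m \<Omega> u} > 0}"

definition ess_sup :: "'a measure \<Rightarrow> 'a set \<Rightarrow> ('a \<Rightarrow> real) \<Rightarrow> ereal" where
  "ess_sup m \<Omega> u = esssup (restrict_space m \<Omega>) (\<lambda>x. ereal (u x))"

definition distr_fun :: "'a measure \<Rightarrow> 'a set \<Rightarrow> ('a \<Rightarrow> real) \<Rightarrow> real \<Rightarrow> ennreal" where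
  "distr_fun m \<Omega> u t = emeasure m {x\<in>\<Omega>. u x > t}"

definition usharp :: "'a measure \<Rightarrow> 'a set \<Rightarrow> ('a \<Rightarrow> real) \<Rightarrow> ennreal \<Rightarrow> ereal" where
  "usharp m \<Omega> u s =
     (if s = 0 then ess_sup m \<Omega> u
      else Inf {ereal t | t. ess_inf m \<Omega> u < ereal t \<and> distr_fun m \<Omega> u t < s})"

definition Omega_star :: "'a measure \<Rightarrow> 'a set \<Rightarrow> real measure \<Rightarrow> real set" where
  "Omega_star m \<Omega> \<omega> =
     {x. Inf {ereal l | l. cdf_left \<omega> l > 0} < ereal x \<and>
         ereal x < Sup {ereal r | r. cdf_left \<omega> r < emeasure m \<Omega>}}"

text \<open>On \<open>Omega_star\<close> the value of \<open>usharp\<close> is finite; elsewhere \<open>ustar\<close> has no meaning.\<close>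

definition ustar :: "'a measure \<Rightarrow> 'a set \<Rightarrow> ('a \<Rightarrow> real) \<Rightarrow> real measure \<Rightarrow> real \<Rightarrow> real" where
  "ustar m \<Omega> u \<omega> x = real_of_ereal (usharp m \<Omega> u (cdf_left \<omega> x))"

section \<open>Isoperimetric profile\<close>

text \<open>The value at \<open>\<infinity>\<close>, relevant only when \<open>\<omega>\<close> is infinite, is a dummy.\<close>

definition profile :: "real set \<Rightarrow> (real \<Rightarrow> real) \<Rightarrow> ennreal \<Rightarrow> real" where
  "profile I g v =
     (let \<omega> = weighted_measure I g in
      if 0 < v \<and> v < emeasure \<omega> UNIV then g (the_inv_into I (cdf_left \<omega>) v) else 0)"

section \<open>Local absolute continuity\<close>

definition abs_continuous_on :: "real \<Rightarrow> real \<Rightarrow> (real \<Rightarrow> real) \<Rightarrow> bool" where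
  "abs_continuous_on a b f \<longleftrightarrow>
     (\<forall>e>0. \<exists>d>0. \<forall>(n::nat) \<alpha> \<beta>.
        (\<forall>i<n. a \<le> \<alpha> i \<and> \<alpha> i \<le> \<beta> i \<and> \<beta> i \<le> b) \<and>
        disjoint_family_on (\<lambda>i. {\<alpha> i<..<\<beta> i}) {..<n} \<and>
        (\<Sum>i<n. \<beta> i - \<alpha> i) < d \<longrightarrow>
        (\<Sum>i<n. \<bar>f (\<beta> i) - f (\<alpha> i)\<bar>) < e)"

definition loc_abs_continuous_on :: "real set \<Rightarrow> (real \<Rightarrow> real) \<Rightarrow> bool" where
  "loc_abs_continuous_on J f \<longleftrightarrow>
     (\<forall>a b. a \<le> b \<and> {a..b} \<subseteq> J \<longrightarrow> abs_continuous_on a b f)"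

end

theory Submission
  imports Defs
begin

text \<open>Partitions of unity turn the approximations that define \<open>|Du|\<close> into locally Lipschitz functions
  on \<open>\<Omega>\<close> (Meyers--Serrin). Composing these with steep ramps and integrating over the levels gives the
  coarea inequality: the least perimeter of the sets \<open>{u > r}\<close>, \<open>s < r < t\<close>, is at most
  \<open>(\<integral>\<^bsub>{s \<le> u \<le> t}\<^esub> |Du|) / (t - s)\<close>. For \<open>a < b\<close> in \<open>\<Omega>\<^sup>*\<close> and \<open>r\<close> between \<open>u\<^sup>*(b)\<close> and \<open>u\<^sup>*(a)\<close>, the
  measure of \<open>{u > r}\<close> lies between \<open>F(a)\<close> and \<open>F(b)\<close>, so the isoperimetric inequality bounds the
  perimeter below by \<open>C min\<^bsub>[a,b]\<^esub> g\<close>. Replacing \<open>|Du|\<close> by its Young bound \<open>\<alpha> |Du|\<^sup>p + \<beta>\<close>, with the free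
  parameter \<open>k\<close>, yields one estimate for \<open>u\<^sup>*(a) - u\<^sup>*(b)\<close>. With \<open>k\<close> large it gives absolute
  continuity; divided by \<open>b - a\<close>, with \<open>b\<close> tending to \<open>a\<close> and \<open>k = C |(u\<^sup>*)'(a)|\<close>, it bounds
  \<open>C\<^sup>p |(u\<^sup>*)'|\<^sup>p g\<close> by the lower derivative of the energy distribution, and Fatou's lemma concludes.\<close>

section \<open>Differentiability of monotone functions\<close>

text \<open>Hence the isoperimetric bound enters as a constant valid on a whole interval of levels,
  and only the integrals of the approximating ramps are integrated over the level.

  The distribution function is never differentiated, since it jumps where \<open>u\<close> has
  plateaus. Increments of the rearrangement take its place: levels strictly between
  \<open>us b\<close> and \<open>us a\<close> carry mass at most \<open>\<omega> {a..<b}\<close>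
  (\<open>slab_le\<close>), and this mass multiplies the constant term of the Young bound.

  The coarea inequality and the final energy bound rest on the same Tonelli argument
  (\<open>nn_integral_sections_le\<close>): sections of diameter at most \<open>h\<close>, weighted
  by \<open>1 / h\<close>. In the first the sections consist of levels, in the second of positions
  in \<open>Omega_star\<close>.

  Where a function is not differentiable, \<open>deriv\<close> is an unspecified value.
  Differentiability a.e. of the rearrangement is therefore part of the claim to be shown; it comes
  from Lebesgue's theorem on monotone functions, by Vitali coverings.\<close>

lemma vitali_intervals:
  fixes S U :: "real set"
  assumes "open U" "S \<subseteq> U"
    and P: "\<And>x d. x \<in> S \<Longrightarrow> 0 < d \<Longrightarrow> \<exists>a b. a < b \<and> b - a < d \<and> a \<le> x \<and> x \<le> b \<and> P a b"
  obtains C where "countable C" "\<And>a b. (a, b) \<in> C \<Longrightarrow> a < b \<and> {a..b} \<subseteq> U \<and> P a b"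
    "disjoint_family_on (\<lambda>(a, b). {a..b}) C" "negligible (S - (\<Union>(a, b)\<in>C. {a..b}))"
proof -
  let ?K = "{(a, b). a < b \<and> {a..b} \<subseteq> U \<and> P a b}"
  \<comment> \<open>On the line a compact interval is a closed ball with midpoint \<open>?c\<close>
    and radius \<open>?r\<close>. Vitali's theorem for balls asks only that they contain
    \<open>x\<close>, not that they be centred there.\<close>
  let ?c = "\<lambda>(a, b). (a + b) / 2 :: real" and ?r = "\<lambda>(a, b). (b - a) / 2 :: real"
  have cb: "cball (?c ab) (?r ab) = (case ab of (a, b) \<Rightarrow> {a..b})" for ab :: "real \<times> real"
    by (cases ab) (simp add: cball_eq_atLeastAtMost field_simps)
  have 1: "0 < ?r i" if "i \<in> ?K" for i using that by auto
  have 2: "\<exists>i. i \<in> ?K \<and> x \<in> cball (?c i) (?r i) \<and> ?r i < d" if x: "x \<in> S" "0 < d" for x d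
  proof -
    obtain e where e: "e > 0" "ball x e \<subseteq> U"
      using \<open>open U\<close> \<open>S \<subseteq> U\<close> x(1) openE by blast
    obtain a b where ab: "a < b" "b - a < min d e" "a \<le> x" "x \<le> b" "P a b"
      using P[OF x(1), of "min d e"] e x(2) by auto
    have "{a..b} \<subseteq> ball x e" using ab by (auto simp: dist_real_def)
    with ab e show ?thesis
      unfolding cb by (intro exI[of _ "(a, b)"]) auto
  qed
  obtain C where C: "countable C" "C \<subseteq> ?K"
     "pairwise (\<lambda>i j. disjnt (cball (?c i) (?r i)) (cball (?c j) (?r j))) C"
     "negligible (S - (\<Union>i\<in>C. cball (?c i) (?r i)))"
    using Vitali_covering_theorem_cballs[of ?K ?r S ?c, OF 1 2] by blast
  show thesis
  proof
    show "disjoint_family_on (\<lambda>(a, b). {a..b}) C"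
      using C(3) unfolding cb by (auto simp: disjoint_family_on_def pairwise_def disjnt_def)
    show "negligible (S - (\<Union>(a, b)\<in>C. {a..b}))"
      using C(4) unfolding cb .
  qed (use C in auto)
qed

lemma emeasure_UN_mono_countable:
  assumes "countable C" "disjoint_family_on X C" "\<And>i. i \<in> C \<Longrightarrow> X i \<in> sets M" "sets N = sets M"
    and "\<And>i. i \<in> C \<Longrightarrow> emeasure M (X i) \<le> emeasure N (X i)"
  shows "emeasure M (\<Union>i\<in>C. X i) \<le> emeasure N (\<Union>i\<in>C. X i)"
proof -
  have "emeasure M (\<Union>i\<in>C. X i) = (\<integral>\<^sup>+i. emeasure M (X i) \<partial>count_space C)"
    using assms by (intro emeasure_UN_countable) auto
  also have "\<dots> \<le> (\<integral>\<^sup>+i. emeasure N (X i) \<partial>count_space C)"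
    using assms by (intro nn_integral_mono) auto
  also have "\<dots> = emeasure N (\<Union>i\<in>C. X i)"
    using assms by (intro emeasure_UN_countable[symmetric]) auto
  finally show ?thesis .
qed

text \<open>By continuity the Stieltjes measure of \<open>f\<close> gives \<open>{a..b}\<close> the
  mass \<open>f b - f a\<close>. A slope bound on each interval of a disjoint family thus compares
  it with a multiple of Lebesgue measure on the union.\<close>

lemma interval_measure_slopes:
  fixes f :: "real \<Rightarrow> real"
  assumes f: "mono f" "continuous_on UNIV f"
    and C: "countable C" "disjoint_family_on (\<lambda>(a, b). {a..b}) C" "\<And>a b. (a, b) \<in> C \<Longrightarrow> a < b"
    and "0 \<le> q"
  shows "(\<And>a b. (a, b) \<in> C \<Longrightarrow> q * (b - a) \<le> f b - f a) \<Longrightarrow>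
      ennreal q * emeasure lborel (\<Union>(a, b)\<in>C. {a..b}) \<le> emeasure (interval_measure f) (\<Union>(a, b)\<in>C. {a..b})"
    and "(\<And>a b. (a, b) \<in> C \<Longrightarrow> f b - f a \<le> q * (b - a)) \<Longrightarrow>
      emeasure (interval_measure f) (\<Union>(a, b)\<in>C. {a..b}) \<le> ennreal q * emeasure lborel (\<Union>(a, b)\<in>C. {a..b})"
proof -
  have em: "emeasure (interval_measure f) {a..b} = ennreal (f b - f a)" if "a \<le> b" for a b
    using f that by (intro emeasure_interval_measure_Icc) (auto dest: monoD)
  have s: "sets (scale_measure (ennreal q) lborel) = sets (interval_measure f)" by simp
  have "emeasure (scale_measure (ennreal q) lborel) (\<Union>i\<in>C. case i of (a, b) \<Rightarrow> {a..b})
      \<le> emeasure (interval_measure f) (\<Union>i\<in>C. case i of (a, b) \<Rightarrow> {a..b})"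
    if "\<And>a b. (a, b) \<in> C \<Longrightarrow> q * (b - a) \<le> f b - f a"
    using C that \<open>0 \<le> q\<close>
    by (intro emeasure_UN_mono_countable)
       (auto simp: em less_imp_le ennreal_mult[symmetric] intro!: ennreal_leI split: prod.splits)
  then show "(\<And>a b. (a, b) \<in> C \<Longrightarrow> q * (b - a) \<le> f b - f a) \<Longrightarrow>
      ennreal q * emeasure lborel (\<Union>(a, b)\<in>C. {a..b}) \<le> emeasure (interval_measure f) (\<Union>(a, b)\<in>C. {a..b})"
    by simp
  have "emeasure (interval_measure f) (\<Union>i\<in>C. case i of (a, b) \<Rightarrow> {a..b})
      \<le> emeasure (scale_measure (ennreal q) lborel) (\<Union>i\<in>C. case i of (a, b) \<Rightarrow> {a..b})"
    if "\<And>a b. (a, b) \<in> C \<Longrightarrow> f b - f a \<le> q * (b - a)"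
    using C that \<open>0 \<le> q\<close>
    by (intro emeasure_UN_mono_countable)
       (auto simp: em less_imp_le ennreal_mult[symmetric] intro!: ennreal_leI split: prod.splits)
  then show "(\<And>a b. (a, b) \<in> C \<Longrightarrow> f b - f a \<le> q * (b - a)) \<Longrightarrow>
      emeasure (interval_measure f) (\<Union>(a, b)\<in>C. {a..b}) \<le> ennreal q * emeasure lborel (\<Union>(a, b)\<in>C. {a..b})"
    by simp
qed

text \<open>Chords over intervals that merely contain \<open>x\<close>, instead of difference
  quotients at \<open>x\<close>: a Vitali cover consists of such intervals, and \<open>a = x\<close>
  or \<open>b = x\<close> in the negations recovers both one-sided quotients.\<close>

definition slope_above :: "(real \<Rightarrow> real) \<Rightarrow> real \<Rightarrow> real \<Rightarrow> bool" where
  "slope_above f q x \<longleftrightarrow> (\<forall>d>0. \<exists>a b. a < b \<and> b - a < d \<and> a \<le> x \<and> x \<le> b \<and> q * (b - a) < f b - f a)"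

definition slope_below :: "(real \<Rightarrow> real) \<Rightarrow> real \<Rightarrow> real \<Rightarrow> bool" where
  "slope_below f p x \<longleftrightarrow> (\<forall>d>0. \<exists>a b. a < b \<and> b - a < d \<and> a \<le> x \<and> x \<le> b \<and> f b - f a < p * (b - a))"

lemma not_slope_above:
  assumes "\<not> slope_above f q x"
  obtains d where "d > 0" "\<And>a b. \<lbrakk>a < b; b - a < d; a \<le> x; x \<le> b\<rbrakk> \<Longrightarrow> f b - f a \<le> q * (b - a)"
  using assms unfolding slope_above_def by (meson not_less)

lemma not_slope_below:
  assumes "\<not> slope_below f p x"
  obtains d where "d > 0" "\<And>a b. \<lbrakk>a < b; b - a < d; a \<le> x; x \<le> b\<rbrakk> \<Longrightarrow> p * (b - a) \<le> f b - f a"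
  using assms unfolding slope_below_def by (meson not_less)

text \<open>\<open>S\<close> need not be measurable; \<open>W \<union> (S - W)\<close> is a
  measurable superset because its second part is null.\<close>

lemma lmeasurable_diff_null_bound:
  fixes S :: "real set"
  assumes W: "W \<in> sets borel" "emeasure lborel W \<le> ennreal c" and "negligible (S - W)" "0 \<le> c"
  shows "\<exists>T. S \<subseteq> T \<and> T \<in> lmeasurable \<and> measure lebesgue T \<le> c"
proof -
  have eW: "emeasure lebesgue W \<le> ennreal c" using W by simp
  then have Wl: "W \<in> lmeasurable"
    using W by (intro fmeasurableI) (auto intro: le_less_trans)
  have N: "negligible (S - W)" by fact
  have "measure lebesgue (W \<union> (S - W)) = measure lebesgue W"
    by (rule measure_negligible_symdiff[OF Wl negligible_subset[OF N]]) auto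
  also have "\<dots> \<le> c"
    using eW \<open>0 \<le> c\<close> by (simp add: measure_def enn2real_leI)
  finally show ?thesis
    using Wl N by (intro exI[of _ "W \<union> (S - W)"] conjI fmeasurable.Un negligible_imp_measurable[OF N]) auto
qed

text \<open>Double covering: intervals of slope below \<open>p\<close> cover almost all of
  \<open>S\<close> inside an open set of measure below \<open>s + e\<close>, and within these,
  intervals of slope above \<open>q\<close> cover it again. Comparing Stieltjes masses gives
  \<open>q * s \<le> p * (s + e)\<close> for the outer measure \<open>s\<close>, so that
  \<open>s = 0\<close>.\<close>

lemma negligible_slope_gap:
  fixes f :: "real \<Rightarrow> real"
  assumes f: "mono f" "continuous_on UNIV f" and pq: "0 \<le> p" "p < q"
    and S: "bounded S" "\<And>x. x \<in> S \<Longrightarrow> slope_below f p x" "\<And>x. x \<in> S \<Longrightarrow> slope_above f q x"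
  shows "negligible S"
proof -
  let ?A = "{measure lebesgue T |T. T \<in> lmeasurable \<and> S \<subseteq> T}"
  define s where "s = Inf ?A"
  obtain n where n: "S \<subseteq> {-n..n}" using S(1) by (metis bounded_subset_cbox_symmetric cbox_interval)
  have ne: "?A \<noteq> {}" using n by blast
  have bdd: "bdd_below ?A" by (auto intro!: bdd_belowI[of _ 0])
  have s0: "0 \<le> s" unfolding s_def by (rule cInf_greatest[OF ne]) auto
  have key: "q * s \<le> p * (s + e)" if e: "0 < e" for e
  proof -
    obtain T where T: "T \<in> lmeasurable" "S \<subseteq> T" "measure lebesgue T < s + e / 2"
      using cInf_lessD[OF ne, of "s + e / 2"] e unfolding s_def by auto
    obtain U where U: "open U" "T \<subseteq> U" "U - T \<in> lmeasurable" "emeasure lebesgue (U - T) < ennreal (e / 2)"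
      using sets_lebesgue_outer_open[of T "e / 2"] T(1) e by (auto simp: fmeasurableD)
    have UT: "U = T \<union> (U - T)" using U(2) by auto
    have "measure lebesgue (U - T) < e / 2"
      using U(3,4) e by (simp add: emeasure_eq_measure2 ennreal_less_iff)
    then have mU: "measure lebesgue U < s + e"
      using measure_Un_le[of T lebesgue "U - T"] T(1,3) U(3) UT by (simp add: fmeasurableD)
    have Ul: "U \<in> lmeasurable" using T(1) U(3) UT by (metis fmeasurable.Un)
    obtain C where C: "countable C" "\<And>a b. (a, b) \<in> C \<Longrightarrow> a < b \<and> {a..b} \<subseteq> U \<and> f b - f a < p * (b - a)"
      "disjoint_family_on (\<lambda>(a, b). {a..b}) C" "negligible (S - (\<Union>(a, b)\<in>C. {a..b}))"
      by (rule vitali_intervals[OF U(1) _ S(2)[unfolded slope_below_def, rule_format]]) (use U T in auto)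
    define W where "W = (\<Union>(a, b)\<in>C. {a..b})"
    \<comment> \<open>The second cover needs an open set around it. Passing to interiors loses only
      countably many endpoints.\<close>
    define V where "V = (\<Union>(a, b)\<in>C. {a<..<b})"
    have "open V" unfolding V_def by auto
    have VW: "V \<subseteq> W" unfolding V_def W_def by (intro UN_mono) auto
    have WU: "W \<subseteq> U" unfolding W_def using C(2) by auto
    have "W - V \<subseteq> (\<Union>(a, b)\<in>C. {a, b})" unfolding V_def W_def by force
    moreover have "countable (\<Union>(a, b)\<in>C. {a, b})" using C(1) by auto
    ultimately have nWV: "negligible (W - V)"
      by (meson countable_imp_null_set_lborel negligible_iff_null_sets null_sets_completionI negligible_subset)
    obtain D where D: "countable D" "\<And>a b. (a, b) \<in> D \<Longrightarrow> a < b \<and> {a..b} \<subseteq> V \<and> q * (b - a) < f b - f a"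
      "disjoint_family_on (\<lambda>(a, b). {a..b}) D" "negligible (S \<inter> V - (\<Union>(a, b)\<in>D. {a..b}))"
      by (rule vitali_intervals[OF \<open>open V\<close> _ S(3)[unfolded slope_above_def, rule_format], of "S \<inter> V"]) auto
    define Z where "Z = (\<Union>(a, b)\<in>D. {a..b})"
    have ZV: "Z \<subseteq> V" unfolding Z_def using D(2) by auto
    have mb: "W \<in> sets borel" "Z \<in> sets borel"
      unfolding W_def Z_def using C(1) D(1) by (auto intro!: sets.countable_UN'')
    have "S - Z \<subseteq> (S - W) \<union> (W - V) \<union> (S \<inter> V - Z)" by auto
    then have nSZ: "negligible (S - Z)"
      using C(4) nWV D(4) unfolding W_def[symmetric] Z_def[symmetric]
      by (meson negligible_Un negligible_subset)
    have le1: "ennreal q * emeasure lborel Z \<le> ennreal p * emeasure lborel W"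
    proof -
      have "ennreal q * emeasure lborel Z \<le> emeasure (interval_measure f) Z"
        unfolding Z_def using D pq by (intro interval_measure_slopes[OF f]) (auto simp: less_imp_le)
      also have "\<dots> \<le> emeasure (interval_measure f) W"
        using mb VW ZV by (intro emeasure_mono) auto
      also have "\<dots> \<le> ennreal p * emeasure lborel W"
        unfolding W_def using C pq by (intro interval_measure_slopes[OF f]) (auto simp: less_imp_le)
      finally show ?thesis .
    qed
    have UU: "emeasure lebesgue U = ennreal (measure lebesgue U)"
      using Ul by (simp add: emeasure_eq_measure2)
    have Wle: "emeasure lborel W \<le> ennreal (s + e)"
    proof -
      have "emeasure lborel W = emeasure lebesgue W" using mb by simp
      also have "\<dots> \<le> emeasure lebesgue U" using WU Ul by (intro emeasure_mono) (auto simp: fmeasurableD)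
      also have "\<dots> \<le> ennreal (s + e)" unfolding UU using mU by (intro ennreal_leI) simp
      finally show ?thesis .
    qed
    have Zfin: "emeasure lborel Z \<le> ennreal (measure lborel Z)"
    proof -
      have "emeasure lborel Z \<le> emeasure lborel W"
        using mb VW ZV by (intro emeasure_mono) auto
      also note Wle
      finally have "emeasure lborel Z \<noteq> top" by (auto simp: top_unique)
      then show ?thesis by (simp add: emeasure_eq_ennreal_measure)
    qed
    have "ennreal (q * measure lborel Z) \<le> ennreal (p * (s + e))"
    proof -
      have "ennreal (q * measure lborel Z) \<le> ennreal q * emeasure lborel Z"
        using pq by (simp add: ennreal_mult measure_def ennreal_enn2real_if mult_left_mono)
      also note le1
      also have "ennreal p * emeasure lborel W \<le> ennreal p * ennreal (s + e)"
        by (intro mult_left_mono Wle) simp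
      also have "\<dots> = ennreal (p * (s + e))" using pq s0 e by (simp add: ennreal_mult)
      finally show ?thesis .
    qed
    then have 1: "q * measure lborel Z \<le> p * (s + e)"
      using pq s0 e by (simp add: ennreal_le_iff)
    obtain T' where T': "S \<subseteq> T'" "T' \<in> lmeasurable" "measure lebesgue T' \<le> measure lborel Z"
      using lmeasurable_diff_null_bound[OF mb(2) Zfin nSZ] by auto
    have "s \<le> measure lborel Z"
      unfolding s_def using T' bdd by (intro cInf_lower2[of "measure lebesgue T'"]) auto
    then have "q * s \<le> q * measure lborel Z" using pq by (intro mult_left_mono) auto
    with 1 show ?thesis by linarith
  qed
  have "s \<le> 0"
  proof (rule ccontr)
    assume "\<not> s \<le> 0"
    then have "s > 0" by simp
    have "p * s < q * s" using pq \<open>s > 0\<close> by simp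
    have "q * s \<le> p * s"
    proof (rule field_le_epsilon)
      fix e :: real assume "e > 0"
      \<comment> \<open>\<open>p + 1\<close> instead of \<open>p\<close>, because
        \<open>p = 0\<close> is allowed.\<close>
      have "q * s \<le> p * (s + e / (p + 1))" using key[of "e / (p + 1)"] \<open>e > 0\<close> pq by simp
      also have "\<dots> = p * s + (p / (p + 1)) * e" by (simp add: algebra_simps)
      also have "(p / (p + 1)) * e \<le> 1 * e" using \<open>e > 0\<close> pq by (intro mult_right_mono) auto
      finally show "q * s \<le> p * s + e" by simp
    qed
    with \<open>p * s < q * s\<close> show False by simp
  qed
  show ?thesis
    unfolding negligible_outer
  proof (intro allI impI)
    fix e :: real assume "e > 0"
    then show "\<exists>T. S \<subseteq> T \<and> T \<in> lmeasurable \<and> measure lebesgue T < e"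
      using cInf_lessD[OF ne, of e] \<open>s \<le> 0\<close> unfolding s_def by auto
  qed
qed

text \<open>In a bounded interval, disjoint intervals of slope above \<open>q\<close> have total
  length at most \<open>c / q\<close>, where \<open>c\<close> bounds the increment of
  \<open>f\<close>. The choice \<open>q = c / e + 1\<close> makes this at most \<open>e\<close> and
  stays positive when \<open>c = 0\<close>.\<close>

lemma negligible_slope_infinite:
  fixes f :: "real \<Rightarrow> real"
  assumes f: "mono f" "continuous_on UNIV f" and S: "bounded S" "\<And>x q. x \<in> S \<Longrightarrow> slope_above f q x"
  shows "negligible S"
proof -
  obtain n where n: "S \<subseteq> {-n<..<n}"
    using S(1) by (metis bounded_subset_box_symmetric box_real(1))
  show ?thesis
    unfolding negligible_outer_le
  proof (intro allI impI)
    fix e :: real assume e: "e > 0"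
    define c where "c = max 0 (f n - f (-n))"
    define q where "q = c / e + 1"
    have q: "q > 0" using e unfolding q_def c_def by (auto intro!: add_nonneg_pos divide_nonneg_pos)
    obtain C where C: "countable C" "\<And>a b. (a, b) \<in> C \<Longrightarrow> a < b \<and> {a..b} \<subseteq> {-n<..<n} \<and> q * (b - a) < f b - f a"
      "disjoint_family_on (\<lambda>(a, b). {a..b}) C" "negligible (S - (\<Union>(a, b)\<in>C. {a..b}))"
      by (rule vitali_intervals[OF _ n S(2)[unfolded slope_above_def, rule_format]]) auto
    define W where "W = (\<Union>(a, b)\<in>C. {a..b})"
    have mb: "W \<in> sets borel"
      unfolding W_def using C(1) by (auto intro!: sets.countable_UN'')
    have WU: "W \<subseteq> {-n..n}" unfolding W_def using C(2) by force
    have "ennreal q * emeasure lborel W \<le> emeasure (interval_measure f) W"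
      unfolding W_def using C q by (intro interval_measure_slopes[OF f]) (auto simp: less_imp_le)
    also have "\<dots> \<le> emeasure (interval_measure f) {-n..n}"
      using mb WU by (intro emeasure_mono) auto
    also have "\<dots> \<le> ennreal c"
    proof (cases "-n \<le> n")
      case True
      then show ?thesis
        using f by (subst emeasure_interval_measure_Icc) (auto dest: monoD simp: c_def intro!: ennreal_leI)
    qed auto
    also have "\<dots> \<le> ennreal (q * e)"
      using e by (intro ennreal_leI) (simp add: q_def field_simps)
    finally have "ennreal q * emeasure lborel W \<le> ennreal q * ennreal e"
      using q e by (simp add: ennreal_mult)
    then have "emeasure lborel W \<le> ennreal e"
      using q by (subst (asm) ennreal_mult_le_mult_iff) auto
    then show "\<exists>T. S \<subseteq> T \<and> T \<in> lmeasurable \<and> measure lebesgue T \<le> e"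
      using lmeasurable_diff_null_bound[OF mb _ C(4)[folded W_def], of e] e by auto
  qed
qed

text \<open>If both alternatives fail, the derivative is the supremum \<open>L\<close> of the slopes
  \<open>p\<close> with \<open>\<not> slope_below f p x\<close>. Rational gaps are used so that the
  exceptional points form a countable union.\<close>

lemma mono_differentiable_or_slopes:
  fixes f :: "real \<Rightarrow> real"
  assumes f: "mono f" and nd: "\<not> f differentiable (at x)"
  shows "(\<forall>q. slope_above f q x) \<or> (\<exists>p\<in>\<rat>. \<exists>q\<in>\<rat>. 0 \<le> p \<and> p < q \<and> slope_below f p x \<and> slope_above f q x)"
proof (rule ccontr)
  assume not: "\<not> ?thesis"
  then obtain q0 where q0: "\<not> slope_above f q0 x" by auto
  have gap: "\<not> slope_below f p x \<or> \<not> slope_above f q x" if "p \<in> \<rat>" "q \<in> \<rat>" "0 \<le> p" "p < q" for p q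
    using not that by auto
  let ?A = "{p. \<not> slope_below f p x}"
  define L where "L = Sup ?A"
  have 0: "0 \<in> ?A" using f by (auto simp: slope_below_def mono_def not_less intro!: exI[of _ 1])
  have ub: "p \<le> q" if p: "\<not> slope_below f p x" and q: "\<not> slope_above f q x" for p q
  proof -
    obtain d1 where d1: "d1 > 0" "\<And>a b. \<lbrakk>a < b; b - a < d1; a \<le> x; x \<le> b\<rbrakk> \<Longrightarrow> p * (b - a) \<le> f b - f a"
      using p not_slope_below by blast
    obtain d2 where d2: "d2 > 0" "\<And>a b. \<lbrakk>a < b; b - a < d2; a \<le> x; x \<le> b\<rbrakk> \<Longrightarrow> f b - f a \<le> q * (b - a)"
      using q not_slope_above by blast
    define h where "h = min d1 d2 / 2"
    have h: "h > 0" "h < d1" "h < d2" using d1(1) d2(1) unfolding h_def by auto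
    have "p * h \<le> f (x + h) - f x" "f (x + h) - f x \<le> q * h"
      using d1(2)[of x "x + h"] d2(2)[of x "x + h"] h by simp_all
    then have "p * h \<le> q * h" by linarith
    then show ?thesis using h(1) by (simp add: mult_le_cancel_right)
  qed
  have bdd: "bdd_above ?A" using ub q0 by (intro bdd_aboveI[of _ q0]) auto
  have L0: "0 \<le> L" unfolding L_def by (rule cSup_upper[OF 0 bdd])
  have "((\<lambda>y. (f y - f x) / (y - x)) \<longlongrightarrow> L) (at x)"
  proof (rule tendstoI)
    fix e :: real assume e: "e > 0"
    obtain p where p: "p \<in> ?A" "L - e < p"
      using less_cSup_iff[OF _ bdd, of "L - e"] 0 e unfolding L_def by auto
    obtain d1 where d1: "d1 > 0" "\<And>a b. \<lbrakk>a < b; b - a < d1; a \<le> x; x \<le> b\<rbrakk> \<Longrightarrow> p * (b - a) \<le> f b - f a"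
      using p not_slope_below by blast
    \<comment> \<open>Two rationals just above \<open>L\<close>: \<open>slope_below\<close> holds at
      \<open>p'\<close> by the choice of \<open>L\<close>, and since there is no rational gap,
      \<open>slope_above\<close> fails at \<open>q'\<close>.\<close>
    obtain p' where p': "p' \<in> \<rat>" "L < p'" "p' < L + e"
      using Rats_dense_in_real[of L "L + e"] e by auto
    obtain q' where q': "q' \<in> \<rat>" "p' < q'" "q' < L + e"
      using Rats_dense_in_real[OF p'(3)] by auto
    have "slope_below f p' x"
      using p'(2) cSup_upper[OF _ bdd, of p'] unfolding L_def by auto
    then have "\<not> slope_above f q' x" using gap[OF p'(1) q'(1)] q' p' L0 by auto
    then obtain d2 where d2: "d2 > 0" "\<And>a b. \<lbrakk>a < b; b - a < d2; a \<le> x; x \<le> b\<rbrakk> \<Longrightarrow> f b - f a \<le> q' * (b - a)"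
      using not_slope_above by blast
    have "dist ((f y - f x) / (y - x)) L < e" if y: "y \<noteq> x" "dist y x < min d1 d2" for y
    proof -
      have "p \<le> (f y - f x) / (y - x) \<and> (f y - f x) / (y - x) \<le> q'"
      proof (cases "x < y")
        case True
        then show ?thesis using d1(2)[of x y] d2(2)[of x y] y
          by (auto simp: dist_real_def field_simps)
      next
        case False
        then have "y < x" using y by simp
        then have "(f y - f x) / (y - x) = (f x - f y) / (x - y)"
          by (metis minus_diff_eq minus_divide_divide)
        then show ?thesis using d1(2)[of y x] d2(2)[of y x] y \<open>y < x\<close>
          by (auto simp: dist_real_def field_simps)
      qed
      then show ?thesis using p q' by (auto simp: dist_real_def)
    qed
    then show "\<forall>\<^sub>F y in at x. dist ((f y - f x) / (y - x)) L < e"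
      unfolding eventually_at using d1(1) d2(1) by (intro exI[of _ "min d1 d2"]) auto
  qed
  then have "(f has_field_derivative L) (at x)"
    by (simp add: has_field_derivative_iff)
  then show False using nd by (simp add: real_differentiable_def)
qed

lemma negligible_UN_countable:
  "countable A \<Longrightarrow> (\<And>i. i \<in> A \<Longrightarrow> negligible (X i)) \<Longrightarrow> negligible (\<Union>i\<in>A. X i)"
  by (auto intro!: negligible_countable_Union countable_image)

lemma mono_continuous_differentiable_AE:
  fixes f :: "real \<Rightarrow> real"
  assumes f: "mono f" "continuous_on UNIV f"
  shows "AE x in lborel. f differentiable (at x)"
proof -
  let ?B = "\<lambda>n::nat. {-real n..real n}"
  let ?S = "\<lambda>p q n. {x \<in> ?B n. 0 \<le> p \<and> p < q \<and> slope_below f p x \<and> slope_above f q x}"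
  let ?I = "\<lambda>n. {x \<in> ?B n. \<forall>q. slope_above f q x}"
  have 1: "negligible (?S p q n)" for p q n
  proof (cases "0 \<le> p \<and> p < q")
    case True
    then show ?thesis
      by (intro negligible_slope_gap[OF f, of p q] bounded_subset[of "?B n" "?S p q n"]) auto
  qed auto
  have 2: "negligible (?I n)" for n
    by (intro negligible_slope_infinite[OF f] bounded_subset[of "?B n" "?I n"]) auto
  have "negligible ((\<Union>n. ?I n) \<union> (\<Union>p\<in>\<rat>. \<Union>q\<in>\<rat>. \<Union>n. ?S p q n))"
    using 1 2 by (intro negligible_Un negligible_UN_countable countable_rat) auto
  moreover have "{x. \<not> f differentiable (at x)} \<subseteq> (\<Union>n. ?I n) \<union> (\<Union>p\<in>\<rat>. \<Union>q\<in>\<rat>. \<Union>n. ?S p q n)"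
  proof
    fix x assume "x \<in> {x. \<not> f differentiable (at x)}"
    then have "\<not> f differentiable (at x)" by simp
    moreover obtain n where "\<bar>x\<bar> \<le> real n" using real_arch_simple by blast
    then have "x \<in> ?B n" by auto
    ultimately consider "x \<in> ?I n"
      | p q where "p \<in> \<rat>" "q \<in> \<rat>" "x \<in> ?S p q n"
      using mono_differentiable_or_slopes[OF f(1), of x] by auto
    then show "x \<in> (\<Union>n. ?I n) \<union> (\<Union>p\<in>\<rat>. \<Union>q\<in>\<rat>. \<Union>n. ?S p q n)"
    proof cases
      case 1
      then show ?thesis by (intro UnI1 UN_I[of n]) auto
    next
      case 2
      then show ?thesis by (intro UnI2 UN_I[of p] UN_I[of q] UN_I[of n]) auto
    qed
  qed
  ultimately have "negligible {x. \<not> f differentiable (at x)}" by (rule negligible_subset)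
  then have "AE x in lebesgue. f differentiable (at x)"
    by (intro AE_I'[of "{x. \<not> f differentiable (at x)}"]) (auto simp: negligible_iff_null_sets)
  then show ?thesis by (simp add: AE_completion_iff)
qed

section \<open>Local Lipschitz constants and a partition of unity\<close>

lemma lip_le:
  assumes "0 \<le> c" and "\<And>e. e > 0 \<Longrightarrow> \<forall>\<^sub>F y in at x. \<bar>f y - f x\<bar> \<le> (c + e) * dist y x"
  shows "lip f x \<le> c"
proof -
  have "Limsup (at x) (\<lambda>y. ennreal (\<bar>f y - f x\<bar> / dist y x)) \<le> ennreal c"
  proof (rule ennreal_le_epsilon)
    fix e :: real assume e: "e > 0"
    have "\<forall>\<^sub>F y in at x. ennreal (\<bar>f y - f x\<bar> / dist y x) \<le> ennreal (c + e)"
      using assms(2)[OF e] eventually_neq_at_within[of x x UNIV]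
      by eventually_elim (auto intro!: ennreal_leI simp: divide_le_eq)
    then show "Limsup (at x) (\<lambda>y. ennreal (\<bar>f y - f x\<bar> / dist y x)) \<le> ennreal c + ennreal e"
      using assms(1) e by (simp add: Limsup_bounded flip: ennreal_plus)
  qed
  then show ?thesis
    unfolding lip_def using assms(1) by (intro enn2real_leI)
qed

text \<open>The Lipschitz bound near \<open>x\<close> keeps the \<open>Limsup\<close> below
  \<open>top\<close>. Otherwise \<open>enn2real\<close> would turn an infinite slope into
  \<open>lip f x = 0\<close>.\<close>

lemma eventually_le_lip:
  assumes "0 < r" "L-lipschitz_on (ball x r) f" "lip f x < c"
  shows "\<forall>\<^sub>F y in at x. \<bar>f y - f x\<bar> \<le> c * dist y x"
proof -
  let ?q = "\<lambda>y. ennreal (\<bar>f y - f x\<bar> / dist y x)"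
  have "\<forall>\<^sub>F y in at x. y \<in> ball x r"
    using \<open>0 < r\<close> unfolding eventually_at by (auto simp: dist_commute)
  then have "\<forall>\<^sub>F y in at x. ?q y \<le> ennreal L"
    using eventually_neq_at_within[of x x UNIV]
  proof eventually_elim
    case (elim y)
    then have "\<bar>f y - f x\<bar> \<le> L * dist y x"
      using lipschitz_onD[OF assms(2), of y x] \<open>0 < r\<close> by (simp add: dist_real_def)
    then show ?case using elim by (auto intro!: ennreal_leI simp: divide_le_eq)
  qed
  then have "Limsup (at x) ?q \<le> ennreal L" by (rule Limsup_bounded)
  then have "Limsup (at x) ?q = ennreal (lip f x)"
    unfolding lip_def by (simp add: le_less_trans[OF _ ennreal_less_top] less_top)
  also have "\<dots> < ennreal c"
    using assms(3) by (simp add: ennreal_less_iff lip_def)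
  finally have "\<forall>\<^sub>F y in at x. ?q y < ennreal c" by (rule Limsup_lessD)
  then show ?thesis using eventually_neq_at_within[of x x UNIV]
  proof eventually_elim
    case (elim y)
    then show ?case by (simp add: ennreal_less_iff divide_less_eq split: if_splits)
  qed
qed

text \<open>The case distinction is needed because \<open>infdist x {} = 0\<close>. The slopes double with \<open>i\<close> so that
  each function is \<open>1\<close> on the support of its predecessor.\<close>

definition exhaustion :: "'a::metric_space set \<Rightarrow> 'a \<Rightarrow> nat \<Rightarrow> 'a \<Rightarrow> real" where
  "exhaustion \<Omega> x0 i x =
     max 0 (min 1 (min (2 ^ i * (if \<Omega> = UNIV then 1 else infdist x (- \<Omega>)) - 1) (real i - dist x x0)))"

lemma exhaustion_range: "0 \<le> exhaustion \<Omega> x0 i x" "exhaustion \<Omega> x0 i x \<le> 1"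
  by (auto simp: exhaustion_def)

lemma exhaustion_far: "real i \<le> dist x x0 \<Longrightarrow> exhaustion \<Omega> x0 i x = 0"
  unfolding exhaustion_def by (simp add: min_le_iff_disj max_absorb1)

lemma exhaustion_0 [simp]: "exhaustion \<Omega> x0 0 x = 0"
  by (simp add: exhaustion_far)

lemma exhaustion_diff_le: "\<bar>exhaustion \<Omega> x0 i x - exhaustion \<Omega> x0 i y\<bar> \<le> 2 ^ i * dist x y"
proof -
  let ?d = "\<lambda>x. if \<Omega> = UNIV then 1 else infdist x (- \<Omega>)"
  have "\<bar>?d x - ?d y\<bar> \<le> dist x y"
    using infdist_triangle_abs[of x "- \<Omega>" y] by simp
  then have "\<bar>2 ^ i * ?d x - 2 ^ i * ?d y\<bar> \<le> 2 ^ i * dist x y"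
    unfolding right_diff_distrib[symmetric] abs_mult by (intro mult_mono) auto
  moreover have "\<bar>dist x x0 - dist y x0\<bar> \<le> dist x y"
    by (simp add: abs_dist_diff_le dist_commute)
  moreover have "dist x y \<le> 2 ^ i * dist x y" by (simp add: mult_le_cancel_right1)
  ultimately show ?thesis unfolding exhaustion_def by linarith
qed

lemma exhaustion_lipschitz: "(2 ^ i)-lipschitz_on A (exhaustion \<Omega> x0 i)"
  using exhaustion_diff_le by (auto intro!: lipschitz_onI simp: dist_real_def)

lemma continuous_on_exhaustion: "continuous_on A (exhaustion \<Omega> x0 i)"
  by (rule lipschitz_on_continuous_on[OF exhaustion_lipschitz])

text \<open>Where the function of index \<open>i\<close> is nonzero, \<open>2 ^ i\<close> times the
  distance term exceeds \<open>1\<close> and \<open>dist y x0 < i\<close>; at the next index both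
  inner terms are therefore above \<open>1\<close>. Closedness of the level set extends this to the
  closure.\<close>

lemma exhaustion_Suc_closure:
  assumes "x \<in> closure {y. exhaustion \<Omega> x0 i y \<noteq> 0}"
  shows "exhaustion \<Omega> x0 (Suc i) x = 1"
proof -
  have "{y. exhaustion \<Omega> x0 i y \<noteq> 0} \<subseteq> {y. exhaustion \<Omega> x0 (Suc i) y = 1}"
    by (auto simp: exhaustion_def max_def min_def split: if_splits)
  moreover have "closed {y. exhaustion \<Omega> x0 (Suc i) y = 1}"
    by (intro closed_Collect_eq continuous_on_exhaustion continuous_on_const)
  ultimately show ?thesis using assms closure_minimal by blast
qed

lemma exhaustion_Suc: "exhaustion \<Omega> x0 i x \<noteq> 0 \<Longrightarrow> exhaustion \<Omega> x0 (Suc i) x = 1"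
  using exhaustion_Suc_closure closure_subset by (metis (mono_tags, lifting) mem_Collect_eq subsetD)

lemma exhaustion_eq_1: "exhaustion \<Omega> x0 i x \<noteq> 0 \<Longrightarrow> i < j \<Longrightarrow> exhaustion \<Omega> x0 j x = 1"
proof (induction j)
  case (Suc j)
  then show ?case
    using exhaustion_Suc by (metis less_SucE zero_neq_one)
qed simp

text \<open>The closed support lies where the next function equals \<open>1\<close>, hence in
  \<open>\<Omega>\<close>: outside \<open>\<Omega>\<close> the distance term vanishes.\<close>

lemma exhaustion_in_cutoffs:
  fixes \<Omega> :: "'a::metric_space set"
  assumes "open \<Omega>"
  shows "exhaustion \<Omega> x0 i \<in> cutoffs \<Omega>"
proof -
  have "{x. exhaustion \<Omega> x0 i x \<noteq> 0} \<subseteq> cball x0 (real i)"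
    using exhaustion_far[of i _ x0 \<Omega>] by (force simp: dist_commute)
  then have bd: "bounded {x. exhaustion \<Omega> x0 i x \<noteq> 0}"
    by (rule bounded_subset[OF bounded_cball])
  have cl: "x \<in> \<Omega>" if "exhaustion \<Omega> x0 (Suc i) x = 1" for x
  proof (rule ccontr)
    assume "x \<notin> \<Omega>"
    then have "infdist x (- \<Omega>) = 0" "\<Omega> \<noteq> UNIV" by auto
    with that show False by (auto simp: exhaustion_def)
  qed
  have "closure {x. exhaustion \<Omega> x0 i x \<noteq> 0} \<subseteq> \<Omega>"
    using exhaustion_Suc_closure cl by blast
  then show ?thesis
    using bd exhaustion_lipschitz[of i UNIV \<Omega> x0] by (auto simp: cutoffs_def lipschitz_fun_def)
qed

lemma exhaustion_covers:
  fixes \<Omega> :: "'a::metric_space set"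
  assumes "open \<Omega>" "x \<in> \<Omega>"
  obtains k where "0 < exhaustion \<Omega> x0 k x"
proof -
  define d where "d = (if \<Omega> = UNIV then 1 else infdist x (- \<Omega>))"
  have "d > 0"
    using assms infdist_pos_not_in_closed[of "- \<Omega>" x] by (auto simp: d_def)
  then obtain k1 where k1: "1 / d < 2 ^ k1" using real_arch_pow[of 2 "1 / d"] by auto
  obtain k2 where k2: "dist x x0 < real k2" using reals_Archimedean2 by blast
  have "1 < 2 ^ k1 * d" using k1 \<open>d > 0\<close> by (simp add: field_simps)
  also have "2 ^ k1 * d \<le> 2 ^ (max k1 k2) * d"
    using \<open>d > 0\<close> by (intro mult_right_mono power_increasing) auto
  finally have "0 < exhaustion \<Omega> x0 (max k1 k2) x"
    using k2 unfolding exhaustion_def d_def[symmetric] by auto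
  then show thesis by (rule that)
qed

section \<open>Partition of unity and gluing\<close>

definition ex_part :: "'a::metric_space set \<Rightarrow> 'a \<Rightarrow> nat \<Rightarrow> 'a \<Rightarrow> real" where
  "ex_part \<Omega> x0 i x = exhaustion \<Omega> x0 (Suc i) x - exhaustion \<Omega> x0 i x"

lemma ex_part_nonneg: "0 \<le> ex_part \<Omega> x0 i x"
  using exhaustion_range[of \<Omega> x0] exhaustion_Suc[of \<Omega> x0 i x] by (cases "exhaustion \<Omega> x0 i x = 0") (auto simp: ex_part_def)

lemma ex_part_eq_0: "exhaustion \<Omega> x0 (Suc i) x = 0 \<Longrightarrow> ex_part \<Omega> x0 i x = 0"
  using exhaustion_Suc[of \<Omega> x0 i x] by (auto simp: ex_part_def)

lemma ex_part_diff_le: "\<bar>ex_part \<Omega> x0 i x - ex_part \<Omega> x0 i y\<bar> \<le> 2 ^ (i + 2) * dist x y"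
proof -
  have "\<bar>ex_part \<Omega> x0 i x - ex_part \<Omega> x0 i y\<bar> \<le> 2 ^ Suc i * dist x y + 2 ^ i * dist x y"
    using exhaustion_diff_le[of \<Omega> x0 "Suc i" x y] exhaustion_diff_le[of \<Omega> x0 i x y]
    unfolding ex_part_def by linarith
  also have "\<dots> \<le> 2 ^ (i + 2) * dist x y" by (simp add: algebra_simps)
  finally show ?thesis .
qed

lemma sum_ex_part: "(\<Sum>i<k. ex_part \<Omega> x0 i x) = exhaustion \<Omega> x0 k x"
  unfolding ex_part_def by (subst sum_lessThan_telescope) simp

text \<open>From index \<open>k + 1\<close> on, all exhaustion functions are \<open>1\<close> at
  \<open>x\<close>, so only the parts \<open>i \<le> k\<close> survive; the part \<open>k\<close>,
  which is \<open>1 - exhaustion \<Omega> x0 k x\<close>, may still be nonzero.\<close>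

lemma ex_part_beyond: "exhaustion \<Omega> x0 k x \<noteq> 0 \<Longrightarrow> k < i \<Longrightarrow> ex_part \<Omega> x0 i x = 0"
  using exhaustion_eq_1[of \<Omega> x0 k x i] exhaustion_eq_1[of \<Omega> x0 k x "Suc i"] by (simp add: ex_part_def)

lemma sum_ex_part_1: "exhaustion \<Omega> x0 k x \<noteq> 0 \<Longrightarrow> (\<Sum>i\<le>k. ex_part \<Omega> x0 i x) = 1"
  using exhaustion_Suc by (simp add: sum_ex_part flip: lessThan_Suc_atMost)

text \<open>The Meyers--Serrin gluing: \<open>w i\<close> has to be a good approximation only near
  the support of its part. In \<open>\<Omega>\<close> the series is locally a finite sum.\<close>

definition glue :: "'a::metric_space set \<Rightarrow> 'a \<Rightarrow> (nat \<Rightarrow> 'a \<Rightarrow> real) \<Rightarrow> 'a \<Rightarrow> real" where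
  "glue \<Omega> x0 w x = (\<Sum>i. ex_part \<Omega> x0 i x * w i x)"

lemma glue_eq: "exhaustion \<Omega> x0 k x \<noteq> 0 \<Longrightarrow> glue \<Omega> x0 w x = (\<Sum>i\<le>k. ex_part \<Omega> x0 i x * w i x)"
  unfolding glue_def by (intro suminf_finite) (auto simp: ex_part_beyond not_le)

lemma loc_lipschitz_glue:
  fixes \<Omega> :: "'a::metric_space set"
  assumes "open \<Omega>" and w: "\<And>i. lipschitz_fun (w i)"
  shows "loc_lipschitz \<Omega> (glue \<Omega> x0 w)"
  unfolding loc_lipschitz_def
proof
  fix x assume "x \<in> \<Omega>"
  then obtain k where k: "0 < exhaustion \<Omega> x0 k x" using exhaustion_covers[OF assms(1)] by blast
  have "open {y. 0 < exhaustion \<Omega> x0 k y}"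
    by (intro open_Collect_less continuous_on_exhaustion continuous_on_const)
  then obtain r where r: "r > 0" "ball x r \<subseteq> {y. 0 < exhaustion \<Omega> x0 k y}"
    using k by (metis (mono_tags, lifting) mem_Collect_eq openE)
  have ex: "\<exists>L. L-lipschitz_on (ball x r) (\<lambda>y. ex_part \<Omega> x0 i y * w i y)" for i
  proof -
    obtain M where M: "M-lipschitz_on UNIV (w i)" using w unfolding lipschitz_fun_def by blast
    have M0: "M \<ge> 0" by (rule lipschitz_on_nonneg[OF M])
    \<comment> \<open>\<open>w i\<close> may be unbounded on the whole space; its bound on the ball
      makes the product with the part Lipschitz there.\<close>
    define B where "B = \<bar>w i x\<bar> + M * r"
    have B: "\<bar>w i z\<bar> \<le> B" if "z \<in> ball x r" for z
    proof -
      have "\<bar>w i z - w i x\<bar> \<le> M * dist z x"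
        using lipschitz_onD[OF M, of z x] by (simp add: dist_real_def)
      also have "\<dots> \<le> M * r" using that M0 by (intro mult_left_mono) (auto simp: dist_commute)
      finally show ?thesis unfolding B_def by linarith
    qed
    have e1: "ex_part \<Omega> x0 i y \<le> 1" for y
      using exhaustion_range[of \<Omega> x0 "Suc i" y] exhaustion_range[of \<Omega> x0 i y] by (simp add: ex_part_def)
    have "(M + B * 2 ^ (i + 2))-lipschitz_on (ball x r) (\<lambda>y. ex_part \<Omega> x0 i y * w i y)"
    proof (rule lipschitz_onI)
      fix y z assume yz: "y \<in> ball x r" "z \<in> ball x r"
      have "\<bar>ex_part \<Omega> x0 i y * w i y - ex_part \<Omega> x0 i z * w i z\<bar>
          = \<bar>ex_part \<Omega> x0 i y * (w i y - w i z) + w i z * (ex_part \<Omega> x0 i y - ex_part \<Omega> x0 i z)\<bar>"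
        by (simp add: algebra_simps)
      also have "\<dots> \<le> ex_part \<Omega> x0 i y * \<bar>w i y - w i z\<bar> + \<bar>w i z\<bar> * \<bar>ex_part \<Omega> x0 i y - ex_part \<Omega> x0 i z\<bar>"
        using ex_part_nonneg[of \<Omega> x0 i y] by (auto simp: abs_mult intro: order_trans[OF abs_triangle_ineq])
      also have "\<dots> \<le> 1 * (M * dist y z) + B * (2 ^ (i + 2) * dist y z)"
        using lipschitz_onD[OF M, of y z] B[OF yz(2)] e1[of y] ex_part_nonneg[of \<Omega> x0 i y]
        by (intro add_mono mult_mono ex_part_diff_le) (auto simp: dist_real_def)
      finally show "dist (ex_part \<Omega> x0 i y * w i y) (ex_part \<Omega> x0 i z * w i z) \<le> (M + B * 2 ^ (i + 2)) * dist y z"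
        by (simp add: dist_real_def algebra_simps)
    qed (use M0 B[of x] r(1) in \<open>auto simp: B_def\<close>)
    then show ?thesis by blast
  qed
  define L where "L i = (SOME L. L-lipschitz_on (ball x r) (\<lambda>y. ex_part \<Omega> x0 i y * w i y))" for i
  have L: "(L i)-lipschitz_on (ball x r) (\<lambda>y. ex_part \<Omega> x0 i y * w i y)" for i
    unfolding L_def using ex by (rule someI_ex)
  have "(\<Sum>i\<in>A. L i)-lipschitz_on (ball x r) (\<lambda>y. \<Sum>i\<in>A. ex_part \<Omega> x0 i y * w i y)" if "finite A" for A
    using that
  proof (induction A)
    case empty
    then show ?case by (simp add: lipschitz_on_def)
  next
    case (insert j A)
    then show ?case using lipschitz_on_add[OF L[of j]] by simp
  qed
  moreover have eq: "glue \<Omega> x0 w y = (\<Sum>i\<le>k. ex_part \<Omega> x0 i y * w i y)" if "y \<in> ball x r" for y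
    using r(2) that by (intro glue_eq) auto
  ultimately have "(\<Sum>i\<le>k. L i)-lipschitz_on (ball x r) (\<lambda>y. \<Sum>i\<le>k. ex_part \<Omega> x0 i y * w i y)" by simp
  then have "(\<Sum>i\<le>k. L i)-lipschitz_on (ball x r) (glue \<Omega> x0 w)"
    by (rule lipschitz_on_transform) (simp add: eq)
  then have "(\<Sum>i\<le>k. L i)-lipschitz_on (ball x r \<inter> \<Omega>) (glue \<Omega> x0 w)"
    by (rule lipschitz_on_subset) auto
  with r(1) show "\<exists>r>0. \<exists>L. L-lipschitz_on (ball x r \<inter> \<Omega>) (glue \<Omega> x0 w)" by blast
qed

text \<open>In the application \<open>c = u x\<close>. The parts sum to \<open>1\<close> near
  \<open>x\<close>, so \<open>c\<close> can be subtracted inside the sums and the increments of the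
  parts meet only \<open>w i x - c\<close>. The weight \<open>2 ^ (2 * i + 2)\<close> beats their
  Lipschitz constant \<open>2 ^ (i + 2)\<close> and leaves \<open>(1/2) ^ i * H\<close>, with sum at
  most \<open>2 * H\<close>; the third \<open>H\<close> comes from
  \<open>lip (w i) x\<close>.\<close>

lemma glue_bounds:
  fixes \<Omega> :: "'a::metric_space set" and c G H :: real
  assumes "open \<Omega>" "x \<in> \<Omega>" and w: "\<And>i. lipschitz_fun (w i)" and "0 \<le> G" "0 \<le> H"
    and x: "\<And>i. exhaustion \<Omega> x0 (i + 2) x = 1 \<Longrightarrow> 2 ^ (2 * i + 2) * \<bar>w i x - c\<bar> \<le> H \<and> lip (w i) x \<le> G + H"
  shows "\<bar>glue \<Omega> x0 w x - c\<bar> \<le> H" "lip (glue \<Omega> x0 w) x \<le> G + 3 * H"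
proof -
  let ?\<phi> = "ex_part \<Omega> x0" and ?v = "glue \<Omega> x0 w"
  obtain k where k: "0 < exhaustion \<Omega> x0 k x" using exhaustion_covers[OF assms(1,2)] by blast
  have near: "\<forall>\<^sub>F y in at x. 0 < exhaustion \<Omega> x0 k y"
    using k continuous_on_exhaustion[of UNIV \<Omega> x0 k]
    by (metis UNIV_I continuous_on_eq_continuous_within isCont_def order_tendstoD(1))
  have S1: "\<bar>w i x - c\<bar> \<le> H" if "exhaustion \<Omega> x0 (i + 2) x = 1" for i
  proof -
    have "1 * \<bar>w i x - c\<bar> \<le> 2 ^ (2 * i + 2) * \<bar>w i x - c\<bar>"
      by (intro mult_right_mono one_le_power) auto
    with x[OF that] show ?thesis by simp
  qed
  have supp: "?\<phi> i x * \<bar>w i x - c\<bar> \<le> ?\<phi> i x * H" for i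
  proof (cases "?\<phi> i x = 0")
    case False
    then have "exhaustion \<Omega> x0 (Suc i) x \<noteq> 0" using ex_part_eq_0 by blast
    then have "exhaustion \<Omega> x0 (i + 2) x = 1" using exhaustion_Suc by fastforce
    then show ?thesis using S1 ex_part_nonneg by (intro mult_left_mono) auto
  qed auto
  have sum1: "(\<Sum>i\<le>k. ?\<phi> i x) = 1" using k by (intro sum_ex_part_1) auto
  have "?v x - c = (\<Sum>i\<le>k. ?\<phi> i x * w i x) - (\<Sum>i\<le>k. ?\<phi> i x) * c"
    using k sum1 by (simp add: glue_eq)
  also have "\<dots> = (\<Sum>i\<le>k. ?\<phi> i x * (w i x - c))"
    by (simp add: sum_distrib_right sum_subtractf right_diff_distrib)
  finally have "\<bar>?v x - c\<bar> \<le> (\<Sum>i\<le>k. ?\<phi> i x * \<bar>w i x - c\<bar>)"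
    using sum_abs[of "\<lambda>i. ?\<phi> i x * (w i x - c)" "{..k}"] ex_part_nonneg[of \<Omega> x0 _ x] by (simp add: abs_mult)
  also have "\<dots> \<le> (\<Sum>i\<le>k. ?\<phi> i x * H)" by (intro sum_mono supp)
  also have "\<dots> = H" using sum1 by (simp flip: sum_distrib_right)
  finally show "\<bar>?v x - c\<bar> \<le> H" .
  show "lip ?v x \<le> G + 3 * H"
  proof (rule lip_le)
    show "0 \<le> G + 3 * H" using assms by simp
    fix e :: real assume e: "e > 0"
    have "\<forall>\<^sub>F y in at x. \<bar>?\<phi> i y * (w i y - w i x)\<bar> \<le> ?\<phi> i y * ((G + H + e) * dist y x) \<and>
       \<bar>(?\<phi> i y - ?\<phi> i x) * (w i x - c)\<bar> \<le> (1/2) ^ i * H * dist y x" for i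
    \<comment> \<open>Either \<open>x\<close> lies in this closure, and the assumption applies at
      index \<open>i + 2\<close>, or the part vanishes in a whole neighbourhood of
      \<open>x\<close>.\<close>
    proof (cases "x \<in> closure {y. exhaustion \<Omega> x0 (Suc i) y \<noteq> 0}")
      case True
      then have 1: "exhaustion \<Omega> x0 (i + 2) x = 1" using exhaustion_Suc_closure by fastforce
      obtain M where M: "M-lipschitz_on UNIV (w i)" using w unfolding lipschitz_fun_def by blast
      have "\<forall>\<^sub>F y in at x. \<bar>w i y - w i x\<bar> \<le> (G + H + e) * dist y x"
        using x[OF 1] e by (intro eventually_le_lip[of 1 M] lipschitz_on_subset[OF M]) auto
      then show ?thesis
      proof eventually_elim
        case (elim y)
        have "\<bar>(?\<phi> i y - ?\<phi> i x) * (w i x - c)\<bar> \<le> (2 ^ (i + 2) * dist y x) * \<bar>w i x - c\<bar>"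
          unfolding abs_mult by (intro mult_right_mono ex_part_diff_le) auto
        also have "(2::real) ^ (i + 2) = (1/2) ^ i * 2 ^ (2 * i + 2)"
          by (induction i) auto
        also have "\<dots> * dist y x * \<bar>w i x - c\<bar> = (1/2) ^ i * (2 ^ (2 * i + 2) * \<bar>w i x - c\<bar>) * dist y x"
          by (simp only: ac_simps)
        also have "\<dots> \<le> (1/2) ^ i * H * dist y x"
          using x[OF 1] by (intro mult_right_mono mult_left_mono) auto
        finally show ?case
          using elim ex_part_nonneg[of \<Omega> x0 i y] by (auto simp: abs_mult intro!: mult_left_mono)
      qed
    next
      case False
      then have 0: "\<forall>\<^sub>F y in nhds x. exhaustion \<Omega> x0 (Suc i) y = 0"
        unfolding closure_approachable eventually_nhds_metric by (auto simp: dist_commute)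
      then have "?\<phi> i x = 0" using eventually_nhds_x_imp_x ex_part_eq_0 by blast
      moreover have "\<forall>\<^sub>F y in at x. exhaustion \<Omega> x0 (Suc i) y = 0"
        using 0 by (simp add: eventually_nhds_conv_at)
      ultimately show ?thesis
        using \<open>0 \<le> H\<close> by (auto elim!: eventually_mono simp: ex_part_eq_0)
    qed
    then have "\<forall>\<^sub>F y in at x. \<forall>i\<in>{..k}. \<bar>?\<phi> i y * (w i y - w i x)\<bar> \<le> ?\<phi> i y * ((G + H + e) * dist y x) \<and>
       \<bar>(?\<phi> i y - ?\<phi> i x) * (w i x - c)\<bar> \<le> (1/2) ^ i * H * dist y x"
      by (intro eventually_ball_finite) auto
    with near show "\<forall>\<^sub>F y in at x. \<bar>?v y - ?v x\<bar> \<le> (G + 3 * H + e) * dist y x"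
    proof eventually_elim
      case (elim y)
      have sum1y: "(\<Sum>i\<le>k. ?\<phi> i y) = 1" using elim by (intro sum_ex_part_1) auto
      have "?v y - ?v x = (\<Sum>i\<le>k. ?\<phi> i y * w i y - ?\<phi> i x * w i x) - ((\<Sum>i\<le>k. ?\<phi> i y) - (\<Sum>i\<le>k. ?\<phi> i x)) * c"
        using k elim sum1 sum1y by (simp add: glue_eq[of \<Omega> x0 k] sum_subtractf)
      also have "\<dots> = (\<Sum>i\<le>k. ?\<phi> i y * (w i y - w i x) + (?\<phi> i y - ?\<phi> i x) * (w i x - c))"
        by (simp add: sum_distrib_left sum.distrib sum_subtractf algebra_simps)
      finally have "\<bar>?v y - ?v x\<bar> \<le> (\<Sum>i\<le>k. \<bar>?\<phi> i y * (w i y - w i x) + (?\<phi> i y - ?\<phi> i x) * (w i x - c)\<bar>)"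
        by (simp add: sum_abs)
      also have "\<dots> \<le> (\<Sum>i\<le>k. ?\<phi> i y * ((G + H + e) * dist y x) + (1/2) ^ i * H * dist y x)"
        using elim by (intro sum_mono order_trans[OF abs_triangle_ineq] add_mono) auto
      also have "\<dots> = (G + H + e) * dist y x + (\<Sum>i\<le>k. (1/2) ^ i) * (H * dist y x)"
        using sum1y by (simp add: sum.distrib mult.assoc flip: sum_distrib_right)
      also have "(\<Sum>i\<le>k. (1/2::real) ^ i) = 2 - (1/2) ^ k"
        by (induction k) auto
      finally show ?case using \<open>0 \<le> H\<close> by (simp add: algebra_simps) (smt (verit) mult_nonneg_nonneg zero_le_dist zero_le_divide_1_iff zero_le_numeral zero_le_power)
    qed
  qed
qed

section \<open>Locally Lipschitz approximation of Sobolev functions\<close>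

lemma metric_measure_space_sets: "metric_measure_space m \<Longrightarrow> sets m = sets borel"
  by (simp add: metric_measure_space_def)

lemma metric_measure_space_borel:
  "metric_measure_space m \<Longrightarrow> f \<in> borel_measurable m \<longleftrightarrow> f \<in> borel_measurable borel"
  by (metis measurable_cong_sets metric_measure_space_sets)

lemma lipschitz_fun_borel: "lipschitz_fun w \<Longrightarrow> w \<in> borel_measurable borel"
  unfolding lipschitz_fun_def
  by (blast intro: borel_measurable_continuous_onI lipschitz_on_continuous_on)

lemma le_enn2real_powr:
  assumes "0 \<le> a" "0 < p" "ennreal (a powr p) \<le> S" "S < top"
  shows "a \<le> enn2real S powr (1 / p)"
proof -
  have "a powr p \<le> enn2real S" using enn2real_mono[OF assms(3,4)] by simp
  then have "(a powr p) powr (1 / p) \<le> enn2real S powr (1 / p)"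
    using assms by (intro powr_mono2) auto
  then show ?thesis using assms by (simp add: powr_powr)
qed

lemma ennreal_le_suminf: "f n \<le> (\<Sum>n. f n :: ennreal)"
  using sum_le_suminf[OF summableI, of "{n}" f] by simp

lemma tendsto_Lp_ex_le:
  assumes "tendsto_Lp p m w u" "0 < e"
  shows "\<forall>\<^sub>F n in sequentially. (\<integral>\<^sup>+x. ennreal (\<bar>w n x - u x\<bar> powr p) \<partial>m) \<le> ennreal e"
  using order_tendstoD(2)[OF assms(1)[unfolded tendsto_Lp_def], of "ennreal e"] assms(2)
  by (auto elim!: eventually_mono)

text \<open>One function \<open>H\<close> controls pointwise both the distance to \<open>u\<close>
  and the excess of the slope over \<open>Du\<close>: the coarea argument restricts the slopes to
  slabs of \<open>v\<close> that vary with the approximation, where norm estimates do not suffice.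
  Part \<open>i\<close> uses the cutoff of index \<open>i + 2\<close>, which is \<open>1\<close> on
  its support, so that \<open>z i = u\<close> and \<open>D i = Du\<close> there.\<close>

lemma sobolev_approx:
  fixes m :: "'a::polish_space measure"
  assumes m: "metric_measure_space m" and p: "1 < p" and \<Omega>: "open \<Omega>"
    and W: "W1p_loc p m \<Omega> u" and D: "local_minimal_weak_upper_gradient p m \<Omega> u Du" and e: "0 < e"
  shows "\<exists>v H. loc_lipschitz \<Omega> v \<and> H \<in> borel_measurable m \<and> (\<forall>x. 0 \<le> H x) \<and>
    (\<integral>\<^sup>+x. ennreal (H x powr p) \<partial>m) \<le> ennreal e \<and>
    (AE x in m. x \<in> \<Omega> \<longrightarrow> 0 \<le> Du x \<and> \<bar>v x - u x\<bar> \<le> H x \<and> lip v x \<le> Du x + 3 * H x)"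
proof -
  define x0 :: 'a where "x0 = undefined"
  define \<eta> where "\<eta> i = exhaustion \<Omega> x0 (i + 2)" for i
  define z where "z i = zero_extend \<Omega> (\<lambda>x. \<eta> i x * u x)" for i
  define K :: "nat \<Rightarrow> real" where "K i = 2 ^ (2 * i + 2)" for i
  \<comment> \<open>\<open>\<delta> i\<close> absorbs the weight \<open>K i\<close> required by
    \<open>glue_bounds\<close>: the two errors of index \<open>i\<close> cost at most
    \<open>2 * K i powr p * \<delta> i = e / 2 ^ (i + 1)\<close>, and these sum to
    \<open>e\<close>.\<close>
  define \<delta> where "\<delta> i = e / (2 ^ (i + 2) * K i powr p)" for i
  have K1: "1 \<le> K i" for i unfolding K_def by (intro one_le_power) auto
  have \<delta>: "0 < \<delta> i" for i using e K1[of i] unfolding \<delta>_def by (intro divide_pos_pos mult_pos_pos) auto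
  have \<eta>: "\<eta> i \<in> cutoffs \<Omega>" for i unfolding \<eta>_def by (rule exhaustion_in_cutoffs[OF \<Omega>])
  have z: "z i \<in> borel_measurable m" for i
    using W \<eta>[of i] by (auto simp: W1p_loc_def W1p_def in_Lp_def z_def)
  define Q where "Q i w g D \<longleftrightarrow> lipschitz_fun w \<and> g \<in> borel_measurable m \<and> D \<in> borel_measurable m \<and>
     (AE x in m. lip w x \<le> g x \<and> 0 \<le> D x \<and> (\<eta> i x = 1 \<longrightarrow> Du x = D x)) \<and>
     (\<integral>\<^sup>+x. ennreal (\<bar>w x - z i x\<bar> powr p) \<partial>m) \<le> ennreal (\<delta> i) \<and>
     (\<integral>\<^sup>+x. ennreal (\<bar>g x - D x\<bar> powr p) \<partial>m) \<le> ennreal (\<delta> i)"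
    for i :: nat and w g D :: "'a \<Rightarrow> real"
  have "\<exists>w g D. Q i w g D" for i
  proof -
    obtain D' where D': "weak_upper_gradient p m (z i) D'" "AE x in m. \<eta> i x = 1 \<longrightarrow> Du x = D' x"
      using D \<eta>[of i] unfolding local_minimal_weak_upper_gradient_def minimal_weak_upper_gradient_def z_def
      by blast
    then obtain w g where wg: "\<And>n. lipschitz_fun (w n)" "tendsto_Lp p m w (z i)"
        "\<And>n. in_Lp p m (g n)" "tendsto_Lp p m g D'" "\<And>n. AE x in m. lip (w n) x \<le> g n x"
      and D'': "in_Lp p m D'" "AE x in m. 0 \<le> D' x"
      unfolding weak_upper_gradient_def by blast
    obtain n where n: "(\<integral>\<^sup>+x. ennreal (\<bar>w n x - z i x\<bar> powr p) \<partial>m) \<le> ennreal (\<delta> i)"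
      "(\<integral>\<^sup>+x. ennreal (\<bar>g n x - D' x\<bar> powr p) \<partial>m) \<le> ennreal (\<delta> i)"
      using eventually_happens'[OF _ eventually_conj[OF tendsto_Lp_ex_le[OF wg(2) \<delta>[of i]] tendsto_Lp_ex_le[OF wg(4) \<delta>[of i]]]]
      by auto
    have "Q i (w n) (g n) D'"
      unfolding Q_def using wg(1)[of n] wg(3)[of n] wg(5)[of n] D'(2) D'' n
      by (auto simp: in_Lp_def)
    then show ?thesis by blast
  qed
  then obtain w g D where Q: "\<And>i. Q i (w i) (g i) (D i)" by metis
  have wl: "lipschitz_fun (w i)" for i using Q[of i] by (simp add: Q_def)
  have wm [measurable]: "w i \<in> borel_measurable m" for i
    using lipschitz_fun_borel[OF wl] by (simp add: metric_measure_space_borel[OF m])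
  have gm [measurable]: "g i \<in> borel_measurable m" "D i \<in> borel_measurable m" for i
    using Q[of i] by (simp_all add: Q_def)
  note z [measurable]
  define s where "s i x = ennreal ((K i * \<bar>w i x - z i x\<bar>) powr p) + ennreal (\<bar>g i x - D i x\<bar> powr p)" for i x
  have sm [measurable]: "s i \<in> borel_measurable m" for i unfolding s_def by measurable
  define S where "S x = (\<Sum>i. s i x)" for x
  have Sm [measurable]: "S \<in> borel_measurable m" unfolding S_def by measurable
  have "(\<integral>\<^sup>+x. s i x \<partial>m) \<le> ennreal (e * (1/2) ^ Suc i)" for i
  proof -
    have "(\<integral>\<^sup>+x. s i x \<partial>m) = (\<integral>\<^sup>+x. ennreal (K i powr p) * ennreal (\<bar>w i x - z i x\<bar> powr p) + ennreal (\<bar>g i x - D i x\<bar> powr p) \<partial>m)"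
      using K1[of i] unfolding s_def by (intro nn_integral_cong) (simp add: powr_mult ennreal_mult)
    also have "\<dots> = ennreal (K i powr p) * (\<integral>\<^sup>+x. ennreal (\<bar>w i x - z i x\<bar> powr p) \<partial>m) + (\<integral>\<^sup>+x. ennreal (\<bar>g i x - D i x\<bar> powr p) \<partial>m)"
      by (simp add: nn_integral_add nn_integral_cmult)
    also have "\<dots> \<le> ennreal (K i powr p) * ennreal (\<delta> i) + ennreal (\<delta> i)"
      using Q[of i] by (intro add_mono mult_left_mono) (auto simp: Q_def)
    also have "\<dots> = ennreal (K i powr p * \<delta> i + \<delta> i)" using \<delta>[of i] by (simp add: ennreal_mult)
    also have "\<dots> \<le> ennreal (e * (1/2) ^ Suc i)"
    proof (rule ennreal_leI)
      have "1 \<le> K i powr p" using K1[of i] p by (simp add: ge_one_powr_ge_zero)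
      then have "\<delta> i \<le> K i powr p * \<delta> i" using \<delta>[of i] by simp
      moreover have "K i powr p * \<delta> i = e / 2 ^ (i + 2)" using K1[of i] unfolding \<delta>_def by simp
      ultimately show "K i powr p * \<delta> i + \<delta> i \<le> e * (1/2) ^ Suc i"
        by (simp add: power_divide)
    qed
    finally show ?thesis .
  qed
  then have "(\<integral>\<^sup>+x. S x \<partial>m) \<le> (\<Sum>i. ennreal (e * (1/2) ^ Suc i))"
    unfolding S_def by (subst nn_integral_suminf) (auto intro!: suminf_le)
  also have "\<dots> = ennreal e"
    using sums_mult[OF power_half_series, of e] e by (intro suminf_ennreal_eq) auto
  finally have Se: "(\<integral>\<^sup>+x. S x \<partial>m) \<le> ennreal e" .
  then have "AE x in m. S x \<noteq> \<infinity>"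
    by (intro nn_integral_PInf_AE Sm) (auto simp: top_unique)
  then have Sfin: "AE x in m. S x < top" by (auto simp: less_top)
  \<comment> \<open>\<open>S\<close> dominates the \<open>p\<close>-th power of every weighted
    error, so \<open>H\<close> dominates all the errors at once wherever \<open>S\<close> is
    finite.\<close>
  define H where "H x = enn2real (S x) powr (1 / p)" for x
  have Hm: "H \<in> borel_measurable m" unfolding H_def by measurable
  have "(\<integral>\<^sup>+x. ennreal (H x powr p) \<partial>m) \<le> (\<integral>\<^sup>+x. S x \<partial>m)"
    using p unfolding H_def by (intro nn_integral_mono) (simp add: powr_powr ennreal_enn2real_if)
  with Se have HI: "(\<integral>\<^sup>+x. ennreal (H x powr p) \<partial>m) \<le> ennreal e" by (rule order_trans[rotated])
  have "AE x in m. \<forall>i. lip (w i) x \<le> g i x \<and> 0 \<le> D i x \<and> (\<eta> i x = 1 \<longrightarrow> Du x = D i x)"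
    using Q unfolding Q_def by (subst AE_all_countable) blast
  with Sfin have "AE x in m. x \<in> \<Omega> \<longrightarrow> 0 \<le> Du x \<and> \<bar>glue \<Omega> x0 w x - u x\<bar> \<le> H x \<and> lip (glue \<Omega> x0 w) x \<le> Du x + 3 * H x"
  proof eventually_elim
    case (elim x)
    show ?case
    proof
      assume x: "x \<in> \<Omega>"
      have H0: "0 \<le> H x" by (simp add: H_def)
      have si: "s i x \<le> S x" for i unfolding S_def by (rule ennreal_le_suminf)
      have 1: "K i * \<bar>w i x - z i x\<bar> \<le> H x" "\<bar>g i x - D i x\<bar> \<le> H x" for i
      proof -
        have "ennreal ((K i * \<bar>w i x - z i x\<bar>) powr p) \<le> s i x" "ennreal (\<bar>g i x - D i x\<bar> powr p) \<le> s i x"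
          unfolding s_def by (simp_all add: add_increasing add_increasing2)
        with si[of i] show "K i * \<bar>w i x - z i x\<bar> \<le> H x" "\<bar>g i x - D i x\<bar> \<le> H x"
          using p K1[of i] elim(1) unfolding H_def
          by (auto intro!: le_enn2real_powr mult_nonneg_nonneg intro: order_trans)
      qed
      \<comment> \<open>Some cutoff equals \<open>1\<close> at \<open>x\<close>, which identifies
        \<open>Du x\<close> with a nonnegative \<open>D k x\<close>.\<close>
      obtain k where "0 < exhaustion \<Omega> x0 k x" using exhaustion_covers[OF \<Omega> x] by blast
      then have "\<eta> k x = 1" unfolding \<eta>_def by (intro exhaustion_eq_1[of _ _ k]) auto
      then have Du0: "0 \<le> Du x" using elim(2) by metis
      have 2: "2 ^ (2 * i + 2) * \<bar>w i x - u x\<bar> \<le> H x \<and> lip (w i) x \<le> Du x + H x"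
        if i: "exhaustion \<Omega> x0 (i + 2) x = 1" for i
      proof -
        have "\<eta> i x = 1" using i by (simp add: \<eta>_def)
        then have "z i x = u x" "Du x = D i x" using x elim(2) by (auto simp: z_def zero_extend_def)
        then show ?thesis using 1[of i] elim(2)[rule_format, of i] by (auto simp: K_def)
      qed
      show "0 \<le> Du x \<and> \<bar>glue \<Omega> x0 w x - u x\<bar> \<le> H x \<and> lip (glue \<Omega> x0 w) x \<le> Du x + 3 * H x"
        using glue_bounds[OF \<Omega> x wl Du0 H0 2] Du0 by blast
    qed
  qed
  moreover have "loc_lipschitz \<Omega> (glue \<Omega> x0 w)" by (rule loc_lipschitz_glue[OF \<Omega> wl])
  ultimately show ?thesis using Hm HI by (intro exI[of _ "glue \<Omega> x0 w"] exI[of _ H]) (auto simp: H_def)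
qed

section \<open>Coarea inequality\<close>

lemma metric_measure_space_space: "metric_measure_space m \<Longrightarrow> space m = UNIV"
  using sets_eq_imp_space_eq[OF metric_measure_space_sets] by fastforce

lemma metric_measure_space_sigma_finite:
  fixes m :: "'a::polish_space measure"
  assumes m: "metric_measure_space m"
  shows "sigma_finite_measure m"
proof
  let ?A = "range (\<lambda>n::nat. ball (undefined::'a) (real n))"
  have "\<Union> ?A = UNIV" using reals_Archimedean2 by (fastforce simp: set_eq_iff)
  then have "\<Union> ?A = space m" by (simp add: metric_measure_space_space[OF m])
  moreover have "?A \<subseteq> sets m" by (auto simp: metric_measure_space_sets[OF m])
  moreover have "\<forall>a\<in>?A. emeasure m a \<noteq> \<infinity>"
    using m by (auto simp: metric_measure_space_def less_top)
  ultimately show "\<exists>A. countable A \<and> A \<subseteq> sets m \<and> \<Union> A = space m \<and> (\<forall>a\<in>A. emeasure m a \<noteq> \<infinity>)"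
    by (intro exI[of _ ?A]) auto
qed

lemma emeasure_diameter_le:
  fixes A :: "real set"
  assumes "A \<in> sets borel" "0 \<le> h" "\<And>x x'. x \<in> A \<Longrightarrow> x' \<in> A \<Longrightarrow> x' - x \<le> h"
  shows "emeasure lborel A \<le> ennreal h"
proof (cases "A = {}")
  case False
  then obtain a where a: "a \<in> A" by blast
  have bdd: "bdd_below A" using assms(3)[OF _ a] by (intro bdd_belowI[of _ "a - h"]) (auto simp: algebra_simps)
  have "A \<subseteq> {Inf A..Inf A + h}"
  proof
    fix x assume x: "x \<in> A"
    have "x - h \<le> Inf A" using assms(3)[OF _ x] False by (intro cInf_greatest) (auto simp: algebra_simps)
    moreover have "Inf A \<le> x" by (rule cInf_lower[OF x bdd])
    ultimately show "x \<in> {Inf A..Inf A + h}" by auto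
  qed
  then have "emeasure lborel A \<le> emeasure lborel {Inf A..Inf A + h}"
    by (intro emeasure_mono) auto
  then show ?thesis using assms(2) by simp
qed auto

text \<open>Tonelli's theorem, after which each \<open>x\<close>-section is bounded by its diameter.
  In the coarea bound \<open>x\<close> is a level and \<open>h\<close> the width of a ramp; in the
  energy bound \<open>x\<close> is a position in \<open>Omega_star\<close> and \<open>h\<close> the
  step of a difference quotient.\<close>

lemma nn_integral_sections_le:
  fixes f :: "'b \<Rightarrow> ennreal" and h :: real
  assumes M: "sigma_finite_measure M" and D [measurable]: "D \<in> sets (lborel \<Otimes>\<^sub>M M)"
    and f [measurable]: "f \<in> borel_measurable M" and "0 \<le> h"
    and diam: "\<And>x x' y. (x, y) \<in> D \<Longrightarrow> (x', y) \<in> D \<Longrightarrow> x' - x \<le> h"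
    and Y: "\<And>x y. (x, y) \<in> D \<Longrightarrow> y \<in> Y"
  shows "(\<integral>\<^sup>+x. (\<integral>\<^sup>+y. f y * indicator D (x, y) \<partial>M) \<partial>lborel) \<le> (\<integral>\<^sup>+y. ennreal h * f y * indicator Y y \<partial>M)"
proof -
  interpret M: sigma_finite_measure M by fact
  interpret pair_sigma_finite lborel M ..
  have "(\<integral>\<^sup>+x. (\<integral>\<^sup>+y. f y * indicator D (x, y) \<partial>M) \<partial>lborel) = (\<integral>\<^sup>+y. (\<integral>\<^sup>+x. f y * indicator D (x, y) \<partial>lborel) \<partial>M)"
    by (rule Fubini'[symmetric]) measurable
  also have "\<dots> \<le> (\<integral>\<^sup>+y. ennreal h * f y * indicator Y y \<partial>M)"
  proof (rule nn_integral_mono)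
    fix y assume y: "y \<in> space M"
    have Dy: "(\<lambda>x. (x, y)) -` D \<in> sets borel" using sets_Pair2[OF D, of y] by simp
    have "(\<integral>\<^sup>+x. f y * indicator D (x, y) \<partial>lborel) = (\<integral>\<^sup>+x. f y * indicator ((\<lambda>x. (x, y)) -` D) x \<partial>lborel)"
      by (intro nn_integral_cong) (auto split: split_indicator)
    also have "\<dots> = f y * emeasure lborel ((\<lambda>x. (x, y)) -` D)"
      using Dy by (subst nn_integral_cmult_indicator) auto
    also have "\<dots> \<le> ennreal h * f y * indicator Y y"
    proof (cases "y \<in> Y")
      case True
      have "emeasure lborel ((\<lambda>x. (x, y)) -` D) \<le> ennreal h"
        using \<open>0 \<le> h\<close> diam by (intro emeasure_diameter_le[OF Dy]) auto
      then show ?thesis using True by (simp add: mult.commute[of "ennreal h"] mult_left_mono)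
    next
      case False
      then have "(\<lambda>x. (x, y)) -` D = {}" using Y by auto
      then show ?thesis by simp
    qed
    finally show "(\<integral>\<^sup>+x. f y * indicator D (x, y) \<partial>lborel) \<le> ennreal h * f y * indicator Y y" .
  qed
  finally show ?thesis .
qed

section \<open>Ramps and the perimeter of superlevel sets\<close>

definition ramp :: "real \<Rightarrow> real \<Rightarrow> real \<Rightarrow> real" where
  "ramp r h z = max 0 (min 1 ((z - r) / h))"

lemma ramp_range: "0 \<le> ramp r h z" "ramp r h z \<le> 1"
  by (auto simp: ramp_def)

lemma ramp_low: "0 < h \<Longrightarrow> z \<le> r \<Longrightarrow> ramp r h z = 0"
  using divide_nonpos_pos[of "z - r" h] by (simp add: ramp_def)

lemma ramp_high: "0 < h \<Longrightarrow> r + h \<le> z \<Longrightarrow> ramp r h z = 1"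
  by (auto simp: ramp_def max_def min_def field_simps)

lemma ramp_diff_le: "0 < h \<Longrightarrow> \<bar>ramp r h y - ramp r h z\<bar> \<le> \<bar>y - z\<bar> / h"
proof -
  assume h: "0 < h"
  have "\<bar>(y - r) / h - (z - r) / h\<bar> = \<bar>y - z\<bar> / h"
    using h by (simp flip: diff_divide_distrib)
  then show ?thesis unfolding ramp_def by linarith
qed

lemma ramp_borel [measurable]: "ramp r h \<in> borel_measurable borel"
  unfolding ramp_def by measurable

lemma loc_lipschitz_ball:
  assumes "loc_lipschitz \<Omega> v" "open \<Omega>" "x \<in> \<Omega>"
  obtains r L where "0 < r" "ball x r \<subseteq> \<Omega>" "L-lipschitz_on (ball x r) v"
proof -
  obtain r L where r: "0 < r" "L-lipschitz_on (ball x r \<inter> \<Omega>) v"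
    using assms(1,3) unfolding loc_lipschitz_def by blast
  obtain r' where r': "0 < r'" "ball x r' \<subseteq> \<Omega>" using assms(2,3) openE by blast
  show thesis
  proof
    show "L-lipschitz_on (ball x (min r r')) v"
      using r' by (intro lipschitz_on_subset[OF r(2)]) auto
  qed (use r r' in auto)
qed

lemma loc_lipschitz_isCont:
  assumes "loc_lipschitz \<Omega> v" "open \<Omega>" "x \<in> \<Omega>"
  shows "isCont v x"
proof -
  obtain r L where r: "0 < r" "L-lipschitz_on (ball x r) v"
    using loc_lipschitz_ball[OF assms] by metis
  then show ?thesis
    using lipschitz_on_continuous_on[OF r(2)] by (simp add: continuous_on_eq_continuous_at)
qed

lemma loc_lipschitz_ramp:
  assumes "loc_lipschitz \<Omega> v" "0 < h"
  shows "loc_lipschitz \<Omega> (\<lambda>y. ramp r h (v y))"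
  unfolding loc_lipschitz_def
proof
  fix x assume "x \<in> \<Omega>"
  then obtain d L where d: "0 < d" "L-lipschitz_on (ball x d \<inter> \<Omega>) v"
    using assms unfolding loc_lipschitz_def by blast
  have "(L / h)-lipschitz_on (ball x d \<inter> \<Omega>) (\<lambda>y. ramp r h (v y))"
  proof (rule lipschitz_onI)
    fix y z assume yz: "y \<in> ball x d \<inter> \<Omega>" "z \<in> ball x d \<inter> \<Omega>"
    have "\<bar>ramp r h (v y) - ramp r h (v z)\<bar> \<le> \<bar>v y - v z\<bar> / h" by (rule ramp_diff_le[OF assms(2)])
    also have "\<dots> \<le> L * dist y z / h"
      using lipschitz_onD[OF d(2) yz] assms(2) by (intro divide_right_mono) (auto simp: dist_real_def)
    finally show "dist (ramp r h (v y)) (ramp r h (v z)) \<le> L / h * dist y z" by (simp add: dist_real_def)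
  qed (use lipschitz_on_nonneg[OF d(2)] assms(2) in auto)
  with d(1) show "\<exists>d>0. \<exists>L. L-lipschitz_on (ball x d \<inter> \<Omega>) (\<lambda>y. ramp r h (v y))" by blast
qed

text \<open>Off the closed interval, continuity keeps \<open>v\<close> on one flat side of the ramp
  near \<open>x\<close>. At the two ends this can fail, hence the closed interval in the
  indicator.\<close>

lemma lip_ramp_le:
  assumes v: "loc_lipschitz \<Omega> v" "open \<Omega>" "x \<in> \<Omega>" and "0 < h" "lip v x \<le> c" "0 \<le> c"
  shows "lip (\<lambda>y. ramp r h (v y)) x \<le> (1 / h) * c * indicator {r..r + h} (v x)"
proof -
  have lim: "(v \<longlongrightarrow> v x) (at x)" using loc_lipschitz_isCont[OF v] by (simp add: isCont_def)
  consider "v x < r" | "r + h < v x" | "v x \<in> {r..r + h}" by fastforce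
  then show ?thesis
  proof cases
    case 1
    then have "\<forall>\<^sub>F y in at x. v y < r" by (rule order_tendstoD(2)[OF lim])
    then have "lip (\<lambda>y. ramp r h (v y)) x \<le> 0"
      by (intro lip_le) (use 1 \<open>0 < h\<close> in \<open>auto elim!: eventually_mono simp: ramp_low\<close>)
    with 1 show ?thesis by simp
  next
    case 2
    then have "\<forall>\<^sub>F y in at x. r + h < v y" by (rule order_tendstoD(1)[OF lim])
    then have "lip (\<lambda>y. ramp r h (v y)) x \<le> 0"
      by (intro lip_le) (use 2 \<open>0 < h\<close> in \<open>auto elim!: eventually_mono simp: ramp_high\<close>)
    with 2 show ?thesis by simp
  next
    case 3
    obtain d L where d: "0 < d" "L-lipschitz_on (ball x d) v"
      using loc_lipschitz_ball[OF v] by metis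
    have "lip (\<lambda>y. ramp r h (v y)) x \<le> c / h"
    proof (rule lip_le)
      fix e :: real assume "e > 0"
      then have "0 < e * h" using assms(4) by simp
      then have "\<forall>\<^sub>F y in at x. \<bar>v y - v x\<bar> \<le> (c + e * h) * dist y x"
        using assms(5) by (intro eventually_le_lip[OF d]) linarith
      then show "\<forall>\<^sub>F y in at x. \<bar>ramp r h (v y) - ramp r h (v x)\<bar> \<le> (c / h + e) * dist y x"
      proof eventually_elim
        case (elim y)
        have "\<bar>ramp r h (v y) - ramp r h (v x)\<bar> \<le> \<bar>v y - v x\<bar> / h" by (rule ramp_diff_le[OF assms(4)])
        also have "\<dots> \<le> (c + e * h) * dist y x / h"
          using elim assms(4) by (intro divide_right_mono) auto
        also have "\<dots> = (c / h + e) * dist y x" using assms(4) by (simp add: field_simps)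
        finally show ?case .
      qed
    qed (use assms in auto)
    with 3 show ?thesis by simp
  qed
qed

lemma loc_lipschitz_borel:
  fixes \<Omega> :: "'a::metric_space set"
  assumes "loc_lipschitz \<Omega> v" "open \<Omega>"
  shows "v \<in> borel_measurable (restrict_space borel \<Omega>)"
  using loc_lipschitz_isCont[OF assms]
  by (intro borel_measurable_continuous_on_restrict continuous_at_imp_continuous_on) auto

text \<open>The ramps of \<open>v n\<close> compete in the definition of \<open>Per\<close>. Where
  \<open>u = r\<close> the limit of \<open>v n\<close> does not decide the limit of the ramps, so
  this set has to be null; elsewhere they converge to the indicator of \<open>E\<close>, and
  dominated convergence on balls of finite measure gives convergence in
  \<open>L^1_loc\<close>.\<close>

lemma Per_le_liminf_ramps:
  fixes m :: "'a::polish_space measure"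
  assumes m: "metric_measure_space m" and \<Omega>: "open \<Omega>" and E: "E \<in> sets borel"
    and v: "\<And>n. loc_lipschitz \<Omega> (v n)" and h: "\<And>n. 0 < h n" "h \<longlonglongrightarrow> 0"
    and lim: "AE x in m. x \<in> \<Omega> \<longrightarrow> (\<lambda>n. v n x) \<longlonglongrightarrow> u x"
    and Eu: "AE x in m. x \<in> \<Omega> \<longrightarrow> (x \<in> E \<longleftrightarrow> u x > r) \<and> u x \<noteq> r"
    and G: "\<And>n. AE x in m. x \<in> \<Omega> \<longrightarrow> lip (v n) x \<le> G n x \<and> 0 \<le> G n x"
  shows "Per m E \<Omega> \<le> liminf (\<lambda>n. \<integral>\<^sup>+x\<in>\<Omega>. ennreal ((1 / h n) * G n x * indicator {r..r + h n} (v n x)) \<partial>m)"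
proof -
  let ?w = "\<lambda>n y. ramp r (h n) (v n y)"
  have loc: "loc_lipschitz \<Omega> (?w n)" for n by (rule loc_lipschitz_ramp[OF v h(1)])
  have "tendsto_L1_loc m \<Omega> ?w (indicator E)"
    unfolding tendsto_L1_loc_def
  proof
    fix x assume "x \<in> \<Omega>"
    then obtain \<rho> where \<rho>: "0 < \<rho>" "ball x \<rho> \<subseteq> \<Omega>" using \<Omega> openE by blast
    have fin: "emeasure m (ball x \<rho>) < \<infinity>" using m by (auto simp: metric_measure_space_def)
    let ?f = "\<lambda>n y. ennreal \<bar>?w n y - indicator E y\<bar> * indicator (ball x \<rho>) y"
    have mf: "?f n \<in> borel_measurable m" for n
    proof -
      have "?w n \<in> borel_measurable (restrict_space borel (ball x \<rho>))"
        using measurable_restrict_mono[OF loc_lipschitz_borel[OF v \<Omega>] \<rho>(2)] by measurable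
      moreover have "indicator E \<in> borel_measurable (restrict_space borel (ball x \<rho>))"
        by (intro measurable_restrict_space1 borel_measurable_indicator E)
      ultimately have "(\<lambda>y. ennreal \<bar>?w n y - indicator E y\<bar>) \<in> borel_measurable (restrict_space borel (ball x \<rho>))"
        by measurable
      then have "?f n \<in> borel_measurable borel"
        by (subst (asm) borel_measurable_restrict_space_iff_ennreal) auto
      then show ?thesis by (simp add: metric_measure_space_borel[OF m] measurable_cong_sets[OF metric_measure_space_sets[OF m] refl])
    qed
    have "(\<lambda>n. \<integral>\<^sup>+y. ?f n y \<partial>m) \<longlonglongrightarrow> (\<integral>\<^sup>+y. 0 \<partial>m)"
    proof (rule nn_integral_dominated_convergence[where w = "indicator (ball x \<rho>)"])
      show "AE y in m. ?f n y \<le> indicator (ball x \<rho>) y" for n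
      proof (rule AE_I2)
        fix y
        have "\<bar>?w n y - indicator E y\<bar> \<le> 1"
          using ramp_range[of r "h n" "v n y"] by (auto split: split_indicator)
        then show "?f n y \<le> indicator (ball x \<rho>) y" by (auto split: split_indicator)
      qed
      show "(\<integral>\<^sup>+y. indicator (ball x \<rho>) y \<partial>m) < \<infinity>"
        using fin by (subst nn_integral_indicator) (auto simp: metric_measure_space_sets[OF m])
      show "AE y in m. (\<lambda>n. ?f n y) \<longlonglongrightarrow> 0"
        using lim Eu
      proof eventually_elim
        case (elim y)
        show ?case
        proof (cases "y \<in> ball x \<rho>")
          case True
          then have y: "(\<lambda>n. v n y) \<longlonglongrightarrow> u y" "y \<in> E \<longleftrightarrow> u y > r" "u y \<noteq> r"
            using elim \<rho> by auto
          have "\<forall>\<^sub>F n in sequentially. ?w n y = indicator E y"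
          proof (cases "u y < r")
            case True
            then have "\<forall>\<^sub>F n in sequentially. v n y < r" by (rule order_tendstoD(2)[OF y(1)])
            then show ?thesis by eventually_elim (use True y h(1) in \<open>auto simp: ramp_low\<close>)
          next
            case False
            \<comment> \<open>The width is subtracted because the ramp reaches \<open>1\<close> only
              at \<open>r + h n\<close>.\<close>
            have "(\<lambda>n. v n y - h n) \<longlonglongrightarrow> u y - 0" by (intro tendsto_diff y h)
            moreover have "r < u y - 0" using False y by auto
            ultimately have "\<forall>\<^sub>F n in sequentially. r < v n y - h n" by (rule order_tendstoD(1))
            then show ?thesis by eventually_elim (use False y h(1) in \<open>auto simp: ramp_high\<close>)
          qed
          then have "\<forall>\<^sub>F n in sequentially. ?f n y = 0" by eventually_elim simp
          then show ?thesis by (rule tendsto_eventually)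
        qed simp
      qed
      show "indicator (ball x \<rho>) \<in> borel_measurable m"
        by (intro borel_measurable_indicator) (auto simp: metric_measure_space_sets[OF m])
    qed (use mf in auto)
    then show "\<exists>\<rho>>0. ball x \<rho> \<subseteq> \<Omega> \<and> (\<lambda>n. \<integral>\<^sup>+y\<in>ball x \<rho>. ennreal \<bar>?w n y - indicator E y\<bar> \<partial>m) \<longlonglongrightarrow> 0"
      using \<rho> by auto
  qed
  with loc have "Per m E \<Omega> \<le> liminf (\<lambda>n. \<integral>\<^sup>+x\<in>\<Omega>. ennreal (lip (?w n) x) \<partial>m)"
    unfolding Per_def total_variation_def
    by (intro Inf_lower CollectI exI[of _ ?w]) simp
  also have "\<dots> \<le> liminf (\<lambda>n. \<integral>\<^sup>+x\<in>\<Omega>. ennreal ((1 / h n) * G n x * indicator {r..r + h n} (v n x)) \<partial>m)"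
  proof (rule Liminf_mono[OF always_eventually, OF allI], rule nn_integral_mono_AE)
    fix n
    show "AE x in m. ennreal (lip (?w n) x) * indicator \<Omega> x
       \<le> ennreal ((1 / h n) * G n x * indicator {r..r + h n} (v n x)) * indicator \<Omega> x"
      using G[of n]
    proof eventually_elim
      case (elim x)
      then show ?case
        using lip_ramp_le[OF v \<Omega> _ h(1), of x n "G n x" r n]
        by (cases "x \<in> \<Omega>") (auto intro!: ennreal_leI)
    qed
  qed
  finally show ?thesis .
qed

text \<open>When the ramp estimate is integrated over \<open>s < r < t\<close>, a point
  \<open>x\<close> counts only for levels in an interval of length \<open>h n\<close> below
  \<open>v n x\<close>, which cancels the factor \<open>1 / h n\<close>. Fatou's lemma in the level
  and reverse Fatou in the point remove the approximation. The level \<open>s0\<close> below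
  \<open>s\<close> leaves room for a dominating function when \<open>\<Omega>\<close> has infinite
  measure.\<close>

lemma coarea_bound:
  fixes m :: "'a::polish_space measure"
  assumes m: "metric_measure_space m" and p: "1 < p" and \<Omega>: "open \<Omega>"
    and W: "W1p_loc p m \<Omega> u" and Du: "local_minimal_weak_upper_gradient p m \<Omega> u Du"
    and fin: "(\<integral>\<^sup>+x\<in>\<Omega>. ennreal (\<bar>Du x\<bar> powr p) \<partial>m) < \<infinity>"
    and s: "s0 < s" "s < t" and s0: "emeasure m {x \<in> \<Omega>. s0 < u x} < \<infinity>"
    and E: "\<And>r. s < r \<Longrightarrow> r < t \<Longrightarrow> E r \<in> sets borel"
      "\<And>r. s < r \<Longrightarrow> r < t \<Longrightarrow> AE x in m. x \<in> \<Omega> \<longrightarrow> (x \<in> E r \<longleftrightarrow> u x > r)"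
    and P: "\<And>r. s < r \<Longrightarrow> r < t \<Longrightarrow> P \<le> Per m (E r) \<Omega>"
  shows "P * ennreal (t - s) \<le> (\<integral>\<^sup>+x\<in>{x \<in> \<Omega>. s \<le> u x \<and> u x \<le> t}. ennreal \<bar>Du x\<bar> \<partial>m)"
proof -
  define M where "M = restrict_space m \<Omega>"
  have \<Omega>m: "\<Omega> \<in> sets m" using \<Omega> by (simp add: metric_measure_space_sets[OF m])
  have spm: "\<Omega> \<inter> space m \<in> sets m" using \<Omega>m by (simp add: metric_measure_space_space[OF m])
  have spM: "space M = \<Omega>" by (simp add: M_def space_restrict_space metric_measure_space_space[OF m])
  have AEM: "(AE x in M. Q x) \<longleftrightarrow> (AE x in m. x \<in> \<Omega> \<longrightarrow> Q x)" for Q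
    unfolding M_def by (rule AE_restrict_space_iff[OF spm])
  have IM: "(\<integral>\<^sup>+x. f x \<partial>M) = (\<integral>\<^sup>+x\<in>\<Omega>. f x \<partial>m)" for f
    unfolding M_def by (rule nn_integral_restrict_space[OF spm])
  have sfM: "sigma_finite_measure M"
    unfolding M_def by (intro sigma_finite_measure_restrict_space metric_measure_space_sigma_finite m \<Omega>m)
  have um [measurable]: "u \<in> borel_measurable M"
    using W by (simp add: W1p_loc_def in_Lp_loc_def M_def)
  have Dum [measurable]: "Du \<in> borel_measurable M"
    using Du by (simp add: local_minimal_weak_upper_gradient_def M_def)
  define h :: "nat \<Rightarrow> real" where "h n = 1 / real (Suc n)" for n
  have h: "0 < h n" for n by (simp add: h_def)
  have h0: "h \<longlonglongrightarrow> 0" unfolding h_def using LIMSEQ_Suc[OF lim_1_over_n[where 'a=real]] by simp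
  define Q where "Q n v H \<longleftrightarrow> loc_lipschitz \<Omega> v \<and> H \<in> borel_measurable m \<and> (\<forall>x. 0 \<le> H x) \<and>
    (\<integral>\<^sup>+x. ennreal (H x powr p) \<partial>m) \<le> ennreal ((1/2) ^ Suc n) \<and>
    (AE x in m. x \<in> \<Omega> \<longrightarrow> 0 \<le> Du x \<and> \<bar>v x - u x\<bar> \<le> H x \<and> lip v x \<le> Du x + 3 * H x)" for n :: nat and v H
  have "\<exists>v H. Q n v H" for n
    unfolding Q_def by (rule sobolev_approx[OF m p \<Omega> W Du]) simp
  then obtain v H where Q: "\<And>n. Q n (v n) (H n)" by metis
  have v: "loc_lipschitz \<Omega> (v n)" and Hm: "H n \<in> borel_measurable m" and H0: "0 \<le> H n x"
    and HI: "(\<integral>\<^sup>+x. ennreal (H n x powr p) \<partial>m) \<le> ennreal ((1/2) ^ Suc n)"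
    and vH: "AE x in m. x \<in> \<Omega> \<longrightarrow> 0 \<le> Du x \<and> \<bar>v n x - u x\<bar> \<le> H n x \<and> lip (v n) x \<le> Du x + 3 * H n x"
    for n x
    using Q[of n] by (simp_all add: Q_def)
  have vm [measurable]: "v n \<in> borel_measurable M" for n
    using loc_lipschitz_borel[OF v \<Omega>, of n] unfolding M_def
    by (simp add: measurable_cong_sets[OF sets_restrict_space_cong[OF metric_measure_space_sets[OF m]] refl])
  note Hm [measurable]
  have HM [measurable]: "H n \<in> borel_measurable M" for n
    unfolding M_def by (intro measurable_restrict_space1 Hm)
  define G where "G n x = \<bar>Du x\<bar> + 3 * H n x" for n x
  have Gm [measurable]: "G n \<in> borel_measurable M" for n unfolding G_def by measurable
  have G0: "0 \<le> G n x" for n x using H0 by (simp add: G_def)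
  \<comment> \<open>\<open>K\<close> is integrable and dominates every \<open>H n x powr p\<close>.
    Hence \<open>H n\<close> tends to \<open>0\<close> a.e. without passing to a subsequence, and
    \<open>K\<close> can enter the dominating function.\<close>
  define K where "K x = (\<Sum>n. ennreal (H n x powr p))" for x
  have Km [measurable]: "K \<in> borel_measurable m" unfolding K_def by measurable
  have KI: "(\<integral>\<^sup>+x. K x \<partial>m) \<le> ennreal 1"
  proof -
    have "(\<integral>\<^sup>+x. K x \<partial>m) \<le> (\<Sum>n. ennreal ((1/2) ^ Suc n))"
      using HI unfolding K_def by (subst nn_integral_suminf) (auto intro!: suminf_le)
    also have "\<dots> = ennreal 1"
      using power_half_series by (intro suminf_ennreal_eq) auto
    finally show ?thesis .
  qed
  have KM [measurable]: "K \<in> borel_measurable M" unfolding M_def by (intro measurable_restrict_space1 Km)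
  have KIM: "(\<integral>\<^sup>+x. K x \<partial>M) \<le> ennreal 1"
  proof -
    have "(\<integral>\<^sup>+x. K x \<partial>M) \<le> (\<integral>\<^sup>+x. K x \<partial>m)" unfolding IM by (intro nn_integral_mono) (auto split: split_indicator)
    with KI show ?thesis by simp
  qed
  have "AE x in m. K x \<noteq> \<infinity>"
    using KI by (intro nn_integral_PInf_AE Km) (auto simp: top_unique)
  then have Hlim: "AE x in m. (\<lambda>n. H n x) \<longlonglongrightarrow> 0"
  proof eventually_elim
    case (elim x)
    have "summable (\<lambda>n. H n x powr p)"
      using elim unfolding K_def by (intro summable_suminf_not_top) auto
    then have "(\<lambda>n. H n x powr p) \<longlonglongrightarrow> 0" by (rule summable_LIMSEQ_zero)
    then have "(\<lambda>n. (H n x powr p) powr (1 / p)) \<longlonglongrightarrow> 0 powr (1 / p)"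
      using p by (intro tendsto_powr2) auto
    then show ?case using p H0 by (simp add: powr_powr)
  qed
  have vlim: "AE x in m. x \<in> \<Omega> \<longrightarrow> (\<lambda>n. v n x) \<longlonglongrightarrow> u x"
  proof -
    have "AE x in m. x \<in> \<Omega> \<longrightarrow> \<bar>v n x - u x\<bar> \<le> H n x" for n
      using vH[of n] by eventually_elim auto
    then have "AE x in m. \<forall>n. x \<in> \<Omega> \<longrightarrow> \<bar>v n x - u x\<bar> \<le> H n x"
      by (subst AE_all_countable) blast
    with Hlim show ?thesis
    proof eventually_elim
      case (elim x)
      show ?case
      proof
        assume "x \<in> \<Omega>"
        then have "(\<lambda>n. v n x - u x) \<longlonglongrightarrow> 0"
          using elim by (intro Lim_null_comparison[OF _ elim(1)]) auto
        then show "(\<lambda>n. v n x) \<longlonglongrightarrow> u x" by (simp add: LIM_zero_iff)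
      qed
    qed
  qed
  define A where "A n r = (\<integral>\<^sup>+x. ennreal ((1 / h n) * G n x * indicator {r..r + h n} (v n x)) \<partial>M)" for n r
  define B where "B n = {z \<in> space (lborel \<Otimes>\<^sub>M M). s < fst z \<and> fst z < t \<and> fst z \<le> v n (snd z) \<and> v n (snd z) \<le> fst z + h n}" for n
  have Bm [measurable]: "B n \<in> sets (lborel \<Otimes>\<^sub>M M)" for n unfolding B_def by measurable
  have AB: "indicator {s<..<t} r * A n r = (\<integral>\<^sup>+x. ennreal ((1 / h n) * G n x) * indicator (B n) (r, x) \<partial>M)" for n r
    unfolding A_def B_def
    by (subst nn_integral_cmult[symmetric], measurable)
       (intro nn_integral_cong, auto split: split_indicator simp: space_pair_measure)
  have Am: "(\<lambda>r. indicator {s<..<t} r * A n r) \<in> borel_measurable lborel" for n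
    unfolding AB by (intro sigma_finite_measure.borel_measurable_nn_integral[OF sfM]) measurable
  have lower: "AE r in lborel. P * indicator {s<..<t} r \<le> liminf (\<lambda>n. indicator {s<..<t} r * A n r)"
  proof -
    interpret M: sigma_finite_measure M by (rule sfM)
    interpret pair_sigma_finite lborel M ..
    \<comment> \<open>The ramp estimate does not apply at levels where \<open>{u = r}\<close> has
      positive measure. Exchanging the two a.e. quantifiers shows that such levels are
      negligible.\<close>
    have "AE r in lborel. u x \<noteq> r" for x
      using AE_lborel_singleton[of "u x"] by eventually_elim auto
    then have "AE x in M. AE r in lborel. u x \<noteq> r" by (rule AE_I2)
    then have "AE r in lborel. AE x in M. u x \<noteq> r"
      by (subst AE_commute) measurable
    then show ?thesis
    proof eventually_elim
      case (elim r)
      show ?case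
      proof (cases "r \<in> {s<..<t}")
        case True
        then have r: "s < r" "r < t" by auto
        have "Per m (E r) \<Omega> \<le> liminf (\<lambda>n. \<integral>\<^sup>+x\<in>\<Omega>. ennreal ((1 / h n) * G n x * indicator {r..r + h n} (v n x)) \<partial>m)"
        proof (rule Per_le_liminf_ramps[OF m \<Omega> E(1)[OF r] v h h0 vlim])
          show "AE x in m. x \<in> \<Omega> \<longrightarrow> (x \<in> E r) = (r < u x) \<and> u x \<noteq> r"
            using E(2)[OF r] elim[unfolded AEM] by eventually_elim auto
          show "AE x in m. x \<in> \<Omega> \<longrightarrow> lip (v n) x \<le> G n x \<and> 0 \<le> G n x" for n
            using vH[of n] by eventually_elim (auto simp: G_def H0)
        qed
        with P[OF r] show ?thesis using True by (auto simp: A_def IM)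
      qed simp
    qed
  qed
  define C where "C n x = ennreal (G n x) * indicator {x. s \<le> v n x \<and> v n x \<le> t + h n} x" for n x
  have Cm [measurable]: "C n \<in> borel_measurable M" for n
  proof -
    have "C n = (\<lambda>x. if s \<le> v n x \<and> v n x \<le> t + h n then ennreal (G n x) else 0)"
      by (auto simp: C_def fun_eq_iff)
    moreover have "(\<lambda>x. if s \<le> v n x \<and> v n x \<le> t + h n then ennreal (G n x) else 0) \<in> borel_measurable M"
      by measurable
    ultimately show ?thesis by metis
  qed
  have upper: "(\<integral>\<^sup>+r. indicator {s<..<t} r * A n r \<partial>lborel) \<le> (\<integral>\<^sup>+x. C n x \<partial>M)" for n
  proof -
    have "(\<integral>\<^sup>+r. indicator {s<..<t} r * A n r \<partial>lborel)
       \<le> (\<integral>\<^sup>+x. ennreal (h n) * ennreal ((1 / h n) * G n x) * indicator {x. s \<le> v n x \<and> v n x \<le> t + h n} x \<partial>M)"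
      unfolding AB
    proof (rule nn_integral_sections_le[OF sfM Bm])
      show "(\<lambda>x. ennreal ((1 / h n) * G n x)) \<in> borel_measurable M" by measurable
      show "0 \<le> h n" using h[of n] by simp
      show "r' - r \<le> h n" if "(r, x) \<in> B n" "(r', x) \<in> B n" for r r' x
        using that by (simp add: B_def)
      show "x \<in> {x. s \<le> v n x \<and> v n x \<le> t + h n}" if "(r, x) \<in> B n" for r x
        using that by (simp add: B_def)
    qed
    also have "\<dots> = (\<integral>\<^sup>+x. C n x \<partial>M)"
    proof (rule nn_integral_cong)
      fix x
      have "ennreal (h n) * ennreal ((1 / h n) * G n x) = ennreal (h n * ((1 / h n) * G n x))"
        using h[of n] G0[of n x] by (intro ennreal_mult[symmetric]) auto
      also have "h n * ((1 / h n) * G n x) = G n x" using h[of n] by simp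
      finally show "ennreal (h n) * ennreal ((1 / h n) * G n x) * indicator {x. s \<le> v n x \<and> v n x \<le> t + h n} x = C n x"
        by (simp only: C_def)
    qed
    finally show ?thesis .
  qed
  define J :: "'a \<Rightarrow> ennreal" where "J x = (if s0 < u x then 1 else 0)" for x
  have Jm [measurable]: "J \<in> borel_measurable M" unfolding J_def by measurable
  \<comment> \<open>An integrable bound for all \<open>C n\<close>, from
    \<open>G \<le> 1 + G powr p\<close>. The summand \<open>1\<close> is needed only where
    \<open>s \<le> v n x\<close>: there either \<open>s0 < u x\<close>, a set of finite measure, or
    \<open>H n x \<ge> s - s0\<close>, which \<open>K\<close> pays for. The factors
    \<open>2 powr p\<close> and \<open>6 powr p\<close> come from \<open>\<bar>Du x\<bar> + 3 * H n
    x \<le> 2 * max \<bar>Du x\<bar> (3 * H n x)\<close>.\<close>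
  define w where "w x = J x + ennreal (1 / (s - s0) powr p) * K x
     + (ennreal (2 powr p) * ennreal (\<bar>Du x\<bar> powr p) + ennreal (6 powr p) * K x)" for x
  have wm: "w \<in> borel_measurable M" unfolding w_def by measurable
  have "(\<integral>\<^sup>+x. w x \<partial>M) < \<infinity>"
  proof -
    have "(\<integral>\<^sup>+x. J x \<partial>M) = (\<integral>\<^sup>+x. indicator {x \<in> \<Omega>. s0 < u x} x \<partial>m)"
      unfolding IM by (intro nn_integral_cong) (auto simp: J_def split: split_indicator)
    also have "\<dots> = emeasure m {x \<in> \<Omega>. s0 < u x}"
    proof (rule nn_integral_indicator)
      have "{x \<in> space M. s0 < u x} \<in> sets M" by measurable
      then show "{x \<in> \<Omega>. s0 < u x} \<in> sets m"
        using \<Omega>m unfolding spM by (auto simp: M_def sets_restrict_space_iff[OF spm])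
    qed
    finally have 1: "(\<integral>\<^sup>+x. J x \<partial>M) < \<infinity>" using s0 by simp
    have 2: "(\<integral>\<^sup>+x. K x \<partial>M) < \<infinity>" using KIM by (simp add: le_less_trans)
    have 3: "(\<integral>\<^sup>+x. ennreal (\<bar>Du x\<bar> powr p) \<partial>M) < \<infinity>" using fin by (simp add: IM)
    have "(\<integral>\<^sup>+x. w x \<partial>M) = (\<integral>\<^sup>+x. J x \<partial>M) + ennreal (1 / (s - s0) powr p) * (\<integral>\<^sup>+x. K x \<partial>M)
     + (ennreal (2 powr p) * (\<integral>\<^sup>+x. ennreal (\<bar>Du x\<bar> powr p) \<partial>M) + ennreal (6 powr p) * (\<integral>\<^sup>+x. K x \<partial>M))"
    proof -
      have "(\<integral>\<^sup>+x. ennreal c * K x \<partial>M) = ennreal c * (\<integral>\<^sup>+x. K x \<partial>M)" for c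
        by (rule nn_integral_cmult[OF KM])
      moreover have "(\<integral>\<^sup>+x. ennreal (2 powr p) * ennreal (\<bar>Du x\<bar> powr p) \<partial>M) = ennreal (2 powr p) * (\<integral>\<^sup>+x. ennreal (\<bar>Du x\<bar> powr p) \<partial>M)"
        by (rule nn_integral_cmult) measurable
      moreover have "(\<integral>\<^sup>+x. w x \<partial>M) = ((\<integral>\<^sup>+x. J x \<partial>M) + (\<integral>\<^sup>+x. ennreal (1 / (s - s0) powr p) * K x \<partial>M))
        + ((\<integral>\<^sup>+x. ennreal (2 powr p) * ennreal (\<bar>Du x\<bar> powr p) \<partial>M) + (\<integral>\<^sup>+x. ennreal (6 powr p) * K x \<partial>M))"
      proof -
        have "(\<integral>\<^sup>+x. w x \<partial>M) = (\<integral>\<^sup>+x. J x + ennreal (1 / (s - s0) powr p) * K x \<partial>M)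
           + (\<integral>\<^sup>+x. ennreal (2 powr p) * ennreal (\<bar>Du x\<bar> powr p) + ennreal (6 powr p) * K x \<partial>M)"
          unfolding w_def by (rule nn_integral_add) measurable
        moreover have "(\<integral>\<^sup>+x. J x + ennreal (1 / (s - s0) powr p) * K x \<partial>M)
           = (\<integral>\<^sup>+x. J x \<partial>M) + (\<integral>\<^sup>+x. ennreal (1 / (s - s0) powr p) * K x \<partial>M)"
          by (rule nn_integral_add) measurable
        moreover have "(\<integral>\<^sup>+x. ennreal (2 powr p) * ennreal (\<bar>Du x\<bar> powr p) + ennreal (6 powr p) * K x \<partial>M)
           = (\<integral>\<^sup>+x. ennreal (2 powr p) * ennreal (\<bar>Du x\<bar> powr p) \<partial>M) + (\<integral>\<^sup>+x. ennreal (6 powr p) * K x \<partial>M)"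
          by (rule nn_integral_add) measurable
        ultimately show ?thesis by (simp only:)
      qed
      ultimately show ?thesis by (simp only:)
    qed
    then show ?thesis using 1 2 3 by (simp add: ennreal_mult_less_top)
  qed
  have Cw: "AE x in M. C n x \<le> w x" for n
    using vH[of n] unfolding AEM
  proof eventually_elim
    case (elim x)
    show ?case
    proof
      assume x: "x \<in> \<Omega>"
      have HK: "ennreal (H n x powr p) \<le> K x"
        unfolding K_def by (rule ennreal_le_suminf)
      show "C n x \<le> w x"
      proof (cases "s \<le> v n x \<and> v n x \<le> t + h n")
        case True
        have a: "1 \<le> J x + ennreal (1 / (s - s0) powr p) * K x"
        proof (cases "s0 < u x")
          case False
          then have "s - s0 \<le> H n x" using True elim x by auto
          then have "(s - s0) powr p \<le> H n x powr p" using s p by (intro powr_mono2) auto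
          then have "ennreal 1 \<le> ennreal (1 / (s - s0) powr p * (H n x powr p))"
            using s by (intro ennreal_leI) (simp add: field_simps)
          also have "\<dots> \<le> ennreal (1 / (s - s0) powr p) * K x"
            using HK by (subst ennreal_mult) (auto intro: mult_left_mono)
          finally show ?thesis by (simp add: add_increasing)
        qed (simp add: J_def add_increasing2)
        have "G n x powr p \<le> (2 * max \<bar>Du x\<bar> (3 * H n x)) powr p"
          using p G0[of n x] unfolding G_def by (intro powr_mono2) auto
        also have "\<dots> \<le> 2 powr p * \<bar>Du x\<bar> powr p + 6 powr p * H n x powr p"
          using H0[of n x] p by (cases "\<bar>Du x\<bar> \<le> 3 * H n x") (auto simp: max_def powr_mult[symmetric])
        finally have "ennreal (G n x powr p) \<le> ennreal (2 powr p) * ennreal (\<bar>Du x\<bar> powr p) + ennreal (6 powr p) * ennreal (H n x powr p)"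
          by (simp add: ennreal_leI flip: ennreal_mult ennreal_plus)
        also have "\<dots> \<le> ennreal (2 powr p) * ennreal (\<bar>Du x\<bar> powr p) + ennreal (6 powr p) * K x"
          by (intro add_left_mono mult_left_mono HK) auto
        finally have b: "ennreal (G n x powr p) \<le> ennreal (2 powr p) * ennreal (\<bar>Du x\<bar> powr p) + ennreal (6 powr p) * K x" .
        have "G n x \<le> 1 + G n x powr p"
        proof (cases "G n x \<le> 1")
          case False
          then have "G n x powr 1 \<le> G n x powr p" using p by (intro powr_mono) auto
          with False show ?thesis by simp
        qed (simp add: add_increasing2)
        then have "ennreal (G n x) \<le> ennreal (1 + G n x powr p)" by (rule ennreal_leI)
        also have "\<dots> = 1 + ennreal (G n x powr p)" by (subst ennreal_plus) auto
        finally have "C n x \<le> 1 + ennreal (G n x powr p)" using True by (simp add: C_def)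
        also have "\<dots> \<le> w x" unfolding w_def by (intro add_mono a b)
        finally show ?thesis .
      qed (auto simp: C_def)
    qed
  qed
  have Clim: "AE x in M. limsup (\<lambda>n. C n x) \<le> ennreal \<bar>Du x\<bar> * indicator {x. s \<le> u x \<and> u x \<le> t} x"
    using Hlim vlim unfolding AEM
  proof eventually_elim
    case (elim x)
    show ?case
    proof
      assume "x \<in> \<Omega>"
      then have v: "(\<lambda>n. v n x) \<longlonglongrightarrow> u x" using elim by simp
      show "limsup (\<lambda>n. C n x) \<le> ennreal \<bar>Du x\<bar> * indicator {x. s \<le> u x \<and> u x \<le> t} x"
      proof (cases "s \<le> u x \<and> u x \<le> t")
        case True
        have "(\<lambda>n. ennreal (G n x)) \<longlonglongrightarrow> ennreal (\<bar>Du x\<bar> + 3 * 0)"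
          unfolding G_def by (intro tendsto_intros elim)
        then have "limsup (\<lambda>n. ennreal (G n x)) = ennreal \<bar>Du x\<bar>"
          by (intro lim_imp_Limsup) auto
        moreover have "limsup (\<lambda>n. C n x) \<le> limsup (\<lambda>n. ennreal (G n x))"
          by (intro Limsup_mono always_eventually) (auto simp: C_def split: split_indicator)
        ultimately show ?thesis using True by simp
      next
        case False
        have vh: "(\<lambda>n. v n x - h n) \<longlonglongrightarrow> u x - 0" by (intro tendsto_diff v h0)
        have "\<forall>\<^sub>F n in sequentially. v n x < s \<or> t < v n x - h n"
        proof (cases "u x < s")
          case True
          then have "\<forall>\<^sub>F n in sequentially. v n x < s" by (rule order_tendstoD(2)[OF v])
          then show ?thesis by eventually_elim simp
        next
          case 2: False
          then have "t < u x - 0" using False by auto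
          then have "\<forall>\<^sub>F n in sequentially. t < v n x - h n" by (rule order_tendstoD(1)[OF vh])
          then show ?thesis by eventually_elim simp
        qed
        then have "\<forall>\<^sub>F n in sequentially. C n x = 0"
          by eventually_elim (auto simp: C_def)
        then have "limsup (\<lambda>n. C n x) \<le> 0"
          by (intro Limsup_bounded) (auto elim: eventually_mono)
        then show ?thesis by simp
      qed
    qed
  qed
  have "P * ennreal (t - s) = (\<integral>\<^sup>+r. P * indicator {s<..<t} r \<partial>lborel)"
    using s by (subst nn_integral_cmult_indicator) auto
  also have "\<dots> \<le> (\<integral>\<^sup>+r. liminf (\<lambda>n. indicator {s<..<t} r * A n r) \<partial>lborel)"
    by (rule nn_integral_mono_AE[OF lower])
  also have "\<dots> \<le> liminf (\<lambda>n. \<integral>\<^sup>+r. indicator {s<..<t} r * A n r \<partial>lborel)"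
    by (rule nn_integral_liminf[OF Am])
  also have "\<dots> \<le> liminf (\<lambda>n. \<integral>\<^sup>+x. C n x \<partial>M)"
    by (intro Liminf_mono always_eventually allI upper)
  \<comment> \<open>From the lower to the upper limit, since reverse Fatou bounds the
    latter.\<close>
  also have "\<dots> \<le> limsup (\<lambda>n. \<integral>\<^sup>+x. C n x \<partial>M)"
    by (rule Liminf_le_Limsup) simp
  also have "\<dots> \<le> (\<integral>\<^sup>+x. limsup (\<lambda>n. C n x) \<partial>M)"
    by (rule nn_integral_limsup[OF Cm wm Cw]) fact
  also have "\<dots> \<le> (\<integral>\<^sup>+x. ennreal \<bar>Du x\<bar> * indicator {x. s \<le> u x \<and> u x \<le> t} x \<partial>M)"
    by (rule nn_integral_mono_AE[OF Clim])
  also have "\<dots> = (\<integral>\<^sup>+x\<in>{x \<in> \<Omega>. s \<le> u x \<and> u x \<le> t}. ennreal \<bar>Du x\<bar> \<partial>m)"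
    unfolding IM by (intro nn_integral_cong) (auto split: split_indicator)
  finally show ?thesis .
qed

section \<open>Weighted intervals\<close>

locale weighted_interval =
  fixes I :: "real set" and g :: "real \<Rightarrow> real" and \<omega> :: "real measure"
  assumes I: "open I" "is_interval I"
    and g: "continuous_on I g" "\<And>x. x \<in> I \<Longrightarrow> 0 < g x"
    and \<omega>: "\<omega> = weighted_measure I g"
    and finite_left: "\<And>x. x \<in> I \<Longrightarrow> emeasure \<omega> {..x} < \<infinity>"
begin

lemma density_borel: "(\<lambda>x. ennreal (g x) * indicator I x) \<in> borel_measurable borel"
  using I g(1) borel_measurable_continuous_on_restrict[of I g]
  by (subst borel_measurable_restrict_space_iff_ennreal[symmetric]) auto

lemma sets_\<omega> [simp]: "sets \<omega> = sets borel"
  by (simp add: \<omega> weighted_measure_def)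

lemma space_\<omega> [simp]: "space \<omega> = UNIV"
  by (simp add: \<omega> weighted_measure_def)

lemma emeasure_\<omega>:
  "A \<in> sets borel \<Longrightarrow> emeasure \<omega> A = (\<integral>\<^sup>+x. ennreal (g x) * indicator I x * indicator A x \<partial>lborel)"
  unfolding \<omega> weighted_measure_def using density_borel by (subst emeasure_density) auto

lemma interval_subset: "a \<in> I \<Longrightarrow> b \<in> I \<Longrightarrow> {a..b} \<subseteq> I"
  using I(2) by (metis interval_subset_is_interval box_real(2) ends_in_segment mem_is_interval_1_I subsetI atLeastAtMost_iff)

lemma \<omega>_le:
  assumes "a \<le> b" "\<And>x. x \<in> {a..b} \<Longrightarrow> x \<in> I \<Longrightarrow> g x \<le> \<Gamma>" "0 \<le> \<Gamma>"
  shows "emeasure \<omega> {a..<b} \<le> ennreal (\<Gamma> * (b - a))"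
proof -
  have "emeasure \<omega> {a..<b} \<le> (\<integral>\<^sup>+x. ennreal \<Gamma> * indicator {a..<b} x \<partial>lborel)"
    unfolding emeasure_\<omega>[of "{a..<b}", simplified]
    using assms(2) by (intro nn_integral_mono) (auto split: split_indicator intro!: ennreal_leI)
  also have "\<dots> = ennreal (\<Gamma> * (b - a))"
    using assms(1,3) by (subst nn_integral_cmult_indicator) (auto simp: ennreal_mult)
  finally show ?thesis .
qed

lemma \<omega>_pos:
  assumes "a < b" "a \<in> I" "b \<in> I"
  shows "0 < emeasure \<omega> {a..<b}"
proof -
  have sub: "{a..b} \<subseteq> I" using assms interval_subset by auto
  obtain x where x: "x \<in> {a..b}" "\<And>y. y \<in> {a..b} \<Longrightarrow> g x \<le> g y"
    using continuous_attains_inf[of "{a..b}" g] continuous_on_subset[OF g(1) sub] assms(1) by auto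
  have "0 < ennreal (g x * (b - a))" using g(2) sub x(1) assms(1) by auto
  also have "\<dots> = (\<integral>\<^sup>+y. ennreal (g x) * indicator {a..<b} y \<partial>lborel)"
    using assms(1) g(2) sub x(1) by (subst nn_integral_cmult_indicator) (auto simp: ennreal_mult less_imp_le)
  also have "\<dots> \<le> emeasure \<omega> {a..<b}"
    unfolding emeasure_\<omega>[of "{a..<b}", simplified]
  proof (rule nn_integral_mono)
    fix y
    show "ennreal (g x) * indicator {a..<b} y \<le> ennreal (g y) * indicator I y * indicator {a..<b} y"
    proof (cases "y \<in> {a..<b}")
      case True
      then have "y \<in> {a..b}" "y \<in> I" using sub by auto
      then show ?thesis using True x(2) by (auto intro!: ennreal_leI)
    qed simp
  qed
  finally show ?thesis .
qed

abbreviation "F \<equiv> cdf_left \<omega>"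

lemma F_add: "a \<le> b \<Longrightarrow> F b = F a + emeasure \<omega> {a..<b}"
  unfolding cdf_left_def by (subst plus_emeasure) (auto intro!: arg_cong[where f="emeasure \<omega>"])

lemma F_mono: "a \<le> b \<Longrightarrow> F a \<le> F b"
  unfolding cdf_left_def by (intro emeasure_mono) auto

lemma F_finite: "x \<in> I \<Longrightarrow> F x < \<infinity>"
  unfolding cdf_left_def using finite_left[of x] by (rule le_less_trans[rotated]) (auto intro!: emeasure_mono)

lemma F_strict_mono: "a \<in> I \<Longrightarrow> b \<in> I \<Longrightarrow> a < b \<Longrightarrow> F a < F b"
  using F_add[of a b] \<omega>_pos[of a b] F_finite[of a] ennreal_add_left_cancel_less[of "F a" 0 "emeasure \<omega> {a..<b}"]
  by simp

lemma inj_on_F: "inj_on F I"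
  by (rule linorder_inj_onI') (use F_strict_mono in force)

text \<open>Left of \<open>I\<close> no mass has been collected yet and right of it all of it has,
  so a value strictly between the extremes places \<open>x\<close> in \<open>I\<close>.\<close>

lemma mem_I:
  assumes "0 < F x" "F x < emeasure \<omega> UNIV"
  shows "x \<in> I"
proof -
  have "\<exists>a\<in>I. a < x"
  proof (rule ccontr)
    assume *: "\<not> ?thesis"
    have "F x = (\<integral>\<^sup>+y. 0 \<partial>(lborel :: real measure))"
      unfolding cdf_left_def emeasure_\<omega>[of "{..<x}", simplified]
      using * by (intro nn_integral_cong) (auto split: split_indicator)
    with assms show False by simp
  qed
  moreover have "\<exists>b\<in>I. x \<le> b"
  proof (rule ccontr)
    assume *: "\<not> ?thesis"
    have "emeasure \<omega> UNIV = F x"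
      unfolding cdf_left_def emeasure_\<omega>[of "{..<x}", simplified] emeasure_\<omega>[of UNIV, simplified]
      using * by (intro nn_integral_cong) (auto split: split_indicator)
    with assms show False by simp
  qed
  ultimately show ?thesis using I(2) by (meson less_imp_le mem_is_interval_1_I)
qed

text \<open>\<open>F\<close> takes values in \<open>ennreal\<close>; its real version is Lipschitz
  on \<open>{a..b}\<close> with the maximum of \<open>g\<close> as constant, and the intermediate
  value theorem is applied to that.\<close>

lemma F_IVT:
  assumes "a \<in> I" "b \<in> I" "a \<le> b" "F a \<le> v" "v \<le> F b"
  shows "\<exists>y\<in>{a..b}. F y = v"
proof -
  have sub: "{a..b} \<subseteq> I" using assms interval_subset by auto
  obtain x where x: "x \<in> {a..b}" "\<And>y. y \<in> {a..b} \<Longrightarrow> g y \<le> g x"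
    using continuous_attains_sup[of "{a..b}" g] continuous_on_subset[OF g(1) sub] assms(3) by auto
  have gx: "0 \<le> g x" using x(1) sub g(2) by (auto simp: less_imp_le)
  define f where "f y = enn2real (F y)" for y
  have Ff: "F y = ennreal (f y)" if "y \<in> {a..b}" for y
    using F_finite[of y] sub that by (auto simp: f_def ennreal_enn2real_if)
  have *: "0 \<le> f z - f y \<and> f z - f y \<le> g x * (z - y)" if "y \<in> {a..b}" "z \<in> {a..b}" "y \<le> z" for y z
  proof -
    have "emeasure \<omega> {y..<z} \<le> ennreal (g x * (z - y))"
      using that x(2) gx by (intro \<omega>_le) auto
    then have "ennreal (f z) \<le> ennreal (f y) + ennreal (g x * (z - y))"
      using F_add[OF that(3)] Ff[OF that(1)] Ff[OF that(2)] by (metis add_left_mono)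
    also have "\<dots> = ennreal (f y + g x * (z - y))"
      using gx that by (intro ennreal_plus[symmetric]) (auto simp: f_def)
    finally have "f z \<le> f y + g x * (z - y)"
      using gx that by (subst (asm) ennreal_le_iff) (auto simp: f_def)
    moreover have "f y \<le> f z"
      using F_mono[OF that(3)] F_finite[OF subsetD[OF sub that(2)]] unfolding f_def by (intro enn2real_mono) auto
    ultimately show ?thesis by simp
  qed
  have "(g x)-lipschitz_on {a..b} f"
  proof (rule lipschitz_onI)
    fix y z assume "y \<in> {a..b}" "z \<in> {a..b}"
    then show "dist (f y) (f z) \<le> g x * dist y z"
      using *[of y z] *[of z y] by (cases "y \<le> z") (auto simp: dist_real_def)
  qed (rule gx)
  then have "continuous_on {a..b} f" by (rule lipschitz_on_continuous_on)
  moreover have v: "v = ennreal (enn2real v)"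
    using assms(5) F_finite[of b] assms(2) by (auto simp: ennreal_enn2real_if top_unique)
  moreover have "f a \<le> enn2real v" "enn2real v \<le> f b"
    using assms F_finite[of b] unfolding f_def by (auto intro!: enn2real_mono dest: le_less_trans)
  ultimately obtain y where "y \<in> {a..b}" "f y = enn2real v"
    using IVT'[of f a "enn2real v" b] assms(3) by auto
  then show ?thesis using Ff v by metis
qed

text \<open>The inverse of \<open>F\<close> sends \<open>v\<close> into \<open>{a..b}\<close>, so
  the profile at \<open>v\<close> is a value of \<open>g\<close> on this interval.\<close>

lemma profile_ge:
  assumes "a \<in> I" "b \<in> I" "a \<le> b" "F a \<le> v" "v \<le> F b" "0 < v" "v < emeasure \<omega> UNIV"
    and "\<And>y. y \<in> {a..b} \<Longrightarrow> \<gamma> \<le> g y"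
  shows "\<gamma> \<le> profile I g v"
proof -
  obtain y where y: "y \<in> {a..b}" "F y = v" using F_IVT[OF assms(1-5)] by blast
  then have "y \<in> I" using assms interval_subset by blast
  then have "the_inv_into I F v = y" using y the_inv_into_f_f[OF inj_on_F] by metis
  then show ?thesis using assms(6-8) y by (simp add: profile_def Let_def flip: \<omega>)
qed

end

section \<open>Rearrangement\<close>

locale rearrangement = weighted_interval +
  fixes m :: "'a::polish_space measure" and \<Omega> :: "'a set" and u :: "'a \<Rightarrow> real"
  assumes m: "metric_measure_space m" and \<Omega>: "open \<Omega>" "\<Omega> \<noteq> {}"
    and u: "u \<in> borel_measurable (restrict_space m \<Omega>)"
    and distr_finite: "\<And>t. ess_inf m \<Omega> u < ereal t \<Longrightarrow> distr_fun m \<Omega> u t < \<infinity>"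
    and mass: "emeasure m \<Omega> \<le> emeasure \<omega> UNIV"
begin

abbreviation "\<mu> \<equiv> distr_fun m \<Omega> u"
abbreviation "\<Omega>s \<equiv> Omega_star m \<Omega> \<omega>"
abbreviation "us \<equiv> ustar m \<Omega> u \<omega>"
abbreviation "l0 \<equiv> ess_inf m \<Omega> u"

lemma \<Omega>_sets: "\<Omega> \<in> sets m" "\<Omega> \<inter> space m \<in> sets m"
  using \<Omega> m by (auto simp: metric_measure_space_sets metric_measure_space_space)

lemma pred_sets:
  assumes "{x \<in> space (restrict_space m \<Omega>). P x} \<in> sets (restrict_space m \<Omega>)"
  shows "{x \<in> \<Omega>. P x} \<in> sets m"
  using assms \<Omega>_sets by (auto simp: sets_restrict_space_iff space_restrict_space metric_measure_space_space[OF m])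

lemma superlevel_sets: "{x \<in> \<Omega>. t < u x} \<in> sets m"
  using u by (intro pred_sets) measurable

lemma ereal_superlevel_sets: "{x \<in> \<Omega>. l < ereal (u x)} \<in> sets m"
  using u by (intro pred_sets) measurable

lemma emeasure_\<Omega>_pos: "0 < emeasure m \<Omega>"
proof -
  obtain x r where "0 < r" "ball x r \<subseteq> \<Omega>" using \<Omega> openE by (metis ex_in_conv)
  moreover have "0 < emeasure m (ball x r)"
    using m \<open>0 < r\<close> by (auto simp: metric_measure_space_def measure_support_def)
  ultimately show ?thesis using emeasure_mono[OF _ \<Omega>_sets(1)] less_le_trans by blast
qed

lemma AE_gt_ess_inf: "ereal t < l0 \<Longrightarrow> AE x in m. x \<in> \<Omega> \<longrightarrow> t < u x"
proof -
  assume "ereal t < l0"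
  then have "AE x in restrict_space m \<Omega>. ereal t < ereal (u x)"
    unfolding ess_inf_def by (rule less_LiminfD)
  then show ?thesis by (simp add: AE_restrict_space_iff[OF \<Omega>_sets(2)])
qed

text \<open>Otherwise \<open>u\<close> would exceed every natural number a.e. on a set of positive
  measure. This keeps the set of levels in \<open>usharp\<close> from being empty.\<close>

lemma ess_inf_less: "\<exists>t. l0 < ereal t"
proof (rule ccontr)
  assume *: "\<not> ?thesis"
  have "ereal (real n) < l0" for n :: nat
    using * by (metis ereal_less(2) ereal_less_eq(3) less_le_trans less_ereal.simps(1) not_le lessI of_nat_less_iff)
  then have "AE x in m. \<forall>n::nat. x \<in> \<Omega> \<longrightarrow> real n < u x"
    by (subst AE_all_countable) (blast intro: AE_gt_ess_inf)
  then have "AE x in m. x \<notin> \<Omega>"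
  proof eventually_elim
    case (elim x)
    obtain n :: nat where "u x < real n" using reals_Archimedean2 by blast
    with elim show ?case by (auto dest: less_asym)
  qed
  then have "emeasure m \<Omega> = 0"
    using \<Omega>_sets by (subst (asm) AE_iff_measurable[of \<Omega>]) (auto simp: metric_measure_space_space[OF m])
  with emeasure_\<Omega>_pos show False by simp
qed

lemma \<mu>_antimono: "s \<le> t \<Longrightarrow> \<mu> t \<le> \<mu> s"
  unfolding distr_fun_def by (intro emeasure_mono superlevel_sets) auto

text \<open>Continuity from above along the levels \<open>t0 + n\<close>, which the finiteness of
  the superlevel sets above the essential infimum permits.\<close>

lemma \<mu>_small:
  assumes "0 < a"
  shows "\<exists>t. l0 < ereal t \<and> \<mu> t < a"
proof -
  obtain t0 where t0: "l0 < ereal t0" using ess_inf_less by blast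
  let ?A = "\<lambda>n::nat. {x \<in> \<Omega>. t0 + real n < u x}"
  have "(\<lambda>n. emeasure m (?A n)) \<longlonglongrightarrow> emeasure m (\<Inter>n. ?A n)"
  proof (rule Lim_emeasure_decseq)
    show "range ?A \<subseteq> sets m" using superlevel_sets by auto
    show "decseq ?A" by (auto simp: decseq_def)
    show "emeasure m (?A n) \<noteq> \<infinity>" for n
      using distr_finite[OF t0] \<mu>_antimono[of t0 "t0 + real n"] by (auto simp: distr_fun_def top_unique)
  qed
  moreover have "(\<Inter>n. ?A n) = {}"
  proof -
    have "\<exists>n::nat. \<not> t0 + real n < u x" for x
      using reals_Archimedean2[of "u x - t0"] by (metis add.commute less_diff_eq less_asym)
    then show ?thesis by blast
  qed
  ultimately have "(\<lambda>n. emeasure m (?A n)) \<longlonglongrightarrow> 0" by simp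
  then have "\<forall>\<^sub>F n in sequentially. emeasure m (?A n) < a" using assms by (rule order_tendstoD)
  then obtain n where "emeasure m (?A n) < a" by (auto simp: eventually_sequentially)
  moreover have "l0 < ereal (t0 + real n)" using t0 by (rule less_le_trans) simp
  ultimately show ?thesis by (auto simp: distr_fun_def)
qed

lemma \<mu>_large:
  assumes "a < emeasure m \<Omega>"
  shows "\<exists>t. a < \<mu> t"
proof -
  let ?A = "\<lambda>n::nat. {x \<in> \<Omega>. - real n < u x}"
  have "(\<lambda>n. emeasure m (?A n)) \<longlonglongrightarrow> emeasure m (\<Union>n. ?A n)"
    using superlevel_sets by (intro Lim_emeasure_incseq) (auto simp: incseq_def)
  moreover have "(\<Union>n. ?A n) = \<Omega>"
  proof -
    have "\<exists>n::nat. - real n < u x" for x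
      using reals_Archimedean2[of "- u x"] by (metis minus_less_iff)
    then show ?thesis by blast
  qed
  ultimately have "(\<lambda>n. emeasure m (?A n)) \<longlonglongrightarrow> emeasure m \<Omega>" by simp
  then have "\<forall>\<^sub>F n in sequentially. a < emeasure m (?A n)" using assms by (rule order_tendstoD)
  then show ?thesis unfolding distr_fun_def by (auto simp: eventually_sequentially)
qed

section \<open>The decreasing rearrangement on \<open>Omega_star\<close>\<close>

lemma mem_\<Omega>s: 
  assumes "x \<in> \<Omega>s"
  shows "0 < F x" "F x < emeasure m \<Omega>" "x \<in> I"
proof -
  obtain l where l: "0 < F l" "l < x"
    using assms unfolding Omega_star_def by (auto simp: Inf_less_iff)
  then show 1: "0 < F x" using F_mono[of l x] by auto
  obtain r where r: "F r < emeasure m \<Omega>" "x < r"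
    using assms unfolding Omega_star_def by (auto simp: less_Sup_iff)
  then show 2: "F x < emeasure m \<Omega>" using F_mono[of x r] by auto
  show "x \<in> I" using mem_I[OF 1] 2 mass by auto
qed

lemma open_\<Omega>s: "open \<Omega>s"
proof -
  have "\<Omega>s = ereal -` {Inf {ereal l |l. 0 < F l}<..<Sup {ereal r |r. F r < emeasure m \<Omega>}}"
    by (auto simp: Omega_star_def)
  then show ?thesis by (simp add: open_ereal_vimage)
qed

lemma \<Omega>s_interval: "a \<in> \<Omega>s \<Longrightarrow> b \<in> \<Omega>s \<Longrightarrow> {a..b} \<subseteq> \<Omega>s"
  unfolding Omega_star_def by (auto intro: less_le_trans le_less_trans simp: ereal_less_eq(3)[symmetric] simp del: ereal_less_eq(3))

text \<open>\<open>0 < F x < emeasure m \<Omega>\<close> provides levels with \<open>\<mu>\<close>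
  below and above \<open>F x\<close>. So the infimum is finite and \<open>real_of_ereal\<close>
  loses nothing.\<close>

lemma ustar_eq:
  assumes x: "x \<in> \<Omega>s"
  shows "ereal (us x) = Inf {ereal t |t. l0 < ereal t \<and> \<mu> t < F x}"
proof -
  let ?A = "{ereal t |t. l0 < ereal t \<and> \<mu> t < F x}"
  obtain t1 where t1: "l0 < ereal t1" "\<mu> t1 < F x" using \<mu>_small[OF mem_\<Omega>s(1)[OF x]] by blast
  obtain t2 where t2: "F x < \<mu> t2" using \<mu>_large[OF mem_\<Omega>s(2)[OF x]] by blast
  have "Inf ?A \<le> ereal t1" using t1 by (intro Inf_lower) auto
  moreover have "ereal t2 \<le> Inf ?A"
  proof (rule Inf_greatest)
    fix z assume "z \<in> ?A"
    then obtain t where t: "z = ereal t" "\<mu> t < F x" by auto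
    have "t2 \<le> t"
    proof (rule ccontr)
      assume "\<not> t2 \<le> t"
      then have "\<mu> t2 \<le> \<mu> t" by (intro \<mu>_antimono) auto
      with t t2 show False by auto
    qed
    then show "ereal t2 \<le> z" using t by simp
  qed
  ultimately have "\<bar>Inf ?A\<bar> \<noteq> \<infinity>" by auto
  then show ?thesis
    using mem_\<Omega>s(1)[OF x, THEN less_imp_neq] unfolding ustar_def usharp_def by (auto simp: ereal_real)
qed

text \<open>Together with \<open>less_ustar\<close> this is the duality between \<open>us\<close>
  and \<open>\<mu>\<close> through which the order of levels is compared with that of masses. The
  converse direction needs \<open>l0 < ereal t\<close>, because the infimum ranges over such levels
  only.\<close>

lemma ustar_less:
  assumes "x \<in> \<Omega>s" "us x < t"
  shows "l0 < ereal t" "\<mu> t < F x"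
proof -
  have "Inf {ereal t |t. l0 < ereal t \<and> \<mu> t < F x} < ereal t"
    using assms by (simp flip: ustar_eq)
  then obtain s where s: "l0 < ereal s" "\<mu> s < F x" "s < t" by (auto simp: Inf_less_iff)
  then show "l0 < ereal t" by (meson less_trans less_ereal.simps(1))
  show "\<mu> t < F x" using \<mu>_antimono[of s t] s by auto
qed

lemma less_ustar:
  assumes "x \<in> \<Omega>s" "t < us x" "l0 < ereal t"
  shows "F x \<le> \<mu> t"
proof (rule ccontr)
  assume "\<not> F x \<le> \<mu> t"
  then have "Inf {ereal t |t. l0 < ereal t \<and> \<mu> t < F x} \<le> ereal t"
    using assms by (intro Inf_lower) auto
  then show False using assms by (simp flip: ustar_eq)
qed

lemma ustar_antimono:
  assumes "x \<in> \<Omega>s" "y \<in> \<Omega>s" "x \<le> y"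
  shows "us y \<le> us x"
proof -
  have "ereal (us y) \<le> ereal (us x)"
    unfolding ustar_eq[OF assms(1)] ustar_eq[OF assms(2)]
    using F_mono[OF assms(3)] by (intro Inf_superset_mono) (auto intro: less_le_trans)
  then show ?thesis by simp
qed

text \<open>The complement of the support is a union of balls that meet
  \<open>{u > ess inf u}\<close> in null sets; by Lindelof, countably many of them suffice.\<close>

lemma AE_ess_supp: "AE x in m. x \<in> \<Omega> \<longrightarrow> l0 < ereal (u x) \<longrightarrow> x \<in> ess_supp m \<Omega> u"
proof -
  let ?N = "\<lambda>U. {y \<in> U \<inter> \<Omega>. l0 < ereal (u y)}"
  define \<F> where "\<F> = {ball x r |x r. 0 < r \<and> emeasure m (?N (ball x r)) = 0}"
  have cover: "x \<in> \<Union>\<F>" if x: "x \<notin> ess_supp m \<Omega> u" for x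
  proof -
    obtain r where "0 < r" "emeasure m (?N (ball x r)) = 0"
      using x unfolding ess_supp_def by (auto simp: not_less)
    then show ?thesis unfolding \<F>_def by (intro UnionI[of "ball x r"]) auto
  qed
  have op: "open U" if "U \<in> \<F>" for U using that unfolding \<F>_def by auto
  obtain \<F>' where \<F>': "\<F>' \<subseteq> \<F>" "countable \<F>'" "\<Union>\<F>' = \<Union>\<F>"
    using Lindelof[of \<F>] op by metis
  have "?N U \<in> null_sets m" if "U \<in> \<F>'" for U
  proof -
    have "U \<in> sets m" using that \<F>'(1) op by (auto simp: metric_measure_space_sets[OF m])
    then have "U \<inter> {x \<in> \<Omega>. l0 < ereal (u x)} \<in> sets m" using ereal_superlevel_sets by (rule sets.Int)
    moreover have "U \<inter> {x \<in> \<Omega>. l0 < ereal (u x)} = ?N U" by auto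
    ultimately show ?thesis using that \<F>'(1) by (auto simp: null_sets_def \<F>_def)
  qed
  then have "(\<Union>U\<in>\<F>'. ?N U) \<in> null_sets m" using \<F>'(2) by (intro null_sets_UN') auto
  moreover have "{x \<in> space m. \<not> (x \<in> \<Omega> \<longrightarrow> l0 < ereal (u x) \<longrightarrow> x \<in> ess_supp m \<Omega> u)} \<subseteq> (\<Union>U\<in>\<F>'. ?N U)"
  proof
    fix x assume "x \<in> {x \<in> space m. \<not> (x \<in> \<Omega> \<longrightarrow> l0 < ereal (u x) \<longrightarrow> x \<in> ess_supp m \<Omega> u)}"
    then have x: "x \<in> \<Omega>" "l0 < ereal (u x)" "x \<notin> ess_supp m \<Omega> u" by auto
    then obtain U where "U \<in> \<F>'" "x \<in> U" using cover[of x] \<F>'(3) by auto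
    then show "x \<in> (\<Union>U\<in>\<F>'. ?N U)" using x by auto
  qed
  ultimately show ?thesis by (rule AE_I')
qed

text \<open>By duality \<open>\<mu> s' < F b\<close> and \<open>F a \<le> \<mu> t'\<close>, so the
  mass between these levels is at most \<open>F b - F a\<close>. The levels \<open>s'\<close> and
  \<open>t'\<close> lie slightly outside, so that the closed slab is contained in
  \<open>{s' < u}\<close> and disjoint from \<open>{t' < u}\<close>. Plateaus of \<open>u\<close> at
  the levels \<open>us a\<close> and \<open>us b\<close>, whose mass can be larger, stay
  excluded.\<close>

lemma slab_le:
  assumes ab: "a \<in> \<Omega>s" "b \<in> \<Omega>s" "a \<le> b" and st: "us b < s" "t < us a" "s \<le> t"
  shows "emeasure m {x \<in> \<Omega>. s \<le> u x \<and> u x \<le> t} \<le> emeasure \<omega> {a..<b}"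
proof -
  obtain s' where s': "us b < s'" "s' < s" using dense[OF st(1)] by blast
  obtain t' where t': "t < t'" "t' < us a" using dense[OF st(2)] by blast
  let ?S = "{x \<in> \<Omega>. s \<le> u x \<and> u x \<le> t}"
  note u [measurable]
  have S: "?S \<in> sets m" by (intro pred_sets) measurable
  have l0: "l0 < ereal t'" using ustar_less(1)[OF ab(2), of t'] s' t' st by auto
  have "emeasure m ?S + \<mu> t' = emeasure m (?S \<union> {x \<in> \<Omega>. t' < u x})"
    unfolding distr_fun_def using S t' by (intro plus_emeasure superlevel_sets) auto
  also have "\<dots> \<le> \<mu> s'"
    unfolding distr_fun_def using s' t' st by (intro emeasure_mono superlevel_sets) auto
  also have "\<dots> \<le> F b" using ustar_less(2)[OF ab(2) s'(1)] by simp
  also have "\<dots> = F a + emeasure \<omega> {a..<b}" by (rule F_add[OF ab(3)])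
  also have "\<dots> \<le> \<mu> t' + emeasure \<omega> {a..<b}"
    by (intro add_right_mono less_ustar ab t' l0)
  finally have "\<mu> t' + emeasure m ?S \<le> \<mu> t' + emeasure \<omega> {a..<b}" by (simp add: add.commute)
  then show ?thesis using distr_finite[OF l0] by (auto simp: ennreal_add_left_cancel_le)
qed

end

section \<open>Increments and energy of the rearrangement\<close>

text \<open>A rearrangement of the fact that \<open>z powr p\<close> lies above its tangent at
  \<open>z = k\<close>, where equality holds. Optimizing over \<open>k\<close> afterwards replaces
  Holder's inequality.\<close>

lemma young_tangent:
  fixes z k p :: real
  assumes "1 < p" "0 < k" "0 \<le> z"
  shows "z \<le> z powr p / (p * k powr (p - 1)) + k * (1 - 1 / p)"
proof -
  have "(z / k) * 1 \<le> (z / k) powr p / p + 1 powr (p / (p - 1)) / (p / (p - 1))"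
    using assms by (intro Youngs_inequality) (auto simp: field_simps)
  also have "\<dots> = (z / k) powr p / p + (1 - 1 / p)" using assms by (simp add: field_simps)
  finally have "z / k \<le> (z / k) powr p / p + (1 - 1 / p)" by simp
  then have "k * (z / k) \<le> k * ((z / k) powr p / p + (1 - 1 / p))" using assms by (intro mult_left_mono) auto
  also have "\<dots> = k * ((z / k) powr p / p) + k * (1 - 1 / p)" by (simp add: distrib_left)
  also have "k * ((z / k) powr p / p) = z powr p / (p * k powr (p - 1))"
    using assms by (simp add: powr_divide powr_diff field_simps)
  finally show ?thesis using assms by simp
qed

lemma ex_large_powr:
  fixes c q :: real
  assumes "0 < q"
  shows "\<exists>k>0. c \<le> k powr q"
proof (intro exI[of _ "max 1 c powr (1 / q)"] conjI)
  show "0 < max 1 c powr (1 / q)" by simp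
  show "c \<le> (max 1 c powr (1 / q)) powr q" using assms by (simp add: powr_powr)
qed

locale isoperimetric_rearrangement = rearrangement +
  fixes Du :: "'a \<Rightarrow> real" and p C \<epsilon> :: real
  assumes p: "1 < p"
    and W: "W1p_loc p m \<Omega> u" and Du: "local_minimal_weak_upper_gradient p m \<Omega> u Du"
    and C: "0 < C" and \<epsilon>: "0 < \<epsilon>"
    and isoperimetric: "\<And>E. E \<in> sets borel \<Longrightarrow> E \<subseteq> open_nbhd \<epsilon> (ess_supp m \<Omega> u) \<inter> \<Omega> \<Longrightarrow> emeasure m E < \<infinity>
           \<Longrightarrow> Per m E \<Omega> \<ge> ennreal (C * profile I g (emeasure m E))"
    and energy_finite: "(\<integral>\<^sup>+x\<in>\<Omega>. ennreal (\<bar>Du x\<bar> powr p) \<partial>m) < \<infinity>"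
begin

text \<open>The neighbourhood makes the superlevel set admissible in the isoperimetric hypothesis.
  For levels above the essential infimum it removes only a null set.\<close>

abbreviation "E r \<equiv> {x \<in> \<Omega>. r < u x} \<inter> open_nbhd \<epsilon> (ess_supp m \<Omega> u)"

lemma E_sets: "E r \<in> sets borel"
proof -
  have "open (open_nbhd \<epsilon> (ess_supp m \<Omega> u))" unfolding open_nbhd_def by auto
  then show ?thesis using superlevel_sets[of r] by (auto simp: metric_measure_space_sets[OF m])
qed

lemma AE_E:
  assumes "l0 < ereal r"
  shows "AE x in m. x \<in> \<Omega> \<longrightarrow> (x \<in> E r \<longleftrightarrow> r < u x)"
  using AE_ess_supp
proof eventually_elim
  case (elim x)
  have "x \<in> open_nbhd \<epsilon> (ess_supp m \<Omega> u)" if "x \<in> ess_supp m \<Omega> u"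
    using that \<epsilon> unfolding open_nbhd_def by (intro UN_I[of x]) auto
  moreover have "l0 < ereal (u x)" if "r < u x" using assms that by (meson less_trans less_ereal.simps(1))
  ultimately show ?case using elim by auto
qed

lemma emeasure_E:
  assumes "l0 < ereal r"
  shows "emeasure m (E r) = \<mu> r"
  unfolding distr_fun_def using AE_E[OF assms] E_sets[of r] superlevel_sets[of r]
  by (intro emeasure_eq_AE) (auto simp: metric_measure_space_sets[OF m] elim: eventually_mono)

lemma Per_E_ge:
  assumes ab: "a \<in> \<Omega>s" "b \<in> \<Omega>s" "a \<le> b" and r: "us b < r" "r < us a"
    and \<gamma>: "\<And>x. x \<in> {a..b} \<Longrightarrow> \<gamma> \<le> g x"
  shows "ennreal (C * \<gamma>) \<le> Per m (E r) \<Omega>"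
proof -
  note l0 = ustar_less(1)[OF ab(2) r(1)]
  have 1: "F a \<le> \<mu> r" by (rule less_ustar[OF ab(1) r(2) l0])
  have 2: "\<mu> r < F b" by (rule ustar_less(2)[OF ab(2) r(1)])
  have "\<gamma> \<le> profile I g (\<mu> r)"
    using 1 2 mem_\<Omega>s[OF ab(1)] mem_\<Omega>s[OF ab(2)] mass ab(3)
    by (intro profile_ge[of a b] \<gamma>) (auto intro: less_le_trans less_trans order_less_imp_le)
  then have "ennreal (C * \<gamma>) \<le> ennreal (C * profile I g (emeasure m (E r)))"
    using C by (intro ennreal_leI mult_left_mono) (auto simp: emeasure_E[OF l0])
  also have "\<dots> \<le> Per m (E r) \<Omega>"
    using distr_finite[OF l0] by (intro isoperimetric E_sets) (auto simp: emeasure_E[OF l0])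
  finally show ?thesis .
qed

text \<open>\<open>Du\<close> is known to be measurable only on \<open>\<Omega>\<close> and is
  arbitrary outside; the indicator repairs this.\<close>

lemma Du_powr_borel: "S \<in> sets m \<Longrightarrow> S \<subseteq> \<Omega> \<Longrightarrow> (\<lambda>x. ennreal (\<bar>Du x\<bar> powr p) * indicator S x) \<in> borel_measurable m"
proof -
  assume S: "S \<in> sets m" "S \<subseteq> \<Omega>"
  have [measurable]: "Du \<in> borel_measurable (restrict_space m \<Omega>)"
    using Du by (simp add: local_minimal_weak_upper_gradient_def)
  have "(\<lambda>x. ennreal (\<bar>Du x\<bar> powr p) * indicator \<Omega> x) \<in> borel_measurable m"
    by (rule iffD1[OF borel_measurable_restrict_space_iff_ennreal[OF \<Omega>_sets(2)]]) measurable
  then have "(\<lambda>x. ennreal (\<bar>Du x\<bar> powr p) * indicator \<Omega> x * indicator S x) \<in> borel_measurable m"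
    by (rule borel_measurable_times_ennreal[OF _ borel_measurable_indicator[OF S(1)]])
  also have "(\<lambda>x. ennreal (\<bar>Du x\<bar> powr p) * indicator \<Omega> x * indicator S x)
      = (\<lambda>x. ennreal (\<bar>Du x\<bar> powr p) * indicator S x)"
    using S by (intro ext) (auto split: split_indicator)
  finally show ?thesis .
qed

text \<open>The energy between the two end levels of an interval. The inequalities are strict so
  that adjacent intervals, which share a level, have disjoint slabs.\<close>

definition \<nu> :: "real \<Rightarrow> real \<Rightarrow> ennreal" where
  "\<nu> a b = (\<integral>\<^sup>+x\<in>{x \<in> \<Omega>. us b < u x \<and> u x < us a}. ennreal (\<bar>Du x\<bar> powr p) \<partial>m)"

lemma \<nu>_finite: "\<nu> a b < \<infinity>"
  unfolding \<nu>_def by (rule le_less_trans[OF nn_integral_mono energy_finite]) (auto split: split_indicator)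

text \<open>The coarea inequality with \<open>P = C * \<gamma>\<close> on a closed slab strictly
  inside the range; Young's inequality then splits the integral into the energy of the slab and its
  mass, which \<open>slab_le\<close> bounds by \<open>\<Gamma> * (b - a)\<close>.\<close>

lemma increment_le:
  assumes ab: "a \<in> \<Omega>s" "b \<in> \<Omega>s" "a \<le> b"
    and \<gamma>: "\<And>x. x \<in> {a..b} \<Longrightarrow> \<gamma> \<le> g x" "0 \<le> \<gamma>" and \<Gamma>: "\<And>x. x \<in> {a..b} \<Longrightarrow> g x \<le> \<Gamma>" "0 \<le> \<Gamma>"
    and k: "0 < k"
  shows "C * \<gamma> * (us a - us b) \<le> enn2real (\<nu> a b) / (p * k powr (p - 1)) + k * (1 - 1 / p) * \<Gamma> * (b - a)"
    (is "_ \<le> ?R")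
proof -
  define \<alpha> where "\<alpha> = 1 / (p * k powr (p - 1))"
  define \<beta> where "\<beta> = k * (1 - 1 / p)"
  have \<alpha>: "0 \<le> \<alpha>" and \<beta>: "0 \<le> \<beta>" using p k unfolding \<alpha>_def \<beta>_def by auto
  have R: "?R = \<alpha> * enn2real (\<nu> a b) + \<beta> * (\<Gamma> * (b - a))" unfolding \<alpha>_def \<beta>_def by simp
  have R0: "0 \<le> ?R" unfolding R using \<alpha> \<beta> \<Gamma> ab by (intro add_nonneg_nonneg mult_nonneg_nonneg) auto
  have *: "C * \<gamma> * (t - s) \<le> ?R" if st: "us b < s" "s < t" "t < us a" for s t
  proof -
    \<comment> \<open>\<open>coarea_bound\<close> wants a level below \<open>s\<close> with a
      superlevel set of finite measure; the gap above \<open>us b\<close> has room for one.\<close>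
    obtain s0 where s0: "us b < s0" "s0 < s" using dense[OF st(1)] by blast
    note l0 = ustar_less(1)[OF ab(2) s0(1)]
    let ?S = "{x \<in> \<Omega>. s \<le> u x \<and> u x \<le> t}"
    note u [measurable]
    have S: "?S \<in> sets m" by (intro pred_sets) measurable
    have Dm: "(\<lambda>x. ennreal (\<bar>Du x\<bar> powr p) * indicator ?S x) \<in> borel_measurable m"
      by (intro Du_powr_borel S) auto
    have "ennreal (C * \<gamma>) * ennreal (t - s) \<le> (\<integral>\<^sup>+x\<in>?S. ennreal \<bar>Du x\<bar> \<partial>m)"
    proof (rule coarea_bound[OF m p \<Omega>(1) W Du energy_finite s0(2) st(2)])
      show "emeasure m {x \<in> \<Omega>. s0 < u x} < \<infinity>" using distr_finite[OF l0] by (simp add: distr_fun_def)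
      fix r assume r: "s < r" "r < t"
      show "E r \<in> sets borel" by (rule E_sets)
      have "l0 < ereal r" using st r by (intro ustar_less(1)[OF ab(2)]) auto
      then show "AE x in m. x \<in> \<Omega> \<longrightarrow> (x \<in> E r) = (r < u x)" by (rule AE_E)
      show "ennreal (C * \<gamma>) \<le> Per m (E r) \<Omega>"
        using r st \<gamma>(1) by (intro Per_E_ge[OF ab]) auto
    qed
    also have "\<dots> \<le> (\<integral>\<^sup>+x. ennreal \<alpha> * (ennreal (\<bar>Du x\<bar> powr p) * indicator ?S x) + ennreal \<beta> * indicator ?S x \<partial>m)"
    proof (rule nn_integral_mono)
      fix x
      have "\<bar>Du x\<bar> \<le> \<alpha> * \<bar>Du x\<bar> powr p + \<beta>"
        using young_tangent[OF p k, of "\<bar>Du x\<bar>"] by (simp add: \<alpha>_def \<beta>_def)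
      then have "ennreal \<bar>Du x\<bar> \<le> ennreal (\<alpha> * \<bar>Du x\<bar> powr p + \<beta>)" by (rule ennreal_leI)
      also have "\<dots> = ennreal \<alpha> * ennreal (\<bar>Du x\<bar> powr p) + ennreal \<beta>"
        using \<alpha> \<beta> by (simp add: ennreal_mult ennreal_plus)
      finally show "ennreal \<bar>Du x\<bar> * indicator ?S x
        \<le> ennreal \<alpha> * (ennreal (\<bar>Du x\<bar> powr p) * indicator ?S x) + ennreal \<beta> * indicator ?S x"
        by (auto split: split_indicator)
    qed
    also have "\<dots> = ennreal \<alpha> * (\<integral>\<^sup>+x\<in>?S. ennreal (\<bar>Du x\<bar> powr p) \<partial>m) + ennreal \<beta> * emeasure m ?S"
      using Dm S by (subst nn_integral_add) (auto simp: nn_integral_cmult nn_integral_cmult_indicator)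
    also have "\<dots> \<le> ennreal \<alpha> * \<nu> a b + ennreal \<beta> * ennreal (\<Gamma> * (b - a))"
    proof (intro add_mono mult_left_mono)
      show "(\<integral>\<^sup>+x\<in>?S. ennreal (\<bar>Du x\<bar> powr p) \<partial>m) \<le> \<nu> a b"
        unfolding \<nu>_def using st by (intro nn_integral_mono) (auto split: split_indicator)
      have "emeasure m ?S \<le> emeasure \<omega> {a..<b}" using st by (intro slab_le ab) auto
      also have "\<dots> \<le> ennreal (\<Gamma> * (b - a))" by (intro \<omega>_le ab \<Gamma>)
      finally show "emeasure m ?S \<le> ennreal (\<Gamma> * (b - a))" .
    qed auto
    also have "\<nu> a b = ennreal (enn2real (\<nu> a b))" using \<nu>_finite[of a b] by (simp add: ennreal_enn2real_if less_top[symmetric])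
    also have "ennreal \<alpha> * ennreal (enn2real (\<nu> a b)) + ennreal \<beta> * ennreal (\<Gamma> * (b - a)) = ennreal ?R"
      unfolding R using \<alpha> \<beta> \<Gamma>(2) ab(3) by (simp add: ennreal_mult ennreal_plus)
    finally have "ennreal (C * \<gamma> * (t - s)) \<le> ennreal ?R"
      using C \<gamma>(2) st by (simp add: ennreal_mult)
    then show ?thesis using R0 by (simp add: ennreal_le_iff)
  qed
  define d where "d = us a - us b"
  have "0 \<le> d" using ustar_antimono[OF ab] by (simp add: d_def)
  show ?thesis
  proof (cases "d = 0")
    case True
    then show ?thesis using R0 by (simp add: d_def)
  next
    case False
    with \<open>0 \<le> d\<close> have "0 < d" by simp
    have "C * \<gamma> * d \<le> ?R"
    proof (rule field_le_mult_one_interval)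
      fix z :: real assume z: "0 < z" "z < 1"
      \<comment> \<open>\<open>*\<close> needs levels strictly between the end values, so the gap is
        shrunk symmetrically to \<open>z * d\<close>; since \<open>z < 1\<close> is arbitrary, the
        full increment follows.\<close>
      define e where "e = (1 - z) / 2 * d"
      have "0 < e" using z \<open>0 < d\<close> by (simp add: e_def)
      have "z * d = (us a - e) - (us b + e)" unfolding d_def[symmetric] by (simp add: e_def d_def field_simps)
      moreover have "0 < z * d" using z \<open>0 < d\<close> by simp
      ultimately have "C * \<gamma> * (z * d) \<le> ?R" using *[of "us b + e" "us a - e"] \<open>0 < e\<close> by auto
      then show "z * (C * \<gamma> * d) \<le> ?R" by (simp add: ac_simps)
    qed
    then show ?thesis by (simp add: d_def)
  qed
qed


section \<open>Absolute continuity of the rearrangement\<close>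

abbreviation "energy \<equiv> \<integral>\<^sup>+x\<in>\<Omega>. ennreal (\<bar>Du x\<bar> powr p) \<partial>m"

lemma slab_sets: "{x \<in> \<Omega>. s < u x \<and> u x < t} \<in> sets m"
proof -
  note u [measurable]
  show ?thesis by (intro pred_sets) measurable
qed

lemma sum_\<nu>_le:
  fixes \<alpha> \<beta> :: "nat \<Rightarrow> real"
  assumes sub: "\<And>i. i < n \<Longrightarrow> \<alpha> i \<in> \<Omega>s \<and> \<beta> i \<in> \<Omega>s \<and> \<alpha> i \<le> \<beta> i"
    and disj: "disjoint_family_on (\<lambda>i. {\<alpha> i<..<\<beta> i}) {..<n}"
  shows "(\<Sum>i<n. enn2real (\<nu> (\<alpha> i) (\<beta> i))) \<le> enn2real energy"
proof -
  let ?S = "\<lambda>i. {x \<in> \<Omega>. us (\<beta> i) < u x \<and> u x < us (\<alpha> i)}"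
  have dS: "disjoint_family_on ?S {..<n}"
    unfolding disjoint_family_on_def
  proof (intro ballI impI)
    fix i j assume ij: "i \<in> {..<n}" "j \<in> {..<n}" "i \<noteq> j"
    show "?S i \<inter> ?S j = {}"
    \<comment> \<open>A degenerate interval has an empty interior, so disjointness does not order it
      relative to the other one; but its slab is empty.\<close>
    proof (cases "\<alpha> i = \<beta> i \<or> \<alpha> j = \<beta> j")
      case False
      then have lt: "\<alpha> i < \<beta> i" "\<alpha> j < \<beta> j" using ij sub by (auto simp: less_le)
      have "\<beta> i \<le> \<alpha> j \<or> \<beta> j \<le> \<alpha> i"
      proof (rule ccontr)
        assume "\<not> ?thesis"
        then have "max (\<alpha> i) (\<alpha> j) < min (\<beta> i) (\<beta> j)" using lt by auto
        then obtain z where "max (\<alpha> i) (\<alpha> j) < z" "z < min (\<beta> i) (\<beta> j)" using dense by blast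
        then have "z \<in> {\<alpha> i<..<\<beta> i} \<inter> {\<alpha> j<..<\<beta> j}" by auto
        moreover have "{\<alpha> i<..<\<beta> i} \<inter> {\<alpha> j<..<\<beta> j} = {}"
          using disj ij by (auto simp: disjoint_family_on_def)
        ultimately show False by blast
      qed
      then have "us (\<alpha> j) \<le> us (\<beta> i) \<or> us (\<alpha> i) \<le> us (\<beta> j)"
        using sub ij ustar_antimono by auto
      then show ?thesis by auto
    qed auto
  qed
  have "(\<Sum>i<n. \<nu> (\<alpha> i) (\<beta> i)) = (\<integral>\<^sup>+x. (\<Sum>i<n. ennreal (\<bar>Du x\<bar> powr p) * indicator (?S i) x) \<partial>m)"
    unfolding \<nu>_def by (intro nn_integral_sum[symmetric] Du_powr_borel slab_sets) auto
  also have "\<dots> \<le> energy"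
  proof (rule nn_integral_mono)
    fix x
    have "(\<Sum>i<n. indicator (?S i) x :: ennreal) = indicator (\<Union>i\<in>{..<n}. ?S i) x"
      using dS by (subst indicator_UN_disjoint) auto
    also have "\<dots> \<le> indicator \<Omega> x" by (auto split: split_indicator)
    finally show "(\<Sum>i<n. ennreal (\<bar>Du x\<bar> powr p) * indicator (?S i) x) \<le> ennreal (\<bar>Du x\<bar> powr p) * indicator \<Omega> x"
      by (simp add: mult_left_mono flip: sum_distrib_left)
  qed
  finally have "enn2real (\<Sum>i<n. \<nu> (\<alpha> i) (\<beta> i)) \<le> enn2real energy"
    using energy_finite by (intro enn2real_mono) auto
  moreover have "enn2real (\<Sum>i<n. \<nu> (\<alpha> i) (\<beta> i)) = (\<Sum>i<n. enn2real (\<nu> (\<alpha> i) (\<beta> i)))"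
    using \<nu>_finite by (simp add: enn2real_sum)
  ultimately show ?thesis by simp
qed

lemma loc_abs_continuous_ustar: "loc_abs_continuous_on \<Omega>s us"
  unfolding loc_abs_continuous_on_def abs_continuous_on_def
proof (intro allI impI)
  fix a b e :: real
  assume ab: "a \<le> b \<and> {a..b} \<subseteq> \<Omega>s" and e: "0 < e"
  then have sub: "{a..b} \<subseteq> I" using mem_\<Omega>s(3) by blast
  obtain x where x: "x \<in> {a..b}" "\<And>y. y \<in> {a..b} \<Longrightarrow> g x \<le> g y"
    using continuous_attains_inf[of "{a..b}" g] continuous_on_subset[OF g(1) sub] ab by auto
  obtain y where y: "y \<in> {a..b}" "\<And>z. z \<in> {a..b} \<Longrightarrow> g z \<le> g y"
    using continuous_attains_sup[of "{a..b}" g] continuous_on_subset[OF g(1) sub] ab by auto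
  define \<gamma> where "\<gamma> = g x"
  define \<Gamma> where "\<Gamma> = g y"
  have \<gamma>: "0 < \<gamma>" "\<And>z. z \<in> {a..b} \<Longrightarrow> \<gamma> \<le> g z" and \<Gamma>: "0 < \<Gamma>" "\<And>z. z \<in> {a..b} \<Longrightarrow> g z \<le> \<Gamma>"
    using x y g(2) sub by (auto simp: \<gamma>_def \<Gamma>_def)
  \<comment> \<open>Half of \<open>C * \<gamma> * e\<close> for each term: first \<open>k\<close> is
    taken so large that the energy term is at most \<open>e'\<close>, then \<open>d = e' / B\<close>
    keeps the length term below \<open>e'\<close>.\<close>
  define e' where "e' = C * \<gamma> * e / 2"
  have e': "0 < e'" using C \<gamma> e by (simp add: e'_def)
  obtain k where k: "0 < k" "enn2real energy / (p * e') \<le> k powr (p - 1)"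
    using ex_large_powr[of "p - 1" "enn2real energy / (p * e')"] p by auto
  define A where "A = 1 / (p * k powr (p - 1))"
  define B where "B = k * (1 - 1 / p) * \<Gamma>"
  have A0: "0 \<le> A" using p k unfolding A_def by auto
  have B0: "0 < B" using p k \<Gamma> unfolding B_def by (intro mult_pos_pos) auto
  have AT: "A * enn2real energy \<le> e'"
    using k p e' unfolding A_def by (simp add: field_simps)
  show "\<exists>d>0. \<forall>(n::nat) \<alpha> \<beta>. (\<forall>i<n. a \<le> \<alpha> i \<and> \<alpha> i \<le> \<beta> i \<and> \<beta> i \<le> b) \<and>
      disjoint_family_on (\<lambda>i. {\<alpha> i<..<\<beta> i}) {..<n} \<and> (\<Sum>i<n. \<beta> i - \<alpha> i) < d \<longrightarrow>
      (\<Sum>i<n. \<bar>us (\<beta> i) - us (\<alpha> i)\<bar>) < e"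
  proof (intro exI[of _ "e' / B"] conjI allI impI)
    show "0 < e' / B" using e' B0 by simp
    fix n :: nat and \<alpha> \<beta> :: "nat \<Rightarrow> real"
    assume *: "(\<forall>i<n. a \<le> \<alpha> i \<and> \<alpha> i \<le> \<beta> i \<and> \<beta> i \<le> b) \<and>
      disjoint_family_on (\<lambda>i. {\<alpha> i<..<\<beta> i}) {..<n} \<and> (\<Sum>i<n. \<beta> i - \<alpha> i) < e' / B"
    have mem: "\<alpha> i \<in> \<Omega>s" "\<beta> i \<in> \<Omega>s" "\<alpha> i \<le> \<beta> i" "{\<alpha> i..\<beta> i} \<subseteq> {a..b}" if "i < n" for i
      using * that ab by (auto simp: subset_eq)
    have "(\<Sum>i<n. enn2real (\<nu> (\<alpha> i) (\<beta> i))) \<le> enn2real energy"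
      using * mem by (intro sum_\<nu>_le) auto
    then have 1: "A * (\<Sum>i<n. enn2real (\<nu> (\<alpha> i) (\<beta> i))) \<le> A * enn2real energy"
      by (rule mult_left_mono[OF _ A0])
    have 2: "B * (\<Sum>i<n. \<beta> i - \<alpha> i) < B * (e' / B)" using * B0 by (intro mult_strict_left_mono) auto
    have "C * \<gamma> * (\<Sum>i<n. \<bar>us (\<beta> i) - us (\<alpha> i)\<bar>) = (\<Sum>i<n. C * \<gamma> * (us (\<alpha> i) - us (\<beta> i)))"
      unfolding sum_distrib_left
    proof (intro sum.cong refl)
      fix i assume "i \<in> {..<n}"
      then have "us (\<beta> i) \<le> us (\<alpha> i)" using mem[of i] by (intro ustar_antimono) auto
      then show "C * \<gamma> * \<bar>us (\<beta> i) - us (\<alpha> i)\<bar> = C * \<gamma> * (us (\<alpha> i) - us (\<beta> i))" by simp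
    qed
    also have "\<dots> \<le> (\<Sum>i<n. A * enn2real (\<nu> (\<alpha> i) (\<beta> i)) + B * (\<beta> i - \<alpha> i))"
    proof (rule sum_mono)
      fix i assume i: "i \<in> {..<n}"
      have "C * \<gamma> * (us (\<alpha> i) - us (\<beta> i))
        \<le> enn2real (\<nu> (\<alpha> i) (\<beta> i)) / (p * k powr (p - 1)) + k * (1 - 1 / p) * \<Gamma> * (\<beta> i - \<alpha> i)"
        using i mem[of i] \<gamma> \<Gamma> k(1) by (intro increment_le) auto
      then show "C * \<gamma> * (us (\<alpha> i) - us (\<beta> i)) \<le> A * enn2real (\<nu> (\<alpha> i) (\<beta> i)) + B * (\<beta> i - \<alpha> i)"
        by (simp add: A_def B_def)
    qed
    also have "\<dots> = A * (\<Sum>i<n. enn2real (\<nu> (\<alpha> i) (\<beta> i))) + B * (\<Sum>i<n. \<beta> i - \<alpha> i)"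
      by (simp only: sum.distrib sum_distrib_left)
    also have "\<dots> < A * enn2real energy + B * (e' / B)" by (rule add_le_less_mono[OF 1 2])
    also have "\<dots> \<le> C * \<gamma> * e" using AT B0 by (simp add: e'_def)
    finally show "(\<Sum>i<n. \<bar>us (\<beta> i) - us (\<alpha> i)\<bar>) < e" using C \<gamma>(1) by simp
  qed
qed

section \<open>Continuity and differentiability of the rearrangement\<close>

lemma continuous_on_ustar: "continuous_on \<Omega>s us"
  unfolding continuous_on_eq_continuous_at[OF open_\<Omega>s] continuous_at_eps_delta
proof (intro ballI allI impI)
  fix x e :: real assume x: "x \<in> \<Omega>s" and e: "0 < e"
  obtain r where r: "0 < r" "cball x r \<subseteq> \<Omega>s" using open_\<Omega>s x open_contains_cball by blast
  then have sub: "{x - r..x + r} \<subseteq> \<Omega>s" by (simp add: cball_eq_atLeastAtMost)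
  have "abs_continuous_on (x - r) (x + r) us"
    using loc_abs_continuous_ustar sub r(1) unfolding loc_abs_continuous_on_def by auto
  from this[unfolded abs_continuous_on_def, rule_format, OF e]
  obtain d where d: "0 < d"
    and *: "\<forall>(n::nat) \<alpha> \<beta>. (\<forall>i<n. x - r \<le> \<alpha> i \<and> \<alpha> i \<le> \<beta> i \<and> \<beta> i \<le> x + r) \<and>
        disjoint_family_on (\<lambda>i. {\<alpha> i<..<\<beta> i}) {..<n} \<and> (\<Sum>i<n. \<beta> i - \<alpha> i) < d \<longrightarrow>
        (\<Sum>i<n. \<bar>us (\<beta> i) - us (\<alpha> i)\<bar>) < e"
    by blast
  have "\<bar>us y - us x\<bar> < e" if y: "\<bar>y - x\<bar> < min d r" for y
  proof -
    have "max x y - min x y < d" "x - r \<le> min x y" "max x y \<le> x + r" "min x y \<le> max x y"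
      using y r(1) by linarith+
    then have "\<bar>us (max x y) - us (min x y)\<bar> < e"
      using *[rule_format, of 1 "\<lambda>_. min x y" "\<lambda>_. max x y"] by (simp add: disjoint_family_on_def)
    then show ?thesis by (cases "x \<le> y") (auto simp: max_def min_def abs_minus_commute)
  qed
  then show "\<exists>d>0. \<forall>y. dist y x < d \<longrightarrow> dist (us y) (us x) < e"
    using d r(1) by (intro exI[of _ "min d r"]) (auto simp: dist_real_def)
qed

text \<open>Clamping the argument to \<open>{a..b}\<close> and changing the sign gives an increasing
  continuous function on the whole line that equals \<open>- us\<close> near interior points.
  Intervals with rational ends cover \<open>Omega_star\<close>.\<close>

lemma AE_differentiable_ustar: "AE x in lborel. x \<in> \<Omega>s \<longrightarrow> us differentiable (at x)"
proof -
  have "AE x in lborel. a < x \<and> x < b \<longrightarrow> us differentiable (at x)" if ab: "a \<in> \<Omega>s" "b \<in> \<Omega>s" "a \<le> b" for a b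
  proof -
    define c where "c x = max a (min b x)" for x
    have c: "c x \<in> {a..b}" for x using ab by (auto simp: c_def)
    define f where "f x = - us (c x)" for x
    have sub: "{a..b} \<subseteq> \<Omega>s" by (rule \<Omega>s_interval[OF ab(1,2)])
    have "mono f"
    proof (rule monoI)
      fix x y :: real assume "x \<le> y"
      then have "c x \<le> c y" by (auto simp: c_def)
      then show "f x \<le> f y" using ustar_antimono[OF subsetD[OF sub c] subsetD[OF sub c]] by (auto simp: f_def)
    qed
    moreover have "continuous_on UNIV f"
    proof -
      have "continuous_on UNIV c" unfolding c_def by (intro continuous_intros)
      then have "continuous_on UNIV (\<lambda>x. us (c x))"
        using c sub by (intro continuous_on_compose2[OF continuous_on_ustar]) auto
      then show ?thesis unfolding f_def by (intro continuous_on_minus)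
    qed
    ultimately have "AE x in lborel. f differentiable (at x)" by (rule mono_continuous_differentiable_AE)
    then show ?thesis
    proof eventually_elim
      case (elim x)
      show ?case
      proof
        assume x: "a < x \<and> x < b"
        have "(\<lambda>y. - f y) differentiable (at x)" using elim by (rule differentiable_minus)
        moreover have "\<forall>\<^sub>F y in nhds x. us y = - f y"
          using eventually_nhds_in_open[of "{a<..<b}" x] x
          by (auto elim!: eventually_mono simp: f_def c_def max_def min_def)
        ultimately show "us differentiable (at x)"
          using x unfolding real_differentiable_def by (metis DERIV_cong_ev)
      qed
    qed
  qed
  then have "AE x in lborel. \<forall>ab\<in>\<rat> \<times> \<rat>. fst ab \<in> \<Omega>s \<and> snd ab \<in> \<Omega>s \<and> fst ab \<le> snd ab \<longrightarrow>
     fst ab < x \<and> x < snd ab \<longrightarrow> us differentiable (at x)"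
    by (subst AE_ball_countable) (auto intro: countable_rat)
  then show ?thesis
  proof eventually_elim
    case (elim x)
    show ?case
    proof
      assume x: "x \<in> \<Omega>s"
      obtain r where r: "0 < r" "ball x r \<subseteq> \<Omega>s" using open_\<Omega>s x openE by blast
      obtain a where a: "a \<in> \<rat>" "x - r < a" "a < x" using Rats_dense_in_real[of "x - r" x] r by auto
      obtain b where b: "b \<in> \<rat>" "x < b" "b < x + r" using Rats_dense_in_real[of x "x + r"] r by auto
      have "a \<in> ball x r" "b \<in> ball x r" using a b by (auto simp: dist_real_def)
      then have "a \<in> \<Omega>s" "b \<in> \<Omega>s" using r(2) by blast+
      then show "us differentiable (at x)" using elim[rule_format, of "(a, b)"] a b by auto
    qed
  qed
qed

text \<open>Divided by \<open>h n\<close>, \<open>increment_le\<close> on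
  \<open>{x..x + h n}\<close> becomes \<open>key\<close> in the limit, for every \<open>k\<close>.
  With \<open>k = C * D\<close>, the slope at which the Young bound is sharp, the term
  \<open>k * (1 - 1 / p) * g x\<close> is absorbed by the left side and the factor \<open>p\<close>
  cancels.\<close>

lemma liminf_ge_energy_density:
  assumes x: "x \<in> \<Omega>s" and diff: "us differentiable (at x)" and h: "\<And>n. 0 < h n" "h \<longlonglongrightarrow> 0"
  shows "ennreal ((C * \<bar>deriv us x\<bar>) powr p * g x) \<le> liminf (\<lambda>n. ennreal (1 / h n) * \<nu> x (x + h n))"
    (is "_ \<le> ?L")
proof (cases "?L = \<infinity>")
  case False
  define L where "L = enn2real ?L"
  have L: "?L = ennreal L" "0 \<le> L" using False by (auto simp: L_def ennreal_enn2real_if)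
  have xI: "x \<in> I" by (rule mem_\<Omega>s(3)[OF x])
  have gx: "0 < g x" by (rule g(2)[OF xI])
  define D where "D = - deriv us x"
  have "(us has_field_derivative deriv us x) (at x)"
    using diff by (simp add: DERIV_deriv_iff_real_differentiable)
  then have "((\<lambda>t. (us (x + t) - us x) / t) \<longlongrightarrow> deriv us x) (at 0)" by (simp add: DERIV_def)
  moreover have "filterlim h (at 0) sequentially"
    using h by (auto simp: filterlim_at intro!: always_eventually less_imp_neq[symmetric])
  ultimately have "(\<lambda>n. (us (x + h n) - us x) / h n) \<longlonglongrightarrow> deriv us x"
    by (rule filterlim_compose)
  then have "(\<lambda>n. - ((us (x + h n) - us x) / h n)) \<longlonglongrightarrow> D" unfolding D_def by (rule tendsto_minus)
  then have q: "(\<lambda>n. (us x - us (x + h n)) / h n) \<longlonglongrightarrow> D" by (simp add: minus_divide_left)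
  have xh: "(\<lambda>n. x + h n) \<longlonglongrightarrow> x + 0" by (intro tendsto_intros h)
  have near: "\<forall>\<^sub>F n in sequentially. x + h n \<in> \<Omega>s"
    using xh open_\<Omega>s x by (auto dest: topological_tendstoD)
  have "0 \<le> D"
  proof (rule tendsto_lowerbound[OF q])
    show "\<forall>\<^sub>F n in sequentially. 0 \<le> (us x - us (x + h n)) / h n"
      using near
    proof eventually_elim
      case (elim n)
      then show ?case using ustar_antimono[OF x elim] h(1)[of n] by (auto intro!: divide_nonneg_pos)
    qed
  qed simp
  have key: "C * g x * D \<le> L / (p * k powr (p - 1)) + k * (1 - 1 / p) * g x" if k: "0 < k" for k
  proof -
    define A where "A = 1 / (p * k powr (p - 1))"
    define B where "B = k * (1 - 1 / p)"
    have A: "0 \<le> A" and B: "0 \<le> B" using p k unfolding A_def B_def by auto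
    have *: "C * (g x - e) * (D - e) \<le> A * (L + e) + B * (g x + e)" if e: "0 < e" "e < g x" for e
    proof -
      have "isCont g x" using g(1) I(1) xI by (simp add: continuous_on_eq_continuous_at)
      then obtain d where d: "0 < d" "\<And>y. \<bar>y - x\<bar> < d \<Longrightarrow> \<bar>g y - g x\<bar> < e"
        using e unfolding continuous_at_eps_delta dist_real_def by metis
      have "\<forall>\<^sub>F n in sequentially. x + h n < x + d" using order_tendstoD(2)[OF xh, of "x + d"] d by simp
      moreover have "\<forall>\<^sub>F n in sequentially. D - e < (us x - us (x + h n)) / h n"
        using order_tendstoD(1)[OF q] e by simp
      \<comment> \<open>The lower limit guarantees this bound only infinitely often; the other
        conditions hold eventually, so some \<open>n\<close> meets them all.\<close>
      moreover have "\<exists>\<^sub>F n in sequentially. ennreal (1 / h n) * \<nu> x (x + h n) < ennreal (L + e)"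
      proof (rule ccontr)
        assume "\<not> ?thesis"
        then have "\<forall>\<^sub>F n in sequentially. ennreal (L + e) \<le> ennreal (1 / h n) * \<nu> x (x + h n)"
          by (simp add: not_frequently not_less)
        then have "ennreal (L + e) \<le> ?L" by (rule Liminf_bounded)
        then show False using L e by (simp add: ennreal_le_iff)
      qed
      ultimately have "\<exists>\<^sub>F n in sequentially. (ennreal (1 / h n) * \<nu> x (x + h n) < ennreal (L + e)) \<and>
          x + h n < x + d \<and> D - e < (us x - us (x + h n)) / h n \<and> x + h n \<in> \<Omega>s"
        using near by (intro frequently_eventually_frequently eventually_conj) auto
      then obtain n where n: "ennreal (1 / h n) * \<nu> x (x + h n) < ennreal (L + e)"
          "x + h n < x + d" "D - e < (us x - us (x + h n)) / h n" "x + h n \<in> \<Omega>s"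
        by (auto dest: frequently_ex)
      have "enn2real (ennreal (1 / h n) * \<nu> x (x + h n)) \<le> enn2real (ennreal (L + e))"
        using n(1) by (intro enn2real_mono) auto
      then have \<nu>: "enn2real (\<nu> x (x + h n)) / h n \<le> L + e"
        using h(1)[of n] L(2) e by (simp add: enn2real_mult del: ennreal_plus)
      have "\<bar>g y - g x\<bar> < e" if "y \<in> {x..x + h n}" for y
        using that n(2) by (intro d) auto
      then have "C * (g x - e) * (us x - us (x + h n))
          \<le> enn2real (\<nu> x (x + h n)) / (p * k powr (p - 1)) + k * (1 - 1 / p) * (g x + e) * (x + h n - x)"
        using x n(4) h(1)[of n] e k gx by (intro increment_le) (auto simp: abs_less_iff less_imp_le algebra_simps)
      also have "\<dots> = A * enn2real (\<nu> x (x + h n)) + B * (g x + e) * h n"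
        by (simp add: A_def B_def)
      finally have "C * (g x - e) * (us x - us (x + h n)) / h n \<le> (A * enn2real (\<nu> x (x + h n)) + B * (g x + e) * h n) / h n"
        using h(1)[of n] by (intro divide_right_mono) auto
      also have "\<dots> = A * (enn2real (\<nu> x (x + h n)) / h n) + B * (g x + e)"
        using h(1)[of n] by (simp add: add_divide_distrib)
      also have "\<dots> \<le> A * (L + e) + B * (g x + e)"
        by (intro add_right_mono mult_left_mono \<nu> A)
      finally have "C * (g x - e) * ((us x - us (x + h n)) / h n) \<le> A * (L + e) + B * (g x + e)" by simp
      moreover have "C * (g x - e) * (D - e) \<le> C * (g x - e) * ((us x - us (x + h n)) / h n)"
        using n(3) C e by (intro mult_left_mono) auto
      ultimately show ?thesis by linarith
    qed
    have "C * (g x - 0) * (D - 0) \<le> A * (L + 0) + B * (g x + 0)"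
    proof (rule tendsto_le[of "at_right 0"])
      show "((\<lambda>e. A * (L + e) + B * (g x + e)) \<longlongrightarrow> A * (L + 0) + B * (g x + 0)) (at_right 0)"
        by (intro tendsto_intros)
      show "((\<lambda>e. C * (g x - e) * (D - e)) \<longlongrightarrow> C * (g x - 0) * (D - 0)) (at_right 0)"
        by (intro tendsto_intros)
      show "\<forall>\<^sub>F e in at_right 0. C * (g x - e) * (D - e) \<le> A * (L + e) + B * (g x + e)"
        using eventually_at_right_less[of 0] eventually_at_right_real[OF gx]
        by eventually_elim (auto intro: *)
    qed simp
    then show ?thesis by (simp add: A_def B_def)
  qed
  have "(C * D) powr p * g x \<le> L"
  \<comment> \<open>\<open>key\<close> requires a positive \<open>k\<close>, so
    \<open>k = C * D\<close> is available only for nonzero \<open>D\<close>.\<close>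
  proof (cases "D = 0")
    case True
    then show ?thesis using L p by simp
  next
    case False
    then have CD: "0 < C * D" using \<open>0 \<le> D\<close> C by simp
    have "0 < (C * D) powr (p - 1)" using less_imp_neq[OF CD] unfolding powr_gt_zero by simp
    then have P: "0 < p * (C * D) powr (p - 1)" using p by (intro mult_pos_pos) auto
    have "C * g x * D \<le> L / (p * (C * D) powr (p - 1)) + (C * D) * (1 - 1 / p) * g x"
      by (rule key[OF CD])
    then have "(C * D) * g x / p \<le> L / (p * (C * D) powr (p - 1))"
      by (simp add: algebra_simps)
    then have "((C * D) * g x / p) * (p * (C * D) powr (p - 1)) \<le> L"
      by (subst (asm) pos_le_divide_eq[OF P])
    moreover have "(C * D) powr p = (C * D) * (C * D) powr (p - 1)"
      using CD by (simp add: powr_diff)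
    ultimately show ?thesis using p by (simp add: ac_simps)
  qed
  moreover have "\<bar>deriv us x\<bar> = D" using \<open>0 \<le> D\<close> by (simp add: D_def)
  ultimately show ?thesis using L by (simp add: ennreal_leI)
qed simp

text \<open>A point \<open>y\<close> contributes to the quotient at \<open>x\<close> only if
  \<open>us (x + h n) < u y < us x\<close>; by monotonicity such \<open>x\<close> form a set of
  diameter at most \<open>h n\<close>. So the quotients integrate to at most \<open>energy\<close>,
  and Fatou's lemma passes this to their lower limit, with no need to differentiate the energy
  distribution as a measure.\<close>

lemma energy_ustar_le:
  "ennreal (C powr p) * (\<integral>\<^sup>+x\<in>\<Omega>s. ennreal (\<bar>deriv us x\<bar> powr p) \<partial>\<omega>) \<le> energy"
proof -
  define M where "M = restrict_space m \<Omega>"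
  have spM: "space M = \<Omega>" by (simp add: M_def space_restrict_space metric_measure_space_space[OF m])
  have sfM: "sigma_finite_measure M"
    unfolding M_def by (intro sigma_finite_measure_restrict_space metric_measure_space_sigma_finite m \<Omega>_sets)
  have [measurable]: "u \<in> borel_measurable M" using u by (simp add: M_def)
  have [measurable]: "Du \<in> borel_measurable M"
    using Du by (simp add: local_minimal_weak_upper_gradient_def M_def)
  \<comment> \<open>Outside \<open>Omega_star\<close> the values of \<open>us\<close> have no
    meaning; extension by zero gives a Borel function on the line for the definition of
    \<open>B n\<close>.\<close>
  define w where "w x = us x * indicator \<Omega>s x" for x
  have [measurable]: "w \<in> borel_measurable borel"
    unfolding w_def using borel_measurable_continuous_on_indicator[OF _ continuous_on_ustar] open_\<Omega>s
    by (simp add: mult.commute)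
  have [measurable]: "\<Omega>s \<in> sets borel" using open_\<Omega>s by simp
  define h :: "nat \<Rightarrow> real" where "h n = 1 / real (Suc n)" for n
  have h: "0 < h n" for n by (simp add: h_def)
  have h0: "h \<longlonglongrightarrow> 0" unfolding h_def using LIMSEQ_Suc[OF lim_1_over_n[where 'a=real]] by simp
  define B where "B n = {z \<in> space (lborel \<Otimes>\<^sub>M M). fst z \<in> \<Omega>s \<and> fst z + h n \<in> \<Omega>s \<and>
    w (fst z + h n) < u (snd z) \<and> u (snd z) < w (fst z)}" for n
  have Bm [measurable]: "B n \<in> sets (lborel \<Otimes>\<^sub>M M)" for n unfolding B_def by measurable
  define A where "A n x = (\<integral>\<^sup>+y. ennreal (1 / h n) * ennreal (\<bar>Du y\<bar> powr p) * indicator (B n) (x, y) \<partial>M)" for n x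
  have Am [measurable]: "A n \<in> borel_measurable lborel" for n
    unfolding A_def by (intro sigma_finite_measure.borel_measurable_nn_integral[OF sfM]) measurable
  have A_eq: "A n x = ennreal (1 / h n) * \<nu> x (x + h n)" if "x \<in> \<Omega>s" "x + h n \<in> \<Omega>s" for n x
  proof -
    have "A n x = (\<integral>\<^sup>+y. ennreal (1 / h n) * (ennreal (\<bar>Du y\<bar> powr p) * indicator (B n) (x, y)) \<partial>M)"
      by (simp add: A_def mult.assoc)
    also have "\<dots> = ennreal (1 / h n) * (\<integral>\<^sup>+y. ennreal (\<bar>Du y\<bar> powr p) * indicator (B n) (x, y) \<partial>M)"
    proof (rule nn_integral_cmult)
      have "(\<lambda>z. ennreal (\<bar>Du (snd z)\<bar> powr p) * indicator (B n) z) \<in> borel_measurable (lborel \<Otimes>\<^sub>M M)" by measurable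
      then show "(\<lambda>y. ennreal (\<bar>Du y\<bar> powr p) * indicator (B n) (x, y)) \<in> borel_measurable M"
        using measurable_Pair2[of _ lborel M borel x] by force
    qed
    also have "(\<integral>\<^sup>+y. ennreal (\<bar>Du y\<bar> powr p) * indicator (B n) (x, y) \<partial>M) = \<nu> x (x + h n)"
      unfolding \<nu>_def M_def nn_integral_restrict_space[OF \<Omega>_sets(2)]
      using that by (intro nn_integral_cong)
        (auto split: split_indicator simp: B_def w_def space_pair_measure spM)
    finally show ?thesis .
  qed
  have A_le: "(\<integral>\<^sup>+x. A n x \<partial>lborel) \<le> energy" for n
  proof -
    have "(\<integral>\<^sup>+x. A n x \<partial>lborel) \<le> (\<integral>\<^sup>+y. ennreal (h n) * (ennreal (1 / h n) * ennreal (\<bar>Du y\<bar> powr p)) * indicator UNIV y \<partial>M)"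
      unfolding A_def
    proof (rule nn_integral_sections_le[OF sfM Bm])
      show "(\<lambda>y. ennreal (1 / h n) * ennreal (\<bar>Du y\<bar> powr p)) \<in> borel_measurable M" by measurable
      show "0 \<le> h n" using h[of n] by simp
      show "x' - x \<le> h n" if "(x, y) \<in> B n" "(x', y) \<in> B n" for x x' y
      proof (rule ccontr)
        assume "\<not> x' - x \<le> h n"
        then have "us x' \<le> us (x + h n)" using that by (intro ustar_antimono) (auto simp: B_def)
        then show False using that by (auto simp: B_def w_def)
      qed
    qed simp
    also have "\<dots> = (\<integral>\<^sup>+y. ennreal (\<bar>Du y\<bar> powr p) \<partial>M)"
    proof (rule nn_integral_cong)
      fix y
      have "ennreal (h n) * ennreal (1 / h n) = 1"
        using h[of n] by (subst ennreal_mult[symmetric]) auto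
      then show "ennreal (h n) * (ennreal (1 / h n) * ennreal (\<bar>Du y\<bar> powr p)) * indicator UNIV y = ennreal (\<bar>Du y\<bar> powr p)"
        by (simp flip: mult.assoc)
    qed
    also have "\<dots> = energy" unfolding M_def by (rule nn_integral_restrict_space[OF \<Omega>_sets(2)])
    finally show ?thesis .
  qed
  define L where "L x = liminf (\<lambda>n. A n x)" for x
  have Lm [measurable]: "L \<in> borel_measurable lborel" unfolding L_def by measurable
  have "(\<integral>\<^sup>+x. L x \<partial>lborel) \<le> liminf (\<lambda>n. \<integral>\<^sup>+x. A n x \<partial>lborel)"
    unfolding L_def by (rule nn_integral_liminf[OF Am])
  also have "\<dots> \<le> liminf (\<lambda>n. energy)" by (intro Liminf_mono always_eventually allI A_le)
  finally have LI: "(\<integral>\<^sup>+x. L x \<partial>lborel) \<le> energy" by (simp add: Liminf_const)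
  have pw: "AE x in lborel. x \<in> \<Omega>s \<longrightarrow> ennreal ((C * \<bar>deriv us x\<bar>) powr p * g x) \<le> L x"
    using AE_differentiable_ustar
  proof eventually_elim
    case (elim x)
    show ?case
    proof
      assume x: "x \<in> \<Omega>s"
      have xh: "(\<lambda>n. x + h n) \<longlonglongrightarrow> x + 0" by (intro tendsto_intros h0)
      then have "\<forall>\<^sub>F n in sequentially. x + h n \<in> \<Omega>s"
        using open_\<Omega>s x by (auto dest: topological_tendstoD)
      then have "\<forall>\<^sub>F n in sequentially. ennreal (1 / h n) * \<nu> x (x + h n) \<le> A n x"
        by eventually_elim (simp add: A_eq x)
      then have "liminf (\<lambda>n. ennreal (1 / h n) * \<nu> x (x + h n)) \<le> L x"
        unfolding L_def by (rule Liminf_mono)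
      then show "ennreal ((C * \<bar>deriv us x\<bar>) powr p * g x) \<le> L x"
        using liminf_ge_energy_density[OF x _ h h0] elim x by (meson order_trans)
    qed
  qed
  define G where "G x = ennreal (g x) * indicator I x" for x
  have Gm [measurable]: "G \<in> borel_measurable lborel" using density_borel by (simp add: G_def[abs_def])
  have \<omega>G: "\<omega> = density lborel G" unfolding G_def by (simp add: \<omega> weighted_measure_def)
  \<comment> \<open>A measurable majorant of the integrand. The change from \<open>\<omega>\<close>
    to Lebesgue measure is made for \<open>\<psi>\<close>, so no measurability of
    \<open>deriv us\<close> enters.\<close>
  define \<psi> where "\<psi> x = ennreal (1 / C powr p) * (L x * inverse (G x))" for x
  have "(\<integral>\<^sup>+x\<in>\<Omega>s. ennreal (\<bar>deriv us x\<bar> powr p) \<partial>\<omega>) \<le> (\<integral>\<^sup>+x. \<psi> x \<partial>\<omega>)"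
  proof (rule nn_integral_mono_AE)
    have "AE x in lborel. 0 < G x \<longrightarrow> ennreal (\<bar>deriv us x\<bar> powr p) * indicator \<Omega>s x \<le> \<psi> x"
      using pw
    proof eventually_elim
      case (elim x)
      show ?case
      proof
        assume "0 < G x"
        then have xI: "x \<in> I" by (auto simp: G_def split: split_indicator_asm)
        then have gx: "0 < g x" by (rule g(2))
        have Gx: "G x = ennreal (g x)" using xI by (simp add: G_def)
        show "ennreal (\<bar>deriv us x\<bar> powr p) * indicator \<Omega>s x \<le> \<psi> x"
        proof (cases "x \<in> \<Omega>s")
          case True
          have "ennreal (\<bar>deriv us x\<bar> powr p) = ennreal (1 / C powr p * ((C * \<bar>deriv us x\<bar>) powr p * g x * (1 / g x)))"
            using gx C by (simp add: powr_mult)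
          also have "\<dots> = ennreal (1 / C powr p) * (ennreal ((C * \<bar>deriv us x\<bar>) powr p * g x) * ennreal (1 / g x))"
            using gx by (intro trans[OF ennreal_mult] arg_cong2[where f=times] ennreal_mult refl) auto
          also have "\<dots> \<le> ennreal (1 / C powr p) * (L x * ennreal (1 / g x))"
            using elim True by (intro mult_left_mono mult_right_mono) auto
          also have "\<dots> = \<psi> x" using gx by (simp add: \<psi>_def Gx inverse_ennreal inverse_eq_divide)
          finally show ?thesis using True by simp
        qed simp
      qed
    qed
    then show "AE x in \<omega>. ennreal (\<bar>deriv us x\<bar> powr p) * indicator \<Omega>s x \<le> \<psi> x"
      unfolding \<omega>G by (subst AE_density) auto
  qed
  also have "\<dots> = (\<integral>\<^sup>+x. G x * \<psi> x \<partial>lborel)"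
    unfolding \<omega>G by (rule nn_integral_density) (auto simp: \<psi>_def)
  also have "\<dots> \<le> (\<integral>\<^sup>+x. ennreal (1 / C powr p) * L x \<partial>lborel)"
  proof (rule nn_integral_mono)
    fix x
    \<comment> \<open>Off \<open>I\<close> the product is
      \<open>0 * inverse 0 = 0 * top = 0\<close>.\<close>
    have "G x * inverse (G x) \<le> 1"
    proof (cases "x \<in> I")
      case True
      then show ?thesis using g(2)[OF True] by (simp add: G_def inverse_ennreal flip: ennreal_mult)
    qed (simp add: G_def)
    then have "ennreal (1 / C powr p) * L x * (G x * inverse (G x)) \<le> ennreal (1 / C powr p) * L x * 1"
      by (intro mult_left_mono) auto
    then show "G x * \<psi> x \<le> ennreal (1 / C powr p) * L x" by (simp add: \<psi>_def ac_simps)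
  qed
  also have "\<dots> = ennreal (1 / C powr p) * (\<integral>\<^sup>+x. L x \<partial>lborel)" by (rule nn_integral_cmult[OF Lm])
  also have "\<dots> \<le> ennreal (1 / C powr p) * energy" by (intro mult_left_mono LI) simp
  finally have "ennreal (C powr p) * (\<integral>\<^sup>+x\<in>\<Omega>s. ennreal (\<bar>deriv us x\<bar> powr p) \<partial>\<omega>)
      \<le> ennreal (C powr p) * (ennreal (1 / C powr p) * energy)"
    by (rule mult_left_mono) simp
  also have "\<dots> = energy"
    using C by (simp flip: mult.assoc ennreal_mult)
  finally show ?thesis .
qed

end

theorem theorem1p1:
  fixes m :: "'a::polish_space measure" and \<Omega> :: "'a set"
    and u Du :: "'a \<Rightarrow> real" and p C \<epsilon> :: real
    and I :: "real set" and g :: "real \<Rightarrow> real" and \<omega> :: "real measure"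
  assumes "metric_measure_space m"
    and "1 < p"
    and "open \<Omega>" and "\<Omega> \<noteq> {}"
    and "W1p_loc p m \<Omega> u"
    and "local_minimal_weak_upper_gradient p m \<Omega> u Du"
    and "\<And>t. ess_inf m \<Omega> u < ereal t \<Longrightarrow> distr_fun m \<Omega> u t < \<infinity>"
    and "open I" and "is_interval I"
    and "continuous_on I g" and "\<And>x. x \<in> I \<Longrightarrow> 0 < g x"
    and "\<omega> = weighted_measure I g"
    and "emeasure m \<Omega> \<le> emeasure \<omega> UNIV"
    and "\<And>x. x \<in> I \<Longrightarrow> emeasure \<omega> {..x} < \<infinity>"
    and "((\<lambda>x. emeasure \<omega> {..x}) \<longlongrightarrow> 0) at_bot"
    and "0 < C" and "0 < \<epsilon>"
    and "\<And>E. E \<in> sets borel \<Longrightarrow> E \<subseteq> open_nbhd \<epsilon> (ess_supp m \<Omega> u) \<inter> \<Omega> \<Longrightarrow> emeasure m E < \<infinity>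
           \<Longrightarrow> Per m E \<Omega> \<ge> ennreal (C * profile I g (emeasure m E))"
  shows "(\<integral>\<^sup>+x\<in>\<Omega>. ennreal (\<bar>Du x\<bar> powr p) \<partial>m)
           \<ge> ennreal (C powr p) *
             (\<integral>\<^sup>+x\<in>Omega_star m \<Omega> \<omega>. ennreal (\<bar>deriv (ustar m \<Omega> u \<omega>) x\<bar> powr p) \<partial>\<omega>)
         \<and> ((\<integral>\<^sup>+x\<in>\<Omega>. ennreal (\<bar>Du x\<bar> powr p) \<partial>m) < \<infinity>
             \<longrightarrow> loc_abs_continuous_on (Omega_star m \<Omega> \<omega>) (ustar m \<Omega> u \<omega>))"
proof (cases "(\<integral>\<^sup>+x\<in>\<Omega>. ennreal (\<bar>Du x\<bar> powr p) \<partial>m) < \<infinity>")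
  case True
  interpret isoperimetric_rearrangement I g \<omega> m \<Omega> u Du p C \<epsilon>
    using assms True by unfold_locales (auto simp: W1p_loc_def in_Lp_loc_def)
  show ?thesis using energy_ustar_le loc_abs_continuous_ustar by simp
next
  \<comment> \<open>With infinite energy the inequality is trivial and the implication
    vacuous.\<close>
  case False
  then show ?thesis by (simp add: less_top[symmetric])
qed

end
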